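(* Let $1\le d\le n-1$ and let $\lambda$ be a partition such that $\lambda\subset R_d$. Then $$\Phi_n\big(\mathfrak{G}^Q_{w_{\lambda,d}}\big)=\frac{g_{\lambda^\vee}}{\tau_d}.$$
   Context: Let $n\ge2$. Rings and the isomorphism $\Phi_n$. For $1\le i\le m\le n$ put $$F_i^{(m)}=\sum_{I\subset\{1,\dots,m\},\ \#I=i}\ \prod_{j\in I}z_j\prod_{j\in I,\ j+1\notin I}(1-Q_j),\qquad Q_n:=0,$$ $F^{(m)}_0=1$, and $F_i:=F_i^{(n)}$. Let $\mathcal{QK}(Fl_n):=\mathbb{C}[z_1,\dots,z_n,Q_1,\dots,Q_{n-1}]/\langle F_i-\binom{n}{i}\,(1\le i\le n)\rangle$, and let $\mathcal{QK}(Fl_n)_{\mathrm{loc}}$ be its localization inverting $Q_1,\dots,Q_{n-1}$. Set $x_i=1-z_i$. Let $\Lambda=\mathbb{C}[h_1,h_2,\dots]$ be the ring of symmetric functions ($h_0=1$, $h_k=0$ for $k<0$), $\Lambda_{(n)}=\mathbb{C}[h_1,\dots,h_{n-1}]$. For a partition $\lambda$ of length $\ell$ put $g_\lambda=\det\big(\sum_{m\ge0}(-1)^m\binom{1-i}{m}h_{\lambda_i+j-i-m}\big)_{1\le i,j\le\ell}$, $g_\emptyset=1$ (dual stable Grothendieck polynomial). Let $R_i$ be the rectangle with $i$ rows and $n-i$ columns, $\tau_i=g_{R_i}$, $\sigma_i=\sum_{\mu\subset R_i}g_\mu$ for $1\le i\le n-1$, and $\tau_0=\sigma_0=\tau_n=\sigma_n=1$.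 Then $$\Phi_n:\mathcal{QK}(Fl_n)_{\mathrm{loc}}\to\Lambda_{(n)}[\sigma_i^{-1},\tau_i^{-1}\,(1\le i\le n-1)]$$ is the ring isomorphism given by $z_i\mapsto\frac{\tau_i\sigma_{i-1}}{\sigma_i\tau_{i-1}}$ $(1\le i\le n)$, $Q_i\mapsto\frac{\tau_{i-1}\tau_{i+1}}{\tau_i^2}$ $(1\le i\le n-1)$. Grothendieck polynomials. For $1\le i\le n-1$ let $\pi_if=\frac{(1-x_{i+1})f-(1-x_i)s_if}{x_i-x_{i+1}}$ on polynomials in $x_1,\dots,x_n$, where $s_i$ exchanges $x_i,x_{i+1}$. The Grothendieck polynomials $\mathfrak{G}_w$ ($w\in S_n$) are the unique polynomials with $\mathfrak{G}_{w_0}=x_1^{n-1}x_2^{n-2}\cdots x_{n-1}$ ($w_0$ the longest permutation) and $\pi_i\mathfrak{G}_w=\mathfrak{G}_{ws_i}$ if $\ell(ws_i)=\ell(w)-1$, $\pi_i\mathfrak{G}_w=\mathfrak{G}_w$ if $\ell(ws_i)=\ell(w)+1$. Quantum Grothendieck polynomials. Let $f_i^{(j)}=e_i(1-x_1,\dots,1-x_j)$ ($e_i$ elementary symmetric, $f_0^{(j)}=1$). The products $f^{(1)}_{i_1}f^{(2)}_{i_2}\cdots f^{(n-1)}_{i_{n-1}}$ with $0\le i_j\le j$ form a basis of a subspace $L_n\subset\mathbb{C}[x_1,\dots,x_n]$, which contains all $\mathfrak{G}_w$ ($w\in S_n$). The quantization map $\widehat Q$ is the $\mathbb{C}$-linear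 map on $L_n$ with $\widehat Q(f^{(1)}_{i_1}\cdots f^{(n-1)}_{i_{n-1}})=F^{(1)}_{i_1}\cdots F^{(n-1)}_{i_{n-1}}$, with values regarded in $\mathcal{QK}(Fl_n)$ (with $z_j=1-x_j$). Put $\mathfrak{G}_w^Q=\widehat Q(\mathfrak{G}_w)$. Grassmannian permutations. For a partition $\lambda=(\lambda_1\ge\dots\ge\lambda_d\ge0)\subset R_d$ (i.e. $\lambda_1\le n-d$), $w_{\lambda,d}\in S_n$ is the permutation with $w_{\lambda,d}(a)=\lambda_{d+1-a}+a$ for $1\le a\le d$ and $w_{\lambda,d}(d+1)<\dots<w_{\lambda,d}(n)$. Also $\lambda^\vee=(n-d-\lambda_d,\dots,n-d-\lambda_1)$. *)

theory Defs
  imports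
    "HOL-Library.Poly_Mapping"
    "HOL-Combinatorics.Permutations"
    "HOL-Computational_Algebra.Fraction_Field"
    "HOL-Algebra.QuotRing"
    "Jordan_Normal_Form.Determinant"
begin

section \<open>Multivariate polynomials\<close>

text \<open>Polynomials over the complex numbers in variables indexed by \<open>'v\<close>: finitely supported
  functions from monomials (exponent vectors) to coefficients, with the convolution product of
  \<^theory>\<open>HOL-Library.Poly_Mapping\<close>.\<close>

type_synonym 'v mpoly = "('v \<Rightarrow>\<^sub>0 nat) \<Rightarrow>\<^sub>0 complex"

definition Const :: "complex \<Rightarrow> 'v mpoly" where
  "Const c = Poly_Mapping.single 0 c"

definition Var :: "'v \<Rightarrow> 'v mpoly" where
  "Var v = Poly_Mapping.single (Poly_Mapping.single v 1) 1"

definition polys_in :: "'v set \<Rightarrow> 'v mpoly set" where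
  "polys_in V = {p. \<forall>m \<in> Poly_Mapping.keys p. Poly_Mapping.keys m \<subseteq> V}"

definition poly_ring :: "'v set \<Rightarrow> 'v mpoly ring" where
  "poly_ring V = \<lparr>carrier = polys_in V, monoid.mult = (*), one = 1, zero = 0, add = (+)\<rparr>"


section \<open>Localization of a commutative ring\<close>

definition loc_rel :: "('a, 'm) ring_scheme \<Rightarrow> 'a set \<Rightarrow> (('a \<times> 'a) \<times> ('a \<times> 'a)) set" where
  "loc_rel R S = {((a, s), (b, t)). a \<in> carrier R \<and> s \<in> S \<and> b \<in> carrier R \<and> t \<in> S \<and>
     (\<exists>u \<in> S. u \<otimes>\<^bsub>R\<^esub> (t \<otimes>\<^bsub>R\<^esub> a) = u \<otimes>\<^bsub>R\<^esub> (s \<otimes>\<^bsub>R\<^esub> b))}"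

text \<open>The fraction \<open>a/s\<close>.\<close>

definition loc_frac :: "('a, 'm) ring_scheme \<Rightarrow> 'a set \<Rightarrow> 'a \<Rightarrow> 'a \<Rightarrow> ('a \<times> 'a) set" where
  "loc_frac R S a s = loc_rel R S `` {(a, s)}"

definition localization :: "('a, 'm) ring_scheme \<Rightarrow> 'a set \<Rightarrow> ('a \<times> 'a) set ring" where
  "localization R S =
    \<lparr>carrier = (carrier R \<times> S) // loc_rel R S,
     monoid.mult = (\<lambda>X Y. \<Union>(a, s) \<in> X. \<Union>(b, t) \<in> Y. loc_frac R S (a \<otimes>\<^bsub>R\<^esub> b) (s \<otimes>\<^bsub>R\<^esub> t)),
     one = loc_frac R S \<one>\<^bsub>R\<^esub> \<one>\<^bsub>R\<^esub>,
     zero = loc_frac R S \<zero>\<^bsub>R\<^esub> \<one>\<^bsub>R\<^esub>,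
     add = (\<lambda>X Y. \<Union>(a, s) \<in> X. \<Union>(b, t) \<in> Y.
              loc_frac R S ((t \<otimes>\<^bsub>R\<^esub> a) \<oplus>\<^bsub>R\<^esub> (s \<otimes>\<^bsub>R\<^esub> b)) (s \<otimes>\<^bsub>R\<^esub> t))\<rparr>"


section \<open>The ring \<open>QK(Fl_n)\<close> and its localization\<close>

datatype zq = Zvar nat | Qvar nat

text \<open>The polynomials \<open>z_j\<close> and \<open>Q_j\<close>, with the convention \<open>Q_n = 0\<close>.\<close>

definition zpoly :: "nat \<Rightarrow> zq mpoly" where
  "zpoly j = Var (Zvar j)"

definition Qpoly :: "nat \<Rightarrow> nat \<Rightarrow> zq mpoly" where
  "Qpoly n j = (if j = n then 0 else Var (Qvar j))"

text \<open>\<open>Fpoly n m i\<close> is \<open>F_i^{(m)}\<close>; for \<open>i = 0\<close> the sum is 1.\<close>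

definition Fpoly :: "nat \<Rightarrow> nat \<Rightarrow> nat \<Rightarrow> zq mpoly" where
  "Fpoly n m i =
    (\<Sum>I | I \<subseteq> {1..m} \<and> card I = i.
       (\<Prod>j\<in>I. zpoly j) * (\<Prod>j | j \<in> I \<and> j + 1 \<notin> I. 1 - Qpoly n j))"

definition zq_ring :: "nat \<Rightarrow> zq mpoly ring" where
  "zq_ring n = poly_ring (Zvar ` {1..n} \<union> Qvar ` {1..n-1})"

definition QK_ideal :: "nat \<Rightarrow> zq mpoly set" where
  "QK_ideal n = Idl\<^bsub>zq_ring n\<^esub> {Fpoly n n i - of_nat (n choose i) | i. i \<in> {1..n}}"

definition QK :: "nat \<Rightarrow> zq mpoly set ring" where
  "QK n = zq_ring n Quot QK_ideal n"

definition QK_class :: "nat \<Rightarrow> zq mpoly \<Rightarrow> zq mpoly set" where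
  "QK_class n p = QK_ideal n +>\<^bsub>zq_ring n\<^esub> p"

definition Q_monomials :: "nat \<Rightarrow> zq mpoly set set" where
  "Q_monomials n = {QK_class n (\<Prod>i\<in>{1..n-1}. Qpoly n i ^ k i) | k. True}"

definition QK_loc :: "nat \<Rightarrow> (zq mpoly set \<times> zq mpoly set) set ring" where
  "QK_loc n = localization (QK n) (Q_monomials n)"

text \<open>The canonical map from \<open>QK(Fl_n)\<close> to its localization.\<close>

definition to_loc :: "nat \<Rightarrow> zq mpoly set \<Rightarrow> (zq mpoly set \<times> zq mpoly set) set" where
  "to_loc n a = loc_frac (QK n) (Q_monomials n) a \<one>\<^bsub>QK n\<^esub>"


section \<open>Partitions and dual stable Grothendieck polynomials\<close>

text \<open>Partitions are 0-based: \<open>lam k\<close> is the part \<open>\<lambda>_{k+1}\<close>. Containment of Young diagrams is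
  the pointwise order on functions.\<close>

definition is_partition :: "(nat \<Rightarrow> nat) \<Rightarrow> bool" where
  "is_partition lam \<longleftrightarrow> antimono lam \<and> finite {k. lam k \<noteq> 0}"

definition plength :: "(nat \<Rightarrow> nat) \<Rightarrow> nat" where
  "plength lam = card {k. lam k \<noteq> 0}"

definition rect :: "nat \<Rightarrow> nat \<Rightarrow> nat \<Rightarrow> nat" where
  "rect n i = (\<lambda>k. if k < i then n - i else 0)"

definition dual_partition :: "nat \<Rightarrow> nat \<Rightarrow> (nat \<Rightarrow> nat) \<Rightarrow> nat \<Rightarrow> nat" where
  "dual_partition n d lam = (\<lambda>k. if k < d then n - d - lam (d - 1 - k) else 0)"

text \<open>\<open>Var k\<close> stands for \<open>h_k\<close> when \<open>k \<ge> 1\<close>.\<close>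

definition hsym :: "int \<Rightarrow> nat mpoly" where
  "hsym k = (if k < 0 then 0 else if k = 0 then 1 else Var (nat k))"

text \<open>Matrix indices start at 0, so \<open>i\<close> and \<open>j\<close> are one less than in the usual formula, and
  the top of the binomial coefficient is \<open>-i\<close>. The sum over \<open>m\<close> is cut off where
  \<open>h_{\<lambda>_i + j - i - m}\<close> vanishes.\<close>

definition dual_groth :: "(nat \<Rightarrow> nat) \<Rightarrow> nat mpoly" where
  "dual_groth lam =
    det (mat (plength lam) (plength lam) (\<lambda>(i, j).
      \<Sum>m\<in>{0..nat (int (lam i) + int j - int i)}.
        Const ((- 1) ^ m * ((- of_nat i) gchoose m)) *
        hsym (int (lam i) + int j - int i - int m)))"

text \<open>For \<open>i = 0\<close> and \<open>i = n\<close> the rectangle is empty, so these give the conventional value 1.\<close>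

definition tau :: "nat \<Rightarrow> nat \<Rightarrow> nat mpoly" where
  "tau n i = dual_groth (rect n i)"

definition sigma :: "nat \<Rightarrow> nat \<Rightarrow> nat mpoly" where
  "sigma n i = (\<Sum>mu | is_partition mu \<and> mu \<le> rect n i. dual_groth mu)"

text \<open>The ring \<open>\<Lambda>_(n)[\<sigma>_i^{-1}, \<tau>_i^{-1}]\<close>, as a subring of the field of fractions of \<open>\<Lambda>\<close>.\<close>

definition to_frac :: "nat mpoly \<Rightarrow> nat mpoly fract" where
  "to_frac p = Fraction_Field.Fract p 1"

definition Lambda_loc :: "nat \<Rightarrow> nat mpoly fract ring" where
  "Lambda_loc n =
    \<lparr>carrier = {to_frac p / to_frac (\<Prod>i\<in>{1..n-1}. sigma n i ^ a i * tau n i ^ b i) | p a b.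
                 p \<in> polys_in {1..n-1}},
     monoid.mult = (*), one = 1, zero = 0, add = (+)\<rparr>"


section \<open>The isomorphism \<open>\<Phi>_n\<close>\<close>

text \<open>The isomorphism is one of complex algebras, so it fixes the constants.\<close>

definition is_Phi ::
  "nat \<Rightarrow> ((zq mpoly set \<times> zq mpoly set) set \<Rightarrow> nat mpoly fract) \<Rightarrow> bool" where
  "is_Phi n \<Phi> \<longleftrightarrow>
    \<Phi> \<in> ring_iso (QK_loc n) (Lambda_loc n) \<and>
    (\<forall>c. \<Phi> (to_loc n (QK_class n (Const c))) = to_frac (Const c)) \<and>
    (\<forall>i\<in>{1..n}. \<Phi> (to_loc n (QK_class n (zpoly i))) =
        to_frac (tau n i * sigma n (i - 1)) / to_frac (sigma n i * tau n (i - 1))) \<and>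
    (\<forall>i\<in>{1..n-1}. \<Phi> (to_loc n (QK_class n (Qpoly n i))) =
        to_frac (tau n (i - 1) * tau n (i + 1)) / to_frac (tau n i ^ 2))"


section \<open>Grothendieck polynomials\<close>

text \<open>Here \<open>Var i\<close> is \<open>x_i\<close>. \<open>swap_vars i\<close> is the action of \<open>s_i\<close>: the coefficient of a monomial
  in \<open>s_i f\<close> is the coefficient in \<open>f\<close> of that monomial with the exponents of \<open>x_i\<close> and
  \<open>x_{i+1}\<close> exchanged.\<close>

definition swap_vars :: "nat \<Rightarrow> nat mpoly \<Rightarrow> nat mpoly" where
  "swap_vars i = Poly_Mapping.map_key (Poly_Mapping.map_key (transpose i (i + 1)))"

text \<open>The quotient in the definition of \<open>\<pi>_i\<close> is an exact division in the polynomial ring (an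
  integral domain).\<close>

definition demazure :: "nat \<Rightarrow> nat mpoly \<Rightarrow> nat mpoly" where
  "demazure i f =
    (THE g. (Var i - Var (i + 1)) * g = (1 - Var (i + 1)) * f - (1 - Var i) * swap_vars i f)"

definition perm_length :: "nat \<Rightarrow> (nat \<Rightarrow> nat) \<Rightarrow> nat" where
  "perm_length n w = card {(i, j). i \<in> {1..n} \<and> j \<in> {1..n} \<and> i < j \<and> w i > w j}"

definition longest_perm :: "nat \<Rightarrow> nat \<Rightarrow> nat" where
  "longest_perm n = (\<lambda>i. if i \<in> {1..n} then n + 1 - i else i)"

definition grothendieck_polynomials :: "nat \<Rightarrow> ((nat \<Rightarrow> nat) \<Rightarrow> nat mpoly) \<Rightarrow> bool" where
  "grothendieck_polynomials n G \<longleftrightarrow>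
    (\<forall>w. w permutes {1..n} \<longrightarrow> G w \<in> polys_in {1..n}) \<and>
    G (longest_perm n) = (\<Prod>i\<in>{1..n-1}. Var i ^ (n - i)) \<and>
    (\<forall>w i. w permutes {1..n} \<longrightarrow> i \<in> {1..n-1} \<longrightarrow>
      (let ws = w \<circ> transpose i (i + 1) in
        (perm_length n ws + 1 = perm_length n w \<longrightarrow> demazure i (G w) = G ws) \<and>
        (perm_length n ws = perm_length n w + 1 \<longrightarrow> demazure i (G w) = G w)))"


section \<open>The quantization map\<close>

text \<open>\<open>fpoly j i\<close> is \<open>f_i^{(j)} = e_i(1 - x_1, \<dots>, 1 - x_j)\<close>.\<close>

definition fpoly :: "nat \<Rightarrow> nat \<Rightarrow> nat mpoly" where
  "fpoly j i = (\<Sum>I | I \<subseteq> {1..j} \<and> card I = i. \<Prod>k\<in>I. 1 - Var k)"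

definition basis_index :: "nat \<Rightarrow> (nat \<Rightarrow> nat) set" where
  "basis_index n = (\<Pi>\<^sub>E j\<in>{1..n-1}. {0..j})"

definition fprod :: "nat \<Rightarrow> (nat \<Rightarrow> nat) \<Rightarrow> nat mpoly" where
  "fprod n \<iota> = (\<Prod>j\<in>{1..n-1}. fpoly j (\<iota> j))"

definition Fprod :: "nat \<Rightarrow> (nat \<Rightarrow> nat) \<Rightarrow> zq mpoly" where
  "Fprod n \<iota> = (\<Prod>j\<in>{1..n-1}. Fpoly n j (\<iota> j))"

definition L_space :: "nat \<Rightarrow> nat mpoly set" where
  "L_space n = module.span (\<lambda>c p. Const c * p) (fprod n ` basis_index n)"

definition quantization_map :: "nat \<Rightarrow> (nat mpoly \<Rightarrow> zq mpoly set) \<Rightarrow> bool" where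
  "quantization_map n Qhat \<longleftrightarrow>
    Qhat \<in> L_space n \<rightarrow> carrier (QK n) \<and>
    (\<forall>f \<in> L_space n. \<forall>g \<in> L_space n. Qhat (f + g) = Qhat f \<oplus>\<^bsub>QK n\<^esub> Qhat g) \<and>
    (\<forall>c. \<forall>f \<in> L_space n. Qhat (Const c * f) = QK_class n (Const c) \<otimes>\<^bsub>QK n\<^esub> Qhat f) \<and>
    (\<forall>\<iota> \<in> basis_index n. Qhat (fprod n \<iota>) = QK_class n (Fprod n \<iota>))"


section \<open>Grassmannian permutations\<close>

definition grassmannian_perm :: "nat \<Rightarrow> nat \<Rightarrow> (nat \<Rightarrow> nat) \<Rightarrow> nat \<Rightarrow> nat" where
  "grassmannian_perm n d lam =
    (THE w. w permutes {1..n} \<and> (\<forall>a\<in>{1..d}. w a = lam (d - a) + a) \<and>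
            strict_mono_on {d+1..n} w)"

end

theory Submission
  imports Defs "HOL-Computational_Algebra.Polynomial_FPS"
begin

text \<open>Write \<open>H(u) = \<Sum> h_k u^k\<close> and \<open>M_k = H(u) (1 - u)^{-k}\<close> over the field of fractions of \<open>\<Lambda>\<close>, and for
a power series \<open>N\<close> let the corner minor \<open>\<Delta>_m(N)\<close> be the determinant of the coefficients of
\<open>u^{n-m}, \<dots>, u^{n-1}\<close> in \<open>N, u N, \<dots>, u^{m-1} N\<close>.  Row \<open>i\<close> (counted from 0) of the determinant
\<open>g_\<lambda>\<close> lists coefficients of \<open>(1 - u)^{-i} H\<close>.  Unitriangular row operations give
\<open>\<tau>_m = \<Delta>_m(M_{m-1})\<close>; the sum over all partitions in a rectangle telescopes row by row and gives
\<open>\<sigma>_m = \<Delta>_m(M_m)\<close>; and \<open>g_{\<lambda>^\<or>}\<close> is the determinant of the coefficients of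
\<open>u^{n-d}, \<dots>, u^{n-1}\<close> in \<open>a_0 M_{d-1}, \<dots>, a_{d-1} M_{d-1}\<close>, where
\<open>a_i = u^{\<mu>_i} (1 - u)^{d-1-i}\<close> and \<open>\<mu>_i = \<lambda>_{d-i} + i\<close>
(\<open>tau_corner_minor\<close>, \<open>sigma_corner_minor\<close>, \<open>dual_partition_det\<close>).

The \<open>F_i^{(m)}\<close> are collected in the monic polynomial
\<open>P_m(s) = \<Sum>_i F_i^{(m)} (s - 1)^{m-i}\<close>.  For \<open>Q = 0\<close> and \<open>z_j = 1 - x_j\<close> it is
\<open>(s - x_1) \<cdots> (s - x_m)\<close>.  For \<open>1 \<le> m < n\<close> it becomes, under \<open>\<Phi>_n\<close>, the monic polynomial of degree \<open>m\<close> for which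
the coefficients of \<open>u^{n-m}, \<dots>, u^{n-1}\<close> in \<open>P_m(u) M_{m-1}(u)\<close> vanish (\<open>toda_poly_low\<close>).  The
proof is an induction on \<open>m\<close>: such a polynomial exists and is unique because \<open>\<tau>_m \<noteq> 0\<close>, and the
recursion that the solutions satisfy has coefficients that are quotients of corner minors; these
quotients are the prescribed images of \<open>z_m\<close> and \<open>Q_m\<close>.

On the classical side \<open>\<GG>_w\<close> for a Grassmannian permutation is the bialternant
\<open>det(a_i(x_j)) / det(x_j^i)\<close> (\<open>grassmannian_alternant\<close>): an alternating sum over the symmetric
group of \<open>x_1, \<dots>, x_d\<close> does not notice the operators \<open>\<pi>_i\<close> with \<open>i < d\<close>, so \<open>w\<close> may be replaced
by a dominant permutation, whose polynomial is a monomial.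

Both sides now have the same form.  Let \<open>\<xi>_1, \<dots>, \<xi>_d\<close> be linear functionals on polynomials of
degree less than \<open>n\<close> that vanish on \<open>P_d, \<dots>, P_{n-1}\<close>.  Complementary minors give
\<open>c \<cdot> det(\<xi>_j(a_i)) = det(\<xi>_j(u^i)) \<cdot> det(\<theta>_k(P_m))\<close> with constant functionals \<open>\<theta>_k\<close> and a constant
\<open>c \<noteq> 0\<close> that depend only on \<open>\<lambda>\<close> (\<open>common_expansion\<close>).  In the last determinant each of
\<open>P_d, \<dots>, P_{n-1}\<close> fills one row, so it expands into products
\<open>F^{(d)}_{i_d} \<cdots> F^{(n-1)}_{i_{n-1}}\<close> with constant coefficients.  Evaluation at \<open>x_j\<close> as \<open>\<xi>_j\<close> turns
this into an expansion of \<open>\<GG>_w\<close> in the products \<open>f^{(d)}_{i_d} \<cdots> f^{(n-1)}_{i_{n-1}}\<close>, on which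
quantization is explicit; the coefficients of \<open>(\<cdot>) M_{d-1}\<close> as \<open>\<xi>_j\<close> turn the quantized expansion
into \<open>g_{\<lambda>^\<or>} / \<tau>_d\<close>.\<close>

section \<open>Determinants\<close>

lemma det_upper_unitriangular:
  fixes t :: "nat \<Rightarrow> nat \<Rightarrow> 'a::comm_ring_1"
  assumes "\<And>i j. j < i \<Longrightarrow> i < d \<Longrightarrow> t i j = 0" and "\<And>i. i < d \<Longrightarrow> t i i = 1"
  shows "det (mat d d (\<lambda>(i, j). t i j)) = 1"
proof -
  have "det (mat d d (\<lambda>(i, j). t i j)) = prod_list (diag_mat (mat d d (\<lambda>(i, j). t i j)))"
    by (rule det_upper_triangular[where n = d]) (use assms in \<open>auto simp: upper_triangular_def\<close>)
  also have "diag_mat (mat d d (\<lambda>(i, j). t i j)) = map (\<lambda>i. 1) [0..<d]"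
    unfolding diag_mat_def using assms by (auto intro!: map_cong)
  also have "prod_list \<dots> = (1::'a)"
    by (simp add: map_replicate_const prod_list_replicate)
  finally show ?thesis .
qed

lemma det_lower_unitriangular:
  fixes t :: "nat \<Rightarrow> nat \<Rightarrow> 'a::comm_ring_1"
  assumes "\<And>i j. i < j \<Longrightarrow> j < d \<Longrightarrow> t i j = 0" and "\<And>i. i < d \<Longrightarrow> t i i = 1"
  shows "det (mat d d (\<lambda>(i, j). t i j)) = 1"
proof -
  have "det (mat d d (\<lambda>(i, j). t i j)) = prod_list (diag_mat (mat d d (\<lambda>(i, j). t i j)))"
    by (rule det_lower_triangular[where n = d]) (use assms in auto)
  also have "diag_mat (mat d d (\<lambda>(i, j). t i j)) = map (\<lambda>i. 1) [0..<d]"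
    unfolding diag_mat_def using assms by (auto intro!: map_cong)
  also have "prod_list \<dots> = (1::'a)"
    by (simp add: map_replicate_const prod_list_replicate)
  finally show ?thesis .
qed

lemma mat_mult_index:
  "mat a b (\<lambda>(i, j). t i j) * mat b c (\<lambda>(i, j). x i j) =
   mat a c (\<lambda>(i, j). \<Sum>l<b. t i l * (x l j :: 'a::comm_ring_1))"
  by (rule eq_matI) (auto simp: scalar_prod_def atLeast0LessThan)

text \<open>The matrix product \<open>t x\<close> read as: row \<open>i\<close> of the left matrix is a combination of the rows
  of \<open>x\<close>.  In this form unitriangular row operations need no matrix products.\<close>

lemma det_row_combination:
  fixes t x :: "nat \<Rightarrow> nat \<Rightarrow> 'a::comm_ring_1"
  shows "det (mat d d (\<lambda>(i, j). \<Sum>l<d. t i l * x l j)) =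
    det (mat d d (\<lambda>(i, j). t i j)) * det (mat d d (\<lambda>(i, j). x i j))"
  unfolding mat_mult_index[symmetric] by (rule det_mult) auto

text \<open>Jacobi's complementary minor identity, arranged for two families of vectors at once.  The
  columns of \<open>X\<close> are functionals on an \<open>n\<close>-dimensional space.  The rows of \<open>P\<close> are a unitriangular
  basis whose last \<open>n - d\<close> members are annihilated by these functionals; the first \<open>d\<close> rows of \<open>A\<close>
  are the vectors of interest, and the last \<open>n - d\<close> columns of \<open>B = A^{-1}\<close> are the functionals that
  vanish on them.  With \<open>N = P B\<close> the equation \<open>N (A X) = P X\<close> becomes an identity of block
  triangular matrices once the columns of \<open>A X\<close> are completed by unit vectors.\<close>

lemma complementary_minor:
  fixes A B P X :: "'a::idom mat"
  assumes A: "A \<in> carrier_mat n n" and B: "B \<in> carrier_mat n n"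
    and P: "P \<in> carrier_mat n n" and X: "X \<in> carrier_mat n d"
    and BA: "B * A = 1\<^sub>m n" and dn: "d \<le> n"
    and top: "\<And>i j. i < d \<Longrightarrow> j < n \<Longrightarrow> P $$ (i, j) = (if i = j then 1 else 0)"
    and tri: "\<And>i j. i < j \<Longrightarrow> j < n \<Longrightarrow> P $$ (i, j) = 0"
    and diag: "\<And>i. i < n \<Longrightarrow> P $$ (i, i) = 1"
    and bot: "\<And>i j. d \<le> i \<Longrightarrow> i < n \<Longrightarrow> j < d \<Longrightarrow> (P * X) $$ (i, j) = 0"
  shows "det B * det (mat d d (\<lambda>(i, j). (A * X) $$ (i, j))) =
    det (mat d d (\<lambda>(i, j). X $$ (i, j))) *
    det (mat (n - d) (n - d) (\<lambda>(i, j). (P * B) $$ (d + i, d + j)))"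
proof -
  define N where "N = P * B"
  define Y where "Y = A * X"
  have N: "N \<in> carrier_mat n n" and Y: "Y \<in> carrier_mat n d"
    unfolding N_def Y_def using A B P X by auto
  have NY: "N * Y = P * X"
  proof -
    have "N * Y = P * (B * (A * X))"
      unfolding N_def Y_def using A B P X by (simp add: assoc_mult_mat[of _ n n _ n _ d])
    also have "B * (A * X) = (B * A) * X"
      using A B X by (simp add: assoc_mult_mat[of _ n n _ n _ d])
    also have "\<dots> = X" using X BA by simp
    finally show ?thesis .
  qed
  have PXtop: "(P * X) $$ (i, j) = X $$ (i, j)" if "i < d" "j < d" for i j
  proof -
    have "(P * X) $$ (i, j) = (\<Sum>l\<in>{0..<n}. P $$ (i, l) * X $$ (l, j))"
      using that dn P X by (simp add: scalar_prod_def)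
    also have "\<dots> = (\<Sum>l\<in>{0..<n}. if i = l then X $$ (l, j) else 0)"
      by (rule sum.cong) (use that top in auto)
    also have "\<dots> = X $$ (i, j)" using that dn by simp
    finally show ?thesis .
  qed
  define Z where "Z = mat n n (\<lambda>(i, j). if j < d then Y $$ (i, j) else if i = j then 1 else 0)"
  define e where "e = n - d"
  have n: "n = d + e" using dn e_def by simp
  have "det P = 1"
  proof -
    have "P = mat n n (\<lambda>(i, j). P $$ (i, j))" using P by auto
    also have "det \<dots> = 1" by (rule det_lower_unitriangular) (use tri diag in auto)
    finally show ?thesis .
  qed
  hence detN: "det N = det B" unfolding N_def using det_mult[OF P B] by simp
  have Zblock: "Z = four_block_mat (mat d d (\<lambda>(i, j). Y $$ (i, j))) (0\<^sub>m d e)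
                    (mat e d (\<lambda>(i, j). Y $$ (d + i, j))) (1\<^sub>m e)"
    unfolding Z_def using n by (intro eq_matI) (auto simp: le_imp_diff_is_add)
  have detZ: "det Z = det (mat d d (\<lambda>(i, j). Y $$ (i, j)))"
    unfolding Zblock by (subst det_four_block_mat_upper_right_zero[of _ d _ e]) auto
  have NZ: "N * Z = four_block_mat (mat d d (\<lambda>(i, j). X $$ (i, j))) (mat d e (\<lambda>(i, j). N $$ (i, d + j)))
                 (0\<^sub>m e d) (mat e e (\<lambda>(i, j). N $$ (d + i, d + j)))" (is "_ = ?R")
  proof (rule eq_matI)
    fix i j assume "i < dim_row ?R" "j < dim_col ?R"
    hence ij: "i < n" "j < n" using n by auto
    show "(N * Z) $$ (i, j) = ?R $$ (i, j)"
    proof (cases "j < d")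
      case True
      have "(N * Z) $$ (i, j) = (N * Y) $$ (i, j)"
        unfolding Z_def using ij True N Y by (simp add: scalar_prod_def)
      also have "\<dots> = (if i < d then X $$ (i, j) else 0)"
        unfolding NY using PXtop bot ij True by auto
      also have "\<dots> = ?R $$ (i, j)" using ij True n by auto
      finally show ?thesis .
    next
      case False
      have "(N * Z) $$ (i, j) = (\<Sum>l\<in>{0..<n}. N $$ (i, l) * (if l = j then 1 else 0))"
        unfolding Z_def using ij False N Y by (simp add: scalar_prod_def)
      also have "\<dots> = N $$ (i, j)"
        using ij by (simp add: if_distrib[where f = "\<lambda>x. _ * x"] cong: if_cong)
      also have "\<dots> = ?R $$ (i, j)" using ij False n by auto
      finally show ?thesis .
    qed
  qed (use N n in \<open>auto simp: Z_def\<close>)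
  have "det N * det Z = det (N * Z)"
    by (rule det_mult[symmetric, OF N]) (simp add: Z_def)
  also have "\<dots> = det (mat d d (\<lambda>(i, j). X $$ (i, j))) * det (mat e e (\<lambda>(i, j). N $$ (d + i, d + j)))"
    unfolding NZ by (subst det_four_block_mat_lower_left_zero[of _ d _ e]) auto
  finally show ?thesis unfolding detN detZ unfolding Y_def N_def e_def .
qed

text \<open>The coefficient of \<open>\<Prod>_j f j (\<iota> j)\<close> in a determinant whose rows are indexed by
  \<open>j = d, \<dots>, n - 1\<close> and whose row \<open>j\<close> is linear in \<open>f j 0, \<dots>, f j j\<close>.  The indices \<open>j < d\<close> are
  present only so that \<open>\<iota>\<close> ranges over the index set of the basis of \<open>L_n\<close>; they force \<open>\<iota> j = 0\<close>.\<close>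

definition flag_coeff ::
    "nat \<Rightarrow> nat \<Rightarrow> (nat \<Rightarrow> nat \<Rightarrow> nat \<Rightarrow> 'a::comm_ring_1) \<Rightarrow> (nat \<Rightarrow> nat) \<Rightarrow> 'a" where
  "flag_coeff n d \<kappa> \<iota> = (\<Sum>p | p permutes {0..<n - d}. signof p *
     (\<Prod>j\<in>{1..n-1}. if j < d then (if \<iota> j = 0 then 1 else 0) else \<kappa> j (\<iota> j) (p (j - d))))"

lemma (in comm_ring_hom) flag_coeff_hom:
  "flag_coeff n d (\<lambda>j i c. hom (\<kappa> j i c)) \<iota> = hom (flag_coeff n d \<kappa> \<iota>)"
  unfolding flag_coeff_def by (simp add: hom_distribs if_distrib[where f = hom] cong: if_cong)

text \<open>Each row involves its own family \<open>f (d + r)\<close>, so every term of the Leibniz expansion is a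
  product with exactly one factor from each family: a determinant of this shape in the
  \<open>f_i^{(j)}\<close> lies in \<open>L_n\<close> with visible coordinates, which is what makes quantization computable.\<close>

lemma det_flagged_expansion:
  fixes f :: "nat \<Rightarrow> nat \<Rightarrow> 'a::comm_ring_1"
  assumes d: "1 \<le> d" "d \<le> n" and f0: "\<And>j. f j 0 = 1"
  shows "det (mat (n - d) (n - d) (\<lambda>(r, c). \<Sum>i\<le>d + r. \<kappa> (d + r) i c * f (d + r) i)) =
    (\<Sum>\<iota>\<in>basis_index n. flag_coeff n d \<kappa> \<iota> * (\<Prod>j\<in>{1..n-1}. f j (\<iota> j)))"
proof -
  let ?k = "\<lambda>p j i. if j < d then (if i = 0 then 1 else 0) else \<kappa> j i (p (j - d))"
  have *: "(\<Prod>r = 0..<n-d. \<Sum>i\<le>d + r. \<kappa> (d + r) i (p r) * f (d + r) i) =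
      (\<Sum>\<iota>\<in>basis_index n. (\<Prod>j\<in>{1..n-1}. ?k p j (\<iota> j)) * (\<Prod>j\<in>{1..n-1}. f j (\<iota> j)))" for p
  proof -
    have "(\<Prod>r = 0..<n-d. \<Sum>i\<le>d + r. \<kappa> (d + r) i (p r) * f (d + r) i) =
      (\<Prod>j\<in>{d..<n}. \<Sum>i\<le>j. \<kappa> j i (p (j - d)) * f j i)"
      by (rule prod.reindex_bij_witness[of _ "\<lambda>j. j - d" "\<lambda>r. d + r"]) (use d in auto)
    also have "\<dots> = (\<Prod>j\<in>{d..<n}. \<Sum>i\<in>{0..j}. ?k p j i * f j i)"
      by (rule prod.cong) (auto simp: atLeast0AtMost)
    also have "\<dots> = (\<Prod>j\<in>{1..n-1}. \<Sum>i\<in>{0..j}. ?k p j i * f j i)"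
    proof (rule prod.mono_neutral_left)
      show "\<forall>j\<in>{1..n-1} - {d..<n}. (\<Sum>i\<in>{0..j}. ?k p j i * f j i) = 1"
      proof
        fix j assume "j \<in> {1..n-1} - {d..<n}"
        hence "j < d" by auto
        hence "(\<Sum>i\<in>{0..j}. ?k p j i * f j i) = (\<Sum>i\<in>{0..j}. if 0 = i then 1 else 0)"
          by (intro sum.cong) (auto simp: f0)
        thus "(\<Sum>i\<in>{0..j}. ?k p j i * f j i) = 1" by (simp only: sum.delta') simp
      qed
    qed (use d in auto)
    also have "\<dots> = (\<Sum>\<iota>\<in>basis_index n. \<Prod>j\<in>{1..n-1}. ?k p j (\<iota> j) * f j (\<iota> j))"
      unfolding basis_index_def by (rule prod_sum_PiE) auto
    finally show ?thesis by (simp only: prod.distrib)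
  qed
  have "det (mat (n - d) (n - d) (\<lambda>(r, c). \<Sum>i\<le>d + r. \<kappa> (d + r) i c * f (d + r) i)) =
    (\<Sum>p | p permutes {0..<n - d}. signof p *
      (\<Prod>r = 0..<n-d. \<Sum>i\<le>d + r. \<kappa> (d + r) i (p r) * f (d + r) i))"
    by (subst det_def'[where n = "n - d"]) (auto intro!: sum.cong prod.cong simp: permutes_def)
  also have "\<dots> = (\<Sum>p | p permutes {0..<n - d}. \<Sum>\<iota>\<in>basis_index n. signof p *
      (\<Prod>j\<in>{1..n-1}. ?k p j (\<iota> j)) * (\<Prod>j\<in>{1..n-1}. f j (\<iota> j)))"
    unfolding * by (simp add: sum_distrib_left mult.assoc)
  also have "\<dots> = (\<Sum>\<iota>\<in>basis_index n. \<Sum>p | p permutes {0..<n - d}. signof p *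
      (\<Prod>j\<in>{1..n-1}. ?k p j (\<iota> j)) * (\<Prod>j\<in>{1..n-1}. f j (\<iota> j)))"
    by (rule sum.swap)
  finally show ?thesis unfolding flag_coeff_def sum_distrib_right .
qed

section \<open>Corner minors of Toeplitz matrices\<close>

definition corner_minor :: "nat \<Rightarrow> nat \<Rightarrow> 'a::comm_ring_1 fps \<Rightarrow> 'a" where
  "corner_minor n d N = det (mat d d (\<lambda>(i, j). fps_nth (fps_X ^ i * N) (n - d + j)))"

text \<open>Multiplication by a polynomial is a combination of shifts, so the coefficient functionals
  \<open>a \<mapsto> [u^k] a N\<close> are given by the entries of the Toeplitz matrix of \<open>N\<close>.\<close>

lemma fps_nth_poly_mult:
  fixes N :: "'a::comm_ring_1 fps"
  assumes "\<And>l. L \<le> l \<Longrightarrow> coeff a l = 0"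
  shows "fps_nth (fps_of_poly a * N) k = (\<Sum>l<L. coeff a l * fps_nth (fps_X ^ l * N) k)"
proof -
  have "fps_of_poly a = (\<Sum>l<L. fps_const (coeff a l) * fps_X ^ l)"
  proof (rule fps_ext)
    fix k
    have "fps_nth (\<Sum>l<L. fps_const (coeff a l) * fps_X ^ l) k = (\<Sum>l<L. if k = l then coeff a l else 0)"
      unfolding fps_sum_nth by (intro sum.cong) (auto simp: fps_X_power_nth)
    also have "\<dots> = coeff a k" using assms by (auto simp: not_less)
    finally show "fps_nth (fps_of_poly a) k = fps_nth (\<Sum>l<L. fps_const (coeff a l) * fps_X ^ l) k"
      by simp
  qed
  thus ?thesis by (simp add: sum_distrib_right fps_sum_nth mult.assoc)
qed

text \<open>Replace the last row of \<open>\<Delta>_{m+1}(N)\<close> by the combination \<open>a N\<close> (allowed since \<open>a\<close> is monic)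
  and subtract from each column its predecessor, which multiplies the series by \<open>1 - u\<close>.  The
  hypothesis on \<open>a\<close> says that the last row then has a single nonzero entry, and Laplace expansion
  leaves \<open>\<Delta>_m((1 - u) N)\<close>.  The same hypothesis says that the coefficients of \<open>a N\<close> are constant
  from \<open>u^{n-m-1}\<close> to \<open>u^{n-1}\<close>, so the entry may be read off at \<open>u^{n-1}\<close>.\<close>

lemma corner_minor_recurrence:
  fixes N :: "'a::comm_ring_1 fps" and a :: "'a poly"
  assumes mn: "m < n" and deg: "degree a \<le> m" and monic: "coeff a m = 1"
    and low: "\<And>k. n - m \<le> k \<Longrightarrow> k < n \<Longrightarrow> fps_nth ((1 - fps_X) * (fps_of_poly a * N)) k = 0"
  shows "corner_minor n (Suc m) N =
    (-1) ^ m * fps_nth (fps_of_poly a * N) (n - 1) * corner_minor n m ((1 - fps_X) * N)"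
proof -
  define x where "x i j = fps_nth (fps_X ^ i * N) (n - Suc m + j)" for i j
  \<comment> \<open>\<open>t\<close> replaces the last row by the combination with coefficients \<open>a\<close>, \<open>c\<close> subtracts adjacent columns.\<close>
  define t where "t i l = (if i = m then coeff a l else if i = l then 1 else 0)" for i l
  define c where "c j l = (if l = j then 1 else if Suc l = j then -1 else (0::'a))" for j l :: nat
  have hi: "coeff a l = 0" if "Suc m \<le> l" for l
    using that deg by (intro coeff_eq_0) auto
  define y where "y i j = (\<Sum>l<Suc m. t i l * x l j)" for i j
  have y: "y i j = (if i = m then fps_nth (fps_of_poly a * N) (n - Suc m + j) else x i j)" if "i \<le> m" for i j
  proof (cases "i = m")
    case True
    have "fps_nth (fps_of_poly a * N) (n - Suc m + j) =
        (\<Sum>l<Suc m. coeff a l * fps_nth (fps_X ^ l * N) (n - Suc m + j))"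
      by (rule fps_nth_poly_mult) (rule hi)
    thus ?thesis unfolding y_def x_def t_def using True by (simp del: sum.lessThan_Suc)
  next
    case False
    have "y i j = (\<Sum>l<Suc m. if i = l then x l j else 0)"
      unfolding y_def using False by (intro sum.cong) (auto simp: t_def)
    thus ?thesis using that False by (subst (asm) sum.delta') simp_all
  qed
  define u where "u j i = (\<Sum>l<Suc m. c j l * y i l)" for i j
  have u: "u j i = (if j = 0 then y i 0 else y i j - y i (j - 1))" if "j \<le> m" for i j
  proof (cases j)
    case 0
    have "u j i = (\<Sum>l<Suc m. if 0 = l then y i l else 0)"
      unfolding u_def using 0 by (intro sum.cong) (auto simp: c_def)
    thus ?thesis using 0 by (subst (asm) sum.delta') simp_all
  next
    case (Suc k)
    have "u j i = (\<Sum>l<Suc m. (if j = l then y i l else 0) - (if k = l then y i l else 0))"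
      unfolding u_def using Suc by (intro sum.cong) (auto simp: c_def)
    also have "\<dots> = y i j - y i k" using that Suc by (simp add: sum_subtractf)
    finally show ?thesis using Suc by simp
  qed
  have step: "fps_nth f (n - Suc m + j) - fps_nth f (n - Suc m + (j - 1)) =
      fps_nth ((1 - fps_X) * f) (n - Suc m + j)" if "1 \<le> j" for f :: "'a fps" and j
    using that by (simp add: algebra_simps)
  have last: "u j m = (if j = 0 then fps_nth (fps_of_poly a * N) (n - 1) else 0)" if "j \<le> m" for j
  proof (cases "j = 0")
    case True
    have "fps_nth (fps_of_poly a * N) (n - Suc m + k) = fps_nth (fps_of_poly a * N) (n - Suc m)" if "k \<le> m" for k
      using that
    proof (induction k)
      case (Suc k)
      have "fps_nth ((1 - fps_X) * (fps_of_poly a * N)) (n - Suc m + Suc k) = 0"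
        by (rule low) (use Suc.prems mn in auto)
      thus ?case using Suc step[of "Suc k" "fps_of_poly a * N"] by simp
    qed auto
    from this[of m] mn show ?thesis using True u[of 0 m] y[of m] by simp
  next
    case False
    hence "u j m = fps_nth ((1 - fps_X) * (fps_of_poly a * N)) (n - Suc m + j)"
      using that u y step by simp
    also have "\<dots> = 0" by (rule low) (use False that mn in auto)
    finally show ?thesis using False by simp
  qed
  let ?U = "mat (Suc m) (Suc m) (\<lambda>(i, j). u j i)"
  have "corner_minor n (Suc m) N = det (mat (Suc m) (Suc m) (\<lambda>(i, j). x i j))"
    unfolding corner_minor_def x_def by simp
  also have "\<dots> = det (mat (Suc m) (Suc m) (\<lambda>(i, j). t i j)) * \<dots>"
    by (subst det_lower_unitriangular) (use monic hi in \<open>auto simp: t_def\<close>)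
  also have "\<dots> = det (mat (Suc m) (Suc m) (\<lambda>(i, j). y i j))"
    unfolding y_def by (rule det_row_combination[symmetric])
  also have "\<dots> = det (mat (Suc m) (Suc m) (\<lambda>(i, j). y j i))"
    by (subst det_transpose[symmetric, of _ "Suc m"]) (auto intro!: arg_cong[where f = det])
  also have "\<dots> = det (mat (Suc m) (Suc m) (\<lambda>(i, j). c i j)) * \<dots>"
    by (subst det_lower_unitriangular) (auto simp: c_def)
  also have "\<dots> = det (mat (Suc m) (Suc m) (\<lambda>(i, j). u i j))"
    unfolding u_def by (rule det_row_combination[symmetric])
  also have "\<dots> = det ?U"
    by (subst det_transpose[symmetric, of _ "Suc m"]) (auto intro!: arg_cong[where f = det])
  also have "\<dots> = (\<Sum>j<Suc m. ?U $$ (m, j) * cofactor ?U m j)"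
    by (rule laplace_expansion_row) auto
  also have "\<dots> = (\<Sum>j<Suc m. if 0 = j then fps_nth (fps_of_poly a * N) (n - 1) * cofactor ?U m 0 else 0)"
    by (rule sum.cong) (auto simp: last)
  also have "\<dots> = fps_nth (fps_of_poly a * N) (n - 1) * cofactor ?U m 0"
    by (subst sum.delta') simp_all
  also have "cofactor ?U m 0 = (-1) ^ m * corner_minor n m ((1 - fps_X) * N)"
  proof -
    have "mat_delete ?U m 0 = mat m m (\<lambda>(i, j). fps_nth (fps_X ^ i * ((1 - fps_X) * N)) (n - m + j))"
    proof (rule eq_matI)
      fix i j assume "i < dim_row (mat m m (\<lambda>(i, j). fps_nth (fps_X ^ i * ((1 - fps_X) * N)) (n - m + j)))"
        and "j < dim_col (mat m m (\<lambda>(i, j). fps_nth (fps_X ^ i * ((1 - fps_X) * N)) (n - m + j)))"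
      hence ij: "i < m" "j < m" by auto
      hence "mat_delete ?U m 0 $$ (i, j) = u (Suc j) i"
        by (simp add: mat_delete_def)
      also have "\<dots> = x i (Suc j) - x i j"
        using ij u[of "Suc j" i] y[of i] by simp
      also have "\<dots> = fps_nth ((1 - fps_X) * (fps_X ^ i * N)) (n - Suc m + Suc j)"
        unfolding x_def using step[of "Suc j" "fps_X ^ i * N"] by simp
      also have "\<dots> = fps_nth (fps_X ^ i * ((1 - fps_X) * N)) (n - m + j)"
        using mn ij by (simp add: mult.left_commute Suc_diff_Suc del: add_Suc_right add: add_Suc_right[symmetric] add_Suc[symmetric])
      finally show "mat_delete ?U m 0 $$ (i, j) = mat m m (\<lambda>(i, j). fps_nth (fps_X ^ i * ((1 - fps_X) * N)) (n - m + j)) $$ (i, j)"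
        using ij by simp
    qed (auto simp: mat_delete_def)
    thus ?thesis unfolding cofactor_def corner_minor_def by simp
  qed
  finally show ?thesis by (simp add: mult_ac)
qed

text \<open>The corner minor is the determinant of the linear system for the coefficients of \<open>a\<close>.\<close>

lemma corner_minor_uniqueness:
  fixes N :: "'a::field fps" and a :: "'a poly"
  assumes dn: "d \<le> n" and nz: "corner_minor n d N \<noteq> 0"
    and deg: "\<And>l. d \<le> l \<Longrightarrow> coeff a l = 0"
    and low: "\<And>k. n - d \<le> k \<Longrightarrow> k < n \<Longrightarrow> fps_nth (fps_of_poly a * N) k = 0"
  shows "a = 0"
proof (rule ccontr)
  assume "a \<noteq> 0"
  then obtain l where l: "coeff a l \<noteq> 0" by (auto simp: poly_eq_iff)
  define T where "T = mat d d (\<lambda>(i, j). fps_nth (fps_X ^ j * N) (n - d + i))"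
  define v where "v = vec d (coeff a)"
  have v: "v \<in> carrier_vec d" "v \<noteq> 0\<^sub>v d"
  proof -
    have "l < d" using l deg not_less by blast
    hence "v $ l \<noteq> 0\<^sub>v d $ l" unfolding v_def using l by simp
    thus "v \<noteq> 0\<^sub>v d" by auto
  qed (auto simp: v_def)
  have "T *\<^sub>v v = 0\<^sub>v d"
  proof (rule eq_vecI)
    fix i assume "i < dim_vec (0\<^sub>v d :: 'a vec)"
    hence i: "i < d" by simp
    hence "(T *\<^sub>v v) $ i = (\<Sum>l<d. coeff a l * fps_nth (fps_X ^ l * N) (n - d + i))"
      unfolding T_def v_def by (simp add: scalar_prod_def mult.commute atLeast0LessThan)
    also have "\<dots> = fps_nth (fps_of_poly a * N) (n - d + i)"
      by (rule fps_nth_poly_mult[symmetric]) (rule deg)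
    also have "\<dots> = 0" by (rule low) (use i dn in auto)
    finally show "(T *\<^sub>v v) $ i = 0\<^sub>v d $ i" using i by simp
  qed (auto simp: T_def)
  hence "det T = 0"
    using det_0_iff_vec_prod_zero_field[of T d] v by (auto simp: T_def)
  moreover have "det T = corner_minor n d N"
    unfolding corner_minor_def T_def
    by (subst det_transpose[symmetric, of _ d]) (auto intro!: arg_cong[where f = det])
  ultimately show False using nz by simp
qed

text \<open>The inhomogeneous system with the same matrix: the leading coefficient is prescribed, and the
  other \<open>d\<close> coefficients are solved for.\<close>

lemma corner_minor_existence:
  fixes N :: "'a::field fps"
  assumes dn: "d \<le> n" and nz: "corner_minor n d N \<noteq> 0"
  obtains a where "degree a \<le> d" "coeff a d = 1"
    "\<And>k. n - d \<le> k \<Longrightarrow> k < n \<Longrightarrow> fps_nth (fps_of_poly a * N) k = 0"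
proof -
  define T where "T = mat d d (\<lambda>(i, j). fps_nth (fps_X ^ j * N) (n - d + i))"
  define b where "b = vec d (\<lambda>i. - fps_nth (fps_X ^ d * N) (n - d + i))"
  have T: "T \<in> carrier_mat d d" by (simp add: T_def)
  have "det T = corner_minor n d N"
    unfolding corner_minor_def T_def
    by (subst det_transpose[symmetric, of _ d]) (auto intro!: arg_cong[where f = det])
  from det_non_zero_imp_unit[OF T] this nz obtain S where S: "S \<in> carrier_mat d d" "T * S = 1\<^sub>m d"
    unfolding Units_def ring_mat_def by auto
  define v where "v = S *\<^sub>v b"
  have v: "v \<in> carrier_vec d" and b: "b \<in> carrier_vec d" unfolding v_def b_def using S by auto
  have Tv: "T *\<^sub>v v = b"
    unfolding v_def using assoc_mult_mat_vec[OF T S(1) b] S(2) b by simp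
  define a where "a = Poly (map (\<lambda>l. v $ l) [0..<d] @ [1])"
  have ca: "coeff a l = (if l < d then v $ l else if l = d then 1 else 0)" for l
    unfolding a_def coeff_Poly_eq by (auto simp: nth_default_def nth_append)
  show ?thesis
  proof
    show "degree a \<le> d" by (rule degree_le) (simp add: ca)
    show "coeff a d = 1" by (simp add: ca)
    fix k assume k: "n - d \<le> k" "k < n"
    define i where "i = k - (n - d)"
    have i: "i < d" "k = n - d + i" unfolding i_def using k dn by auto
    have "fps_nth (fps_of_poly a * N) k = (\<Sum>l<Suc d. coeff a l * fps_nth (fps_X ^ l * N) k)"
      by (rule fps_nth_poly_mult) (simp add: ca)
    also have "\<dots> = (\<Sum>l<d. v $ l * fps_nth (fps_X ^ l * N) k) + fps_nth (fps_X ^ d * N) k"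
      by (simp add: ca)
    also have "(\<Sum>l<d. v $ l * fps_nth (fps_X ^ l * N) k) = (T *\<^sub>v v) $ i"
      unfolding T_def using i v by (simp add: scalar_prod_def mult.commute atLeast0LessThan)
    also have "\<dots> = - fps_nth (fps_X ^ d * N) k"
      unfolding Tv b_def using i by simp
    finally show "fps_nth (fps_of_poly a * N) k = 0" by simp
  qed
qed

section \<open>Generating polynomials of the quantum elementary polynomials\<close>

text \<open>The polynomial \<open>F_i^{(m)}\<close> for arbitrary values of \<open>z\<close> and \<open>Q\<close>.  It specializes to
  \<open>f_i^{(m)}\<close> at \<open>Q = 0\<close>, \<open>z_j = 1 - x_j\<close>, so that one recursion serves both sides.\<close>

definition quantum_elem :: "(nat \<Rightarrow> 'a) \<Rightarrow> (nat \<Rightarrow> 'a) \<Rightarrow> nat \<Rightarrow> nat \<Rightarrow> 'a::comm_ring_1" where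
  "quantum_elem Q z m i =
    (\<Sum>I | I \<subseteq> {1..m} \<and> card I = i. (\<Prod>j\<in>I. z j) * (\<Prod>j | j \<in> I \<and> j + 1 \<notin> I. 1 - Q j))"

text \<open>Powers of \<open>s - 1\<close> rather than of a free variable: with them the classical polynomial is
  \<open>\<Prod> (s - x_j)\<close>, which vanishes at the \<open>x_j\<close>, and the factor \<open>s - 1\<close> meets \<open>(1 - u)^{-1}\<close> in the
  recursion.\<close>

definition toda_poly :: "(nat \<Rightarrow> 'a) \<Rightarrow> (nat \<Rightarrow> 'a) \<Rightarrow> nat \<Rightarrow> 'a::comm_ring_1 poly" where
  "toda_poly Q z m = (\<Sum>i\<le>m. smult (quantum_elem Q z m i) ([:-1, 1:] ^ (m - i)))"

text \<open>The auxiliary family without the factor \<open>1 - Q_m\<close> at the right end.  It closes the recursion: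
  when \<open>m + 1\<close> is added to an index set, the old end \<open>m\<close> loses its factor.\<close>

definition toda_poly_open :: "(nat \<Rightarrow> 'a) \<Rightarrow> (nat \<Rightarrow> 'a) \<Rightarrow> nat \<Rightarrow> 'a::comm_ring_1 poly" where
  "toda_poly_open Q z m = (\<Sum>I\<in>Pow {1..m}.
     smult ((\<Prod>j\<in>I. z j) * (\<Prod>j | j \<in> I \<and> j + 1 \<notin> I \<and> j \<noteq> m. 1 - Q j)) ([:-1, 1:] ^ (m - card I)))"

lemma quantum_elem_0 [simp]: "quantum_elem Q z m 0 = 1"
proof -
  have "I \<subseteq> {1..m} \<and> card I = 0 \<longleftrightarrow> I = {}" for I
    using finite_subset[of I "{1..m}"] by auto
  hence eq: "{I. I \<subseteq> {1..m} \<and> card I = 0} = {{}}" by simp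
  show ?thesis unfolding quantum_elem_def eq by simp
qed

lemma toda_poly_alt: "toda_poly Q z m = (\<Sum>I\<in>Pow {1..m}.
     smult ((\<Prod>j\<in>I. z j) * (\<Prod>j | j \<in> I \<and> j + 1 \<notin> I. 1 - Q j)) ([:-1, 1:] ^ (m - card I)))"
  (is "_ = (\<Sum>I\<in>_. ?g I)")
proof -
  have "(\<Sum>I\<in>Pow {1..m}. ?g I) = (\<Sum>i\<in>{..m}. sum ?g {I \<in> Pow {1..m}. card I = i})"
  proof (rule sum.group[symmetric])
    show "card ` Pow {1..m} \<subseteq> {..m}"
      using card_mono[of "{1..m}"] by auto
  qed auto
  also have "\<dots> = toda_poly Q z m"
    unfolding toda_poly_def quantum_elem_def smult_sum by (intro sum.cong) auto
  finally show ?thesis by simp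
qed

lemma toda_poly_0 [simp]: "toda_poly Q z 0 = 1" and toda_poly_open_0 [simp]: "toda_poly_open Q z 0 = 1"
  by (simp_all add: toda_poly_alt toda_poly_open_def)

lemma sum_Pow_insert:
  assumes "finite A" "x \<notin> A"
  shows "(\<Sum>I\<in>Pow (insert x A). g I) = (\<Sum>I\<in>Pow A. g I + g (insert x I))"
proof -
  have "(\<Sum>I\<in>Pow (insert x A). g I) = sum g (Pow A) + sum g (insert x ` Pow A)"
    unfolding Pow_insert by (rule sum.union_disjoint) (use assms in auto)
  also have "sum g (insert x ` Pow A) = (\<Sum>I\<in>Pow A. g (insert x I))"
    by (subst sum.reindex) (use assms in \<open>auto simp: inj_on_def o_def\<close>)
  finally show ?thesis by (simp add: sum.distrib)
qed

lemma weight_insert: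
  fixes z Q :: "nat \<Rightarrow> 'a::comm_ring_1"
  assumes "I \<subseteq> {1..m}"
  shows "(\<Prod>j\<in>insert (Suc m) I. z j) = z (Suc m) * (\<Prod>j\<in>I. z j)"
    and "card (insert (Suc m) I) = Suc (card I)"
    and "{j. j \<in> insert (Suc m) I \<and> j + 1 \<notin> insert (Suc m) I \<and> j \<noteq> Suc m} =
         {j. j \<in> I \<and> j + 1 \<notin> I \<and> j \<noteq> m}"
    and "(\<Prod>j | j \<in> insert (Suc m) I \<and> j + 1 \<notin> insert (Suc m) I. 1 - Q j) =
         (1 - Q (Suc m)) * (\<Prod>j | j \<in> I \<and> j + 1 \<notin> I \<and> j \<noteq> m. 1 - Q j)"
    and "{j. j \<in> I \<and> j + 1 \<notin> I \<and> j \<noteq> Suc m} = {j. j \<in> I \<and> j + 1 \<notin> I}"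
    and "Suc m - card I = Suc (m - card I)"
proof -
  have fin: "finite I" and S: "Suc m \<notin> I" "Suc (Suc m) \<notin> I" using assms finite_subset[of I] by auto
  show "(\<Prod>j\<in>insert (Suc m) I. z j) = z (Suc m) * (\<Prod>j\<in>I. z j)"
    and "card (insert (Suc m) I) = Suc (card I)" using fin S by simp_all
  show "{j. j \<in> insert (Suc m) I \<and> j + 1 \<notin> insert (Suc m) I \<and> j \<noteq> Suc m} =
         {j. j \<in> I \<and> j + 1 \<notin> I \<and> j \<noteq> m}" using S by auto
  have "{j. j \<in> insert (Suc m) I \<and> j + 1 \<notin> insert (Suc m) I} =
        insert (Suc m) {j. j \<in> I \<and> j + 1 \<notin> I \<and> j \<noteq> m}" using S by auto
  thus "(\<Prod>j | j \<in> insert (Suc m) I \<and> j + 1 \<notin> insert (Suc m) I. 1 - Q j) =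
         (1 - Q (Suc m)) * (\<Prod>j | j \<in> I \<and> j + 1 \<notin> I \<and> j \<noteq> m. 1 - Q j)"
    using fin S by simp
  show "{j. j \<in> I \<and> j + 1 \<notin> I \<and> j \<noteq> Suc m} = {j. j \<in> I \<and> j + 1 \<notin> I}" using S by auto
  show "Suc m - card I = Suc (m - card I)" using card_mono[OF _ assms] by simp
qed

lemma smult_sum_poly: "smult c (sum f A) = (\<Sum>x\<in>A. smult c (f x))"
  by (induction A rule: infinite_finite_induct) (simp_all add: smult_add_right)

text \<open>Split the index sets by whether they contain \<open>m + 1\<close>.\<close>

lemma toda_poly_open_Suc:
  "toda_poly_open Q z (Suc m) = [:-1, 1:] * toda_poly Q z m + smult (z (Suc m)) (toda_poly_open Q z m)"
proof -
  let ?w = "\<lambda>I. (\<Prod>j\<in>I. z j) * (\<Prod>j | j \<in> I \<and> j + 1 \<notin> I \<and> j \<noteq> Suc m. 1 - Q j)"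
  have "toda_poly_open Q z (Suc m) = (\<Sum>I\<in>Pow {1..m}. smult (?w I) ([:-1, 1:] ^ (Suc m - card I)) +
      smult (?w (insert (Suc m) I)) ([:-1, 1:] ^ (Suc m - card (insert (Suc m) I))))"
    unfolding toda_poly_open_def by (subst atLeastAtMostSuc_conv, simp, subst sum_Pow_insert) auto
  also have "\<dots> = [:-1, 1:] * toda_poly Q z m + smult (z (Suc m)) (toda_poly_open Q z m)"
    unfolding toda_poly_alt toda_poly_open_def sum.distrib smult_sum_poly sum_distrib_left
    by (intro arg_cong2[of _ _ _ _ "(+)"] sum.cong refl)
       (simp_all only: Pow_iff weight_insert mult_smult_right power_Suc smult_smult mult.assoc diff_Suc_Suc)
  finally show ?thesis .
qed

lemma toda_poly_Suc:
  "toda_poly Q z (Suc m) = [:-1, 1:] * toda_poly Q z m + smult (z (Suc m) * (1 - Q (Suc m))) (toda_poly_open Q z m)"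
proof -
  let ?w = "\<lambda>I. (\<Prod>j\<in>I. z j) * (\<Prod>j | j \<in> I \<and> j + 1 \<notin> I. 1 - Q j)"
  have "toda_poly Q z (Suc m) = (\<Sum>I\<in>Pow {1..m}. smult (?w I) ([:-1, 1:] ^ (Suc m - card I)) +
      smult (?w (insert (Suc m) I)) ([:-1, 1:] ^ (Suc m - card (insert (Suc m) I))))"
    unfolding toda_poly_alt by (subst atLeastAtMostSuc_conv, simp, subst sum_Pow_insert) auto
  also have "\<dots> = [:-1, 1:] * toda_poly Q z m + smult (z (Suc m) * (1 - Q (Suc m))) (toda_poly_open Q z m)"
    unfolding toda_poly_alt toda_poly_open_def sum.distrib smult_sum_poly sum_distrib_left
    by (intro arg_cong2[of _ _ _ _ "(+)"] sum.cong refl)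
       (simp_all only: Pow_iff weight_insert mult_smult_right power_Suc smult_smult mult_ac diff_Suc_Suc)
  finally show ?thesis .
qed

lemma toda_poly_classical: "toda_poly (\<lambda>_. 0) (\<lambda>j. 1 - x j) m = (\<Prod>j\<in>{1..m}. [:- x j, 1:])"
proof (induction m)
  case (Suc m)
  have op: "toda_poly_open (\<lambda>_. 0) z k = toda_poly (\<lambda>_. 0) z k" for z :: "nat \<Rightarrow> 'a" and k
    by (simp add: toda_poly_open_def toda_poly_alt)
  have "toda_poly (\<lambda>_. 0) (\<lambda>j. 1 - x j) (Suc m) = [:- x (Suc m), 1:] * toda_poly (\<lambda>_. 0) (\<lambda>j. 1 - x j) m"
    unfolding toda_poly_Suc op by (rule poly_eqI) (simp add: algebra_simps coeff_pCons split: nat.split)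
  thus ?case using Suc by (simp add: atLeastAtMostSuc_conv)
qed simp

section \<open>The recursion solved by corner minors\<close>

definition monic_of_degree :: "nat \<Rightarrow> 'a::comm_ring_1 poly \<Rightarrow> bool" where
  "monic_of_degree m p \<longleftrightarrow> coeff p m = 1 \<and> (\<forall>l>m. coeff p l = 0)"

lemma monic_of_degree_step:
  assumes "monic_of_degree m p" "monic_of_degree m q"
  shows "monic_of_degree (Suc m) ([:-1, 1:] * p + smult c q)"
proof -
  have c: "coeff ([:-1, 1:] * p + smult c q) (Suc l) = coeff p l - coeff p (Suc l) + c * coeff q (Suc l)" for l
    by simp
  have 0: "coeff p l = 0" "coeff q l = 0" if "l > m" for l
    using assms that by (simp_all add: monic_of_degree_def)
  show ?thesis unfolding monic_of_degree_def
  proof (intro conjI allI impI)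
    show "coeff ([:-1, 1:] * p + smult c q) (Suc m) = 1"
      unfolding c using 0[of "Suc m"] assms(1) by (simp add: monic_of_degree_def)
    fix l assume "l > Suc m"
    then obtain k where k: "l = Suc k" "k > m" by (cases l) auto
    show "coeff ([:-1, 1:] * p + smult c q) l = 0"
      unfolding k(1) c using 0[of k] 0[of "Suc k"] k(2) by simp
  qed
qed

lemma monic_toda_poly: "monic_of_degree m (toda_poly Q z m) \<and> monic_of_degree m (toda_poly_open Q z m)"
proof (induction m)
  case (Suc m)
  thus ?case unfolding toda_poly_Suc toda_poly_open_Suc by (blast intro: monic_of_degree_step)
qed (simp add: monic_of_degree_def)

lemma monic_of_degree_degree: "monic_of_degree m p \<Longrightarrow> degree p \<le> m"
  unfolding monic_of_degree_def by (blast intro: degree_le)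

lemma eventually_constant:
  fixes f :: "'a::comm_ring_1 fps"
  assumes "\<And>k. n - m \<le> k \<Longrightarrow> k < n \<Longrightarrow> fps_nth ((1 - fps_X) * f) k = 0" "m < n"
    and "n - Suc m \<le> k" "k < n"
  shows "fps_nth f k = fps_nth f (n - 1)"
  using assms(4,3)
proof (induction "n - 1 - k" arbitrary: k)
  case (Suc j)
  have "fps_nth ((1 - fps_X) * f) (Suc k) = 0" by (rule assms(1)) (use Suc in auto)
  hence "fps_nth f k = fps_nth f (Suc k)" by (simp add: algebra_simps)
  also have "\<dots> = fps_nth f (n - 1)" by (rule Suc.hyps(1)) (use Suc in auto)
  finally show ?case .
next
  case 0
  hence "k = n - 1" by simp
  thus ?case by simp
qed

lemma one_minus_X_low:
  fixes f :: "'a::comm_ring_1 fps"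
  assumes "\<And>k. n - Suc m \<le> k \<Longrightarrow> k < n \<Longrightarrow> fps_nth f k = 0" "m < n" "n - m \<le> k" "k < n"
  shows "fps_nth ((1 - fps_X) * f) k = 0"
proof -
  from assms(2,3) obtain j where "k = Suc j" by (cases k) auto
  hence "fps_nth ((1 - fps_X) * f) k = fps_nth f k - fps_nth f j" by (simp add: algebra_simps)
  thus ?thesis using assms \<open>k = Suc j\<close> by simp
qed

text \<open>The data of the relativistic Toda lattice with unipotent initial condition: \<open>\<tau>\<close> and \<open>\<sigma>\<close> are
  corner minors of two neighbouring series, and \<open>z\<close>, \<open>Q\<close> are the prescribed quotients of them.\<close>

locale toda_solution =
  fixes n :: nat and M :: "nat \<Rightarrow> 'a::field fps" and z Q \<tau> \<sigma> :: "nat \<Rightarrow> 'a"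
  assumes M: "M m = (1 - fps_X) * M (Suc m)"
    and tau: "m \<le> n \<Longrightarrow> \<tau> m = corner_minor n m (M (m - 1))"
    and sigma: "m \<le> n \<Longrightarrow> \<sigma> m = corner_minor n m (M m)"
    and tau_nz: "m \<le> n \<Longrightarrow> \<tau> m \<noteq> 0"
    and sigma_nz: "m \<le> n \<Longrightarrow> \<sigma> m \<noteq> 0"
    and z: "1 \<le> m \<Longrightarrow> m \<le> n \<Longrightarrow> z m = \<tau> m * \<sigma> (m - 1) / (\<sigma> m * \<tau> (m - 1))"
    and Q: "1 \<le> m \<Longrightarrow> m < n \<Longrightarrow> Q m = \<tau> (m - 1) * \<tau> (m + 1) / (\<tau> m)\<^sup>2"
begin

text \<open>For a solution \<open>a\<close> of degree \<open>m\<close>, the coefficients of \<open>u^{n-m-1}, \<dots>, u^{n-1}\<close> in \<open>a M_m\<close>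
  share one value, and \<open>corner_minor_recurrence\<close> computes it.  These values are the only quantities that the
  induction below has to compare.\<close>

lemma corner_value:
  assumes "m < n" "monic_of_degree m a"
    and "\<And>k. n - m \<le> k \<Longrightarrow> k < n \<Longrightarrow> fps_nth ((1 - fps_X) * (fps_of_poly a * M m)) k = 0"
  shows "fps_nth (fps_of_poly a * M m) (n - 1) = (-1) ^ m * \<tau> (Suc m) / \<tau> m"
proof -
  have "corner_minor n m ((1 - fps_X) * M m) = \<tau> m"
  proof (cases m)
    case 0
    thus ?thesis by (simp add: tau corner_minor_def)
  next
    case (Suc k)
    thus ?thesis using M[of k] tau[of m] assms(1) by simp
  qed
  moreover have "\<tau> (Suc m) = (-1) ^ m * fps_nth (fps_of_poly a * M m) (n - 1) *
      corner_minor n m ((1 - fps_X) * M m)"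
    unfolding tau[OF Suc_leI[OF assms(1)]] diff_Suc_1
    by (rule corner_minor_recurrence[OF assms(1) monic_of_degree_degree[OF assms(2)] _ assms(3)])
       (use assms(2) in \<open>auto simp: monic_of_degree_def\<close>)
  ultimately show ?thesis using tau_nz[of m] assms(1)
    by (simp add: field_simps flip: power_mult_distrib)
qed

lemma corner_value_open:
  assumes "m < n" "monic_of_degree m a"
    and "\<And>k. n - m \<le> k \<Longrightarrow> k < n \<Longrightarrow> fps_nth (fps_of_poly a * M m) k = 0"
  shows "fps_nth (fps_of_poly a * M (Suc m)) (n - 1) = (-1) ^ m * \<sigma> (Suc m) / \<sigma> m"
proof -
  have Mm: "(1 - fps_X) * (fps_of_poly a * M (Suc m)) = fps_of_poly a * M m"
    unfolding M[of m] by (simp add: mult_ac)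
  have "\<sigma> (Suc m) = (-1) ^ m * fps_nth (fps_of_poly a * M (Suc m)) (n - 1) *
      corner_minor n m ((1 - fps_X) * M (Suc m))"
    unfolding sigma[OF Suc_leI[OF assms(1)]]
    by (rule corner_minor_recurrence[OF assms(1) monic_of_degree_degree[OF assms(2)]], unfold Mm)
       (use assms(2,3) in \<open>auto simp: monic_of_degree_def\<close>)
  also have "corner_minor n m ((1 - fps_X) * M (Suc m)) = \<sigma> m"
    unfolding M[of m, symmetric] using sigma[of m] assms(1) by simp
  finally show ?thesis using sigma_nz[of m] assms(1)
    by (simp add: field_simps flip: power_mult_distrib)
qed

text \<open>Call \<open>a\<close>, \<open>b\<close> the two polynomials of degree \<open>m\<close> and \<open>a'\<close>, \<open>b'\<close> those of degree \<open>m + 1\<close>.  The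
  coefficients of \<open>a M_m\<close> and \<open>b M_{m+1}\<close> are constant on the range of interest, and
  \<open>b' = (s - 1) a + z_{m+1} b\<close> has vanishing coefficients there because \<open>z_{m+1}\<close> is the quotient
  of the two constants.  For \<open>a'\<close> let \<open>e\<close> be the solution that exists since \<open>\<tau>_{m+1} \<noteq> 0\<close>.  Then
  \<open>b' - e\<close> solves the problem of \<open>b\<close> without being monic, so it is \<open>g b\<close> for a scalar \<open>g\<close>;
  comparing the values of \<open>corner_value\<close> gives \<open>g = z_{m+1} Q_{m+1}\<close>, that is \<open>e = a'\<close>.\<close>

lemma toda_poly_low:
  assumes "m < n"
  shows "(\<forall>k. n - m \<le> k \<longrightarrow> k < n \<longrightarrow> fps_nth ((1 - fps_X) * (fps_of_poly (toda_poly Q z m) * M m)) k = 0) \<and>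
    (\<forall>k. n - m \<le> k \<longrightarrow> k < n \<longrightarrow> fps_nth (fps_of_poly (toda_poly_open Q z m) * M m) k = 0)"
  using assms
proof (induction m)
  case (Suc m)
  define a where "a = toda_poly Q z m"
  define b where "b = toda_poly_open Q z m"
  define b' where "b' = toda_poly_open Q z (Suc m)"
  define N where "N = M (Suc m)"
  have MN: "M m = (1 - fps_X) * N" unfolding N_def by (rule M)
  have mn: "m < n" using Suc.prems by simp
  have alow: "fps_nth ((1 - fps_X) * (fps_of_poly a * M m)) k = 0" if "n - m \<le> k" "k < n" for k
    using Suc.IH mn that unfolding a_def by blast
  have blow: "fps_nth (fps_of_poly b * M m) k = 0" if "n - m \<le> k" "k < n" for k
    using Suc.IH mn that unfolding b_def by blast
  have ma: "monic_of_degree m a" and mb: "monic_of_degree m b" and mb': "monic_of_degree (Suc m) b'"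
    unfolding a_def b_def b'_def using monic_toda_poly by blast+
  have aval: "fps_nth (fps_of_poly a * M m) k = (-1) ^ m * \<tau> (Suc m) / \<tau> m"
    if "n - Suc m \<le> k" "k < n" for k
    using corner_value[OF mn ma alow] eventually_constant[OF alow mn that] by simp
  have blow': "fps_nth ((1 - fps_X) * (fps_of_poly b * N)) k = 0" if "n - m \<le> k" "k < n" for k
    using blow[OF that] unfolding MN by (simp add: mult_ac)
  have bval: "fps_nth (fps_of_poly b * N) k = (-1) ^ m * \<sigma> (Suc m) / \<sigma> m"
    if "n - Suc m \<le> k" "k < n" for k
    using corner_value_open[OF mn mb blow] eventually_constant[OF blow' mn that]
    unfolding N_def by simp
  have nz: "\<tau> m \<noteq> 0" "\<tau> (Suc m) \<noteq> 0" "\<sigma> m \<noteq> 0" "\<sigma> (Suc m) \<noteq> 0"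
    using tau_nz sigma_nz Suc.prems by simp_all
  have zz: "z (Suc m) = \<tau> (Suc m) * \<sigma> m / (\<sigma> (Suc m) * \<tau> m)"
    using z[of "Suc m"] Suc.prems by simp
  have b'_eq: "fps_of_poly b' * N = fps_const (z (Suc m)) * (fps_of_poly b * N) - fps_of_poly a * M m"
  proof -
    have "fps_of_poly [:-1, 1:] = (fps_X - 1 :: 'a fps)"
      by (simp add: fps_of_poly_pCons fps_of_poly_simps)
    hence eq: "fps_of_poly b' = (fps_X - 1) * fps_of_poly a + fps_const (z (Suc m)) * fps_of_poly b"
      unfolding b'_def toda_poly_open_Suc a_def[symmetric] b_def[symmetric]
      by (simp only: fps_of_poly_add fps_of_poly_mult fps_of_poly_smult)
    show ?thesis unfolding MN eq by (simp add: algebra_simps)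
  qed
  have b'low: "fps_nth (fps_of_poly b' * N) k = 0" if "n - Suc m \<le> k" "k < n" for k
    unfolding b'_eq using aval[OF that] bval[OF that] nz by (simp add: zz)
  have "corner_minor n (Suc m) (M m) \<noteq> 0"
    using tau[of "Suc m"] nz Suc.prems by simp
  then obtain e where e: "degree e \<le> Suc m" "coeff e (Suc m) = 1"
    "\<And>k. n - Suc m \<le> k \<Longrightarrow> k < n \<Longrightarrow> fps_nth (fps_of_poly e * M m) k = 0"
    using corner_minor_existence[of "Suc m" n "M m"] Suc.prems by (auto simp: less_imp_le)
  have me: "monic_of_degree (Suc m) e"
    using e by (auto simp: monic_of_degree_def intro: coeff_eq_0)
  have elow: "fps_nth ((1 - fps_X) * (fps_of_poly e * M (Suc m))) k = 0"
    if "n - Suc m \<le> k" "k < n" for k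
    using e(3)[OF that] unfolding MN N_def by (simp add: mult_ac)
  \<comment> \<open>\<open>b' - e\<close> has degree at most \<open>m\<close> because both are monic, and it satisfies the equations of \<open>b\<close>.\<close>
  define r where "r = b' - e"
  define g where "g = coeff r m"
  have "r - smult g b = 0"
  proof (rule corner_minor_uniqueness)
    show "m \<le> n" using mn by simp
    show "corner_minor n m (M m) \<noteq> 0" using sigma[of m] nz mn by simp
    show "coeff (r - smult g b) l = 0" if ml: "m \<le> l" for l
    proof -
      consider "l = m" | "l = Suc m" | "l > Suc m" using ml by linarith
      thus ?thesis
        using mb mb' me unfolding g_def r_def monic_of_degree_def by cases auto
    qed
    fix k assume k: "n - m \<le> k" "k < n"
    have "fps_nth (fps_of_poly b' * M m) k = 0"
      using one_minus_X_low[OF b'low mn k] unfolding MN by (simp add: mult_ac)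
    moreover have "fps_nth (fps_of_poly e * M m) k = 0" by (rule e(3)) (use k in auto)
    moreover have "fps_of_poly (r - smult g b) * M m =
        fps_of_poly b' * M m - fps_of_poly e * M m - fps_const g * (fps_of_poly b * M m)"
      unfolding r_def by (simp only: fps_of_poly_diff fps_of_poly_smult left_diff_distrib mult.assoc)
    ultimately show "fps_nth (fps_of_poly (r - smult g b) * M m) k = 0"
      using blow[OF k] by simp
  qed
  hence "b' - e = smult g b" unfolding r_def by simp
  hence e_eq: "e = b' - smult g b" by (metis diff_diff_eq2 add_diff_cancel_left')
  have "(-1) ^ Suc m * \<tau> (Suc (Suc m)) / \<tau> (Suc m) = fps_nth (fps_of_poly e * N) (n - 1)"
    unfolding N_def by (rule corner_value[OF Suc.prems me elow, symmetric])
  also have "\<dots> = - (g * fps_nth (fps_of_poly b * N) (n - 1))"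
  proof -
    have "fps_of_poly e * N = fps_of_poly b' * N - fps_const g * (fps_of_poly b * N)"
      unfolding e_eq by (simp only: fps_of_poly_diff fps_of_poly_smult left_diff_distrib mult.assoc)
    moreover have "fps_nth (fps_of_poly b' * N) (n - 1) = 0" by (rule b'low) (use Suc.prems in auto)
    ultimately show ?thesis by simp
  qed
  also have "fps_nth (fps_of_poly b * N) (n - 1) = (-1) ^ m * \<sigma> (Suc m) / \<sigma> m"
    by (rule bval) (use Suc.prems in auto)
  finally have "g * ((-1) ^ m * \<sigma> (Suc m) / \<sigma> m) = (-1) ^ m * \<tau> (Suc (Suc m)) / \<tau> (Suc m)"
    by simp
  hence "g = \<tau> (Suc (Suc m)) * \<sigma> m / (\<tau> (Suc m) * \<sigma> (Suc m))"
    using nz by (simp add: field_simps)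
  also have "\<dots> = z (Suc m) * Q (Suc m)"
  proof -
    have "Q (Suc m) = \<tau> m * \<tau> (Suc (Suc m)) / (\<tau> (Suc m))\<^sup>2" using Q[of "Suc m"] Suc.prems by simp
    thus ?thesis unfolding zz using nz by (simp add: field_simps power2_eq_square)
  qed
  finally have g: "g = z (Suc m) * Q (Suc m)" .
  have "toda_poly Q z (Suc m) = b' - smult g b"
    unfolding g b'_def toda_poly_Suc toda_poly_open_Suc b_def by (rule poly_eqI) (simp add: right_diff_distrib left_diff_distrib)
  hence "toda_poly Q z (Suc m) = e" using e_eq by simp
  thus ?case using elow b'low unfolding b'_def N_def by simp
qed simp

text \<open>Passing from \<open>M_{m-1}\<close> to \<open>M_{d-1}\<close> multiplies by \<open>(1 - u)^{m-d}\<close>, and each factor shortens the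
  range of vanishing coefficients by one at its lower end, from \<open>n - m\<close> up to \<open>n - d\<close>.  So the
  polynomials of degree \<open>d, \<dots>, n - 1\<close> are all killed by the same \<open>d\<close> functionals.\<close>

lemma toda_poly_low_shift:
  assumes "1 \<le> d" "d \<le> m" "m < n" "n - d \<le> k" "k < n"
  shows "fps_nth (fps_of_poly (toda_poly Q z m) * M (d - 1)) k = 0"
  using assms(2,1,4,5)
proof (induction d arbitrary: k rule: inc_induct)
  case base
  have eq: "fps_of_poly (toda_poly Q z m) * M (m - 1) = (1 - fps_X) * (fps_of_poly (toda_poly Q z m) * M m)"
    using M[of "m - 1"] base(1) by (simp add: mult_ac)
  show ?case unfolding eq using toda_poly_low[OF assms(3)] base(2,3) by blast
next
  case (step d)
  have eq: "fps_of_poly (toda_poly Q z m) * M (d - 1) = (1 - fps_X) * (fps_of_poly (toda_poly Q z m) * M (Suc d - 1))"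
    using M[of "d - 1"] step(4) by (simp add: mult_ac)
  show ?case unfolding eq
  proof (rule one_minus_X_low[of n d])
    show "fps_nth (fps_of_poly (toda_poly Q z m) * M (Suc d - 1)) k = 0" if "n - Suc d \<le> k" "k < n" for k
      by (rule step.IH) (use that in auto)
  qed (use step assms(3) in auto)
qed

end

section \<open>Localization\<close>

locale localization_data = cring R for R (structure) +
  fixes S :: "'a set"
  assumes S_carrier: "S \<subseteq> carrier R" and S_one: "\<one> \<in> S"
    and S_mult: "s \<in> S \<Longrightarrow> t \<in> S \<Longrightarrow> s \<otimes> t \<in> S"
begin

lemma S_closed [simp]: "s \<in> S \<Longrightarrow> s \<in> carrier R"
  using S_carrier by blast

lemma loc_relI:
  "u \<in> S \<Longrightarrow> a \<in> carrier R \<Longrightarrow> b \<in> carrier R \<Longrightarrow> s \<in> S \<Longrightarrow> t \<in> S \<Longrightarrow>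
   u \<otimes> (t \<otimes> a) = u \<otimes> (s \<otimes> b) \<Longrightarrow> ((a, s), (b, t)) \<in> loc_rel R S"
  unfolding loc_rel_def by blast

lemma loc_relE:
  assumes "((a, s), (b, t)) \<in> loc_rel R S"
  obtains u where "u \<in> S" "a \<in> carrier R" "b \<in> carrier R" "s \<in> S" "t \<in> S"
    "u \<otimes> (t \<otimes> a) = u \<otimes> (s \<otimes> b)"
  using assms unfolding loc_rel_def by blast

lemma loc_rel_trans:
  assumes "((a, s), (b, t)) \<in> loc_rel R S" "((b, t), (c, r)) \<in> loc_rel R S"
  shows "((a, s), (c, r)) \<in> loc_rel R S"
proof -
  from assms(1) obtain u where u: "u \<in> S" "a \<in> carrier R" "b \<in> carrier R" "s \<in> S" "t \<in> S"
    "u \<otimes> (t \<otimes> a) = u \<otimes> (s \<otimes> b)" by (rule loc_relE)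
  from assms(2) obtain v where v: "v \<in> S" "c \<in> carrier R" "r \<in> S"
    "v \<otimes> (r \<otimes> b) = v \<otimes> (t \<otimes> c)" by (rule loc_relE)
  show ?thesis
  proof (rule loc_relI)
    have "(u \<otimes> v \<otimes> t) \<otimes> (r \<otimes> a) = (v \<otimes> r) \<otimes> (u \<otimes> (t \<otimes> a))"
      using u(1-5) v(1-3) by (simp add: m_ac)
    also have "\<dots> = (u \<otimes> s) \<otimes> (v \<otimes> (r \<otimes> b))"
      unfolding u(6) using u(1-5) v(1-3) by (simp add: m_ac)
    also have "\<dots> = (u \<otimes> v \<otimes> t) \<otimes> (s \<otimes> c)"
      unfolding v(4) using u(1-5) v(1-3) by (simp add: m_ac)
    finally show "(u \<otimes> v \<otimes> t) \<otimes> (r \<otimes> a) = (u \<otimes> v \<otimes> t) \<otimes> (s \<otimes> c)" .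
  qed (use u v in \<open>auto intro: S_mult\<close>)
qed

lemma loc_equiv: "equiv (carrier R \<times> S) (loc_rel R S)"
proof (rule equivI)
  show "loc_rel R S \<subseteq> (carrier R \<times> S) \<times> (carrier R \<times> S)"
    unfolding loc_rel_def by auto
  show "refl_on (carrier R \<times> S) (loc_rel R S)"
    unfolding refl_on_def loc_rel_def using S_one by auto
  show "sym (loc_rel R S)"
    unfolding sym_def loc_rel_def by (auto simp: eq_commute)
  show "trans (loc_rel R S)"
    by (rule transI) (metis loc_rel_trans surj_pair)
qed

lemma loc_frac_eqI: "((a, s), (b, t)) \<in> loc_rel R S \<Longrightarrow> loc_frac R S a s = loc_frac R S b t"
  unfolding loc_frac_def by (rule equiv_class_eq[OF loc_equiv])

text \<open>The operations on classes are unions over representatives, so one has to see that all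
  representatives give the same class.\<close>

lemma loc_frac_mult:
  assumes "a \<in> carrier R" "b \<in> carrier R" "s \<in> S" "t \<in> S"
  shows "loc_frac R S a s \<otimes>\<^bsub>localization R S\<^esub> loc_frac R S b t = loc_frac R S (a \<otimes> b) (s \<otimes> t)"
proof -
  have eq: "loc_frac R S (a' \<otimes> b') (s' \<otimes> t') = loc_frac R S (a \<otimes> b) (s \<otimes> t)"
    if A: "((a, s), (a', s')) \<in> loc_rel R S" and B: "((b, t), (b', t')) \<in> loc_rel R S" for a' b' s' t'
  proof -
    from A obtain u where u: "u \<in> S" "a' \<in> carrier R" "s' \<in> S" "u \<otimes> (s' \<otimes> a) = u \<otimes> (s \<otimes> a')"
      by (rule loc_relE)
    from B obtain v where v: "v \<in> S" "b' \<in> carrier R" "t' \<in> S" "v \<otimes> (t' \<otimes> b) = v \<otimes> (t \<otimes> b')"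
      by (rule loc_relE)
    have "((a \<otimes> b, s \<otimes> t), (a' \<otimes> b', s' \<otimes> t')) \<in> loc_rel R S"
    proof (rule loc_relI)
      have "(u \<otimes> v) \<otimes> ((s' \<otimes> t') \<otimes> (a \<otimes> b)) = (u \<otimes> (s' \<otimes> a)) \<otimes> (v \<otimes> (t' \<otimes> b))"
        using assms u(1-3) v(1-3) by (simp add: m_ac)
      also have "\<dots> = (u \<otimes> v) \<otimes> ((s \<otimes> t) \<otimes> (a' \<otimes> b'))"
        unfolding u(4) v(4) using assms u(1-3) v(1-3) by (simp add: m_ac)
      finally show "(u \<otimes> v) \<otimes> ((s' \<otimes> t') \<otimes> (a \<otimes> b)) = (u \<otimes> v) \<otimes> ((s \<otimes> t) \<otimes> (a' \<otimes> b'))" .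
    qed (use assms u v in \<open>auto intro: S_mult\<close>)
    thus ?thesis by (rule loc_frac_eqI[symmetric])
  qed
  have ref: "((a, s), (a, s)) \<in> loc_rel R S" "((b, t), (b, t)) \<in> loc_rel R S"
    using loc_equiv assms unfolding equiv_def refl_on_def by auto
  have "(\<Union>(a', s')\<in>loc_frac R S a s. \<Union>(b', t')\<in>loc_frac R S b t. loc_frac R S (a' \<otimes> b') (s' \<otimes> t')) =
      loc_frac R S (a \<otimes> b) (s \<otimes> t)"
    using eq ref unfolding loc_frac_def[of _ _ a s] loc_frac_def[of _ _ b t] by blast
  thus ?thesis unfolding localization_def by simp
qed

lemma loc_frac_add:
  assumes "a \<in> carrier R" "b \<in> carrier R" "s \<in> S" "t \<in> S"
  shows "loc_frac R S a s \<oplus>\<^bsub>localization R S\<^esub> loc_frac R S b t =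
    loc_frac R S ((t \<otimes> a) \<oplus> (s \<otimes> b)) (s \<otimes> t)"
proof -
  have eq: "loc_frac R S ((t' \<otimes> a') \<oplus> (s' \<otimes> b')) (s' \<otimes> t') = loc_frac R S ((t \<otimes> a) \<oplus> (s \<otimes> b)) (s \<otimes> t)"
    if A: "((a, s), (a', s')) \<in> loc_rel R S" and B: "((b, t), (b', t')) \<in> loc_rel R S" for a' b' s' t'
  proof -
    from A obtain u where u: "u \<in> S" "a' \<in> carrier R" "s' \<in> S" "u \<otimes> (s' \<otimes> a) = u \<otimes> (s \<otimes> a')"
      by (rule loc_relE)
    from B obtain v where v: "v \<in> S" "b' \<in> carrier R" "t' \<in> S" "v \<otimes> (t' \<otimes> b) = v \<otimes> (t \<otimes> b')"
      by (rule loc_relE)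
    have "(((t \<otimes> a) \<oplus> (s \<otimes> b), s \<otimes> t), ((t' \<otimes> a') \<oplus> (s' \<otimes> b'), s' \<otimes> t')) \<in> loc_rel R S"
    proof (rule loc_relI)
      have "(u \<otimes> v) \<otimes> ((s' \<otimes> t') \<otimes> ((t \<otimes> a) \<oplus> (s \<otimes> b))) =
          (t \<otimes> t' \<otimes> v) \<otimes> (u \<otimes> (s' \<otimes> a)) \<oplus> (s \<otimes> s' \<otimes> u) \<otimes> (v \<otimes> (t' \<otimes> b))"
        using assms u(1-3) v(1-3) by (simp add: m_ac r_distr)
      also have "\<dots> = (u \<otimes> v) \<otimes> ((s \<otimes> t) \<otimes> ((t' \<otimes> a') \<oplus> (s' \<otimes> b')))"
        unfolding u(4) v(4) using assms u(1-3) v(1-3) by (simp add: m_ac r_distr)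
      finally show "(u \<otimes> v) \<otimes> ((s' \<otimes> t') \<otimes> ((t \<otimes> a) \<oplus> (s \<otimes> b))) =
        (u \<otimes> v) \<otimes> ((s \<otimes> t) \<otimes> ((t' \<otimes> a') \<oplus> (s' \<otimes> b')))" .
    qed (use assms u v in \<open>auto intro: S_mult\<close>)
    thus ?thesis by (rule loc_frac_eqI[symmetric])
  qed
  have ref: "((a, s), (a, s)) \<in> loc_rel R S" "((b, t), (b, t)) \<in> loc_rel R S"
    using loc_equiv assms unfolding equiv_def refl_on_def by auto
  have "(\<Union>(a', s')\<in>loc_frac R S a s. \<Union>(b', t')\<in>loc_frac R S b t.
      loc_frac R S ((t' \<otimes> a') \<oplus> (s' \<otimes> b')) (s' \<otimes> t')) = loc_frac R S ((t \<otimes> a) \<oplus> (s \<otimes> b)) (s \<otimes> t)"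
    using eq ref unfolding loc_frac_def[of _ _ a s] loc_frac_def[of _ _ b t] by blast
  thus ?thesis unfolding localization_def by simp
qed

lemma loc_frac_carrier: "a \<in> carrier R \<Longrightarrow> s \<in> S \<Longrightarrow> loc_frac R S a s \<in> carrier (localization R S)"
  unfolding localization_def loc_frac_def by (auto intro: quotientI)

end

section \<open>The ring of the quantum K-theory\<close>

lemma polys_in_add: "p \<in> polys_in V \<Longrightarrow> q \<in> polys_in V \<Longrightarrow> p + q \<in> polys_in V"
  unfolding polys_in_def using keys_add[of p q] by blast

lemma polys_in_uminus: "p \<in> polys_in V \<Longrightarrow> - p \<in> polys_in V"
  unfolding polys_in_def by (simp add: in_keys_iff)

lemma polys_in_mult:
  assumes "p \<in> polys_in V" "q \<in> polys_in V"
  shows "p * q \<in> polys_in V"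
  unfolding polys_in_def
proof safe
  fix m v assume m: "m \<in> Poly_Mapping.keys (p * q)" and v: "v \<in> Poly_Mapping.keys m"
  from m obtain a b where ab: "a \<in> Poly_Mapping.keys p" "b \<in> Poly_Mapping.keys q" "m = a + b"
    using keys_mult[of p q] by blast
  with v have "v \<in> Poly_Mapping.keys a \<union> Poly_Mapping.keys b" using keys_add[of a b] by blast
  thus "v \<in> V" using ab assms unfolding polys_in_def by blast
qed

lemma polys_in_Const [simp]: "Const c \<in> polys_in V"
  unfolding polys_in_def Const_def by simp

lemma polys_in_Var: "v \<in> V \<Longrightarrow> Var v \<in> polys_in V"
  unfolding polys_in_def Var_def by simp

lemma Const_0: "Const 0 = 0" and Const_1: "Const 1 = 1"
  unfolding Const_def by (simp_all add: single_one)

lemma polys_in_0 [simp]: "0 \<in> polys_in V" and polys_in_1 [simp]: "1 \<in> polys_in V"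
  using polys_in_Const[of 0 V] polys_in_Const[of 1 V] by (simp_all add: Const_0 Const_1)

lemma polys_in_diff: "p \<in> polys_in V \<Longrightarrow> q \<in> polys_in V \<Longrightarrow> p - q \<in> polys_in V"
  using polys_in_add[of p V "- q"] polys_in_uminus[of q V] by simp

lemma polys_in_sum: "(\<And>x. x \<in> A \<Longrightarrow> f x \<in> polys_in V) \<Longrightarrow> sum f A \<in> polys_in V"
  by (induction A rule: infinite_finite_induct) (auto intro: polys_in_add)

lemma polys_in_prod: "(\<And>x. x \<in> A \<Longrightarrow> f x \<in> polys_in V) \<Longrightarrow> prod f A \<in> polys_in V"
  by (induction A rule: infinite_finite_induct) (auto intro: polys_in_mult)

lemma polys_in_power: "p \<in> polys_in V \<Longrightarrow> p ^ k \<in> polys_in V"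
  by (induction k) (auto intro: polys_in_mult)

lemma polys_in_of_nat: "of_nat k \<in> polys_in V"
  by (induction k) (auto intro: polys_in_add)

lemma cring_poly_ring: "cring (poly_ring V)"
proof (rule cringI)
  show "abelian_group (poly_ring V)"
  proof (rule abelian_groupI)
    fix x assume "x \<in> carrier (poly_ring V)"
    thus "\<exists>y\<in>carrier (poly_ring V). y \<oplus>\<^bsub>poly_ring V\<^esub> x = \<zero>\<^bsub>poly_ring V\<^esub>"
      by (intro bexI[of _ "- x"]) (auto simp: poly_ring_def polys_in_uminus)
  qed (auto simp: poly_ring_def polys_in_add add_ac)
  show "Group.comm_monoid (poly_ring V)"
    by (rule comm_monoidI) (auto simp: poly_ring_def polys_in_mult mult_ac)
qed (auto simp: poly_ring_def distrib_right)

definition zq_polys :: "nat \<Rightarrow> zq mpoly set" where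
  "zq_polys n = polys_in (Zvar ` {1..n} \<union> Qvar ` {1..n-1})"

lemma carrier_zq_ring: "carrier (zq_ring n) = zq_polys n"
  by (simp add: zq_ring_def poly_ring_def zq_polys_def)

lemma zpoly_in: "j \<in> {1..n} \<Longrightarrow> zpoly j \<in> zq_polys n"
  unfolding zpoly_def zq_polys_def by (rule polys_in_Var) auto

lemma Qpoly_in: "j \<in> {1..n} \<Longrightarrow> Qpoly n j \<in> zq_polys n"
  unfolding Qpoly_def zq_polys_def by (auto intro!: polys_in_Var)

lemmas zq_polys_closed =
  polys_in_add[where V = "Zvar ` {1..n} \<union> Qvar ` {1..n-1}" for n, folded zq_polys_def]
  polys_in_mult[where V = "Zvar ` {1..n} \<union> Qvar ` {1..n-1}" for n, folded zq_polys_def]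
  polys_in_diff[where V = "Zvar ` {1..n} \<union> Qvar ` {1..n-1}" for n, folded zq_polys_def]
  polys_in_sum[where V = "Zvar ` {1..n} \<union> Qvar ` {1..n-1}" for n, folded zq_polys_def]
  polys_in_prod[where V = "Zvar ` {1..n} \<union> Qvar ` {1..n-1}" for n, folded zq_polys_def]
  polys_in_power[where V = "Zvar ` {1..n} \<union> Qvar ` {1..n-1}" for n, folded zq_polys_def]
  polys_in_of_nat[where V = "Zvar ` {1..n} \<union> Qvar ` {1..n-1}" for n, folded zq_polys_def]
  polys_in_1[where V = "Zvar ` {1..n} \<union> Qvar ` {1..n-1}" for n, folded zq_polys_def]

lemma Fpoly_in: "m \<le> n \<Longrightarrow> Fpoly n m i \<in> zq_polys n"
  unfolding Fpoly_def
  by (intro zq_polys_closed zpoly_in Qpoly_in) auto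

lemma QK_ideal: "ideal (QK_ideal n) (zq_ring n)"
  unfolding QK_ideal_def
proof (rule ring.genideal_ideal)
  show "ring (zq_ring n)" unfolding zq_ring_def by (rule cring.axioms(1)[OF cring_poly_ring])
  show "{Fpoly n n i - of_nat (n choose i) |i. i \<in> {1..n}} \<subseteq> carrier (zq_ring n)"
    unfolding carrier_zq_ring by (auto intro!: zq_polys_closed Fpoly_in)
qed

lemma cring_QK: "cring (QK n)"
  unfolding QK_def
  by (rule ideal.quotient_is_cring[OF QK_ideal]) (simp add: zq_ring_def cring_poly_ring)

lemma QK_class_hom: "QK_class n \<in> Ring.ring_hom (zq_ring n) (QK n)"
  using ideal.rcos_ring_hom[OF QK_ideal] unfolding QK_def QK_class_def by (simp add: eta_contract_eq)

lemma QK_class_carrier: "p \<in> zq_polys n \<Longrightarrow> QK_class n p \<in> carrier (QK n)"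
  using ring_hom_closed[OF QK_class_hom] by (simp add: carrier_zq_ring)

lemma QK_class_add: "p \<in> zq_polys n \<Longrightarrow> q \<in> zq_polys n \<Longrightarrow>
    QK_class n (p + q) = QK_class n p \<oplus>\<^bsub>QK n\<^esub> QK_class n q"
  using ring_hom_add[OF QK_class_hom] by (simp add: carrier_zq_ring) (simp add: zq_ring_def poly_ring_def)

lemma QK_class_mult: "p \<in> zq_polys n \<Longrightarrow> q \<in> zq_polys n \<Longrightarrow>
    QK_class n (p * q) = QK_class n p \<otimes>\<^bsub>QK n\<^esub> QK_class n q"
  using ring_hom_mult[OF QK_class_hom] by (simp add: carrier_zq_ring) (simp add: zq_ring_def poly_ring_def)

lemma QK_class_one: "QK_class n 1 = \<one>\<^bsub>QK n\<^esub>"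
  using ring_hom_one[OF QK_class_hom, of n] by (simp add: zq_ring_def poly_ring_def)

lemma localization_data_QK: "localization_data (QK n) (Q_monomials n)"
proof -
  let ?m = "\<lambda>k. \<Prod>i\<in>{1..n-1}. Qpoly n i ^ k i"
  have m: "?m k \<in> zq_polys n" for k
    by (intro zq_polys_closed Qpoly_in) auto
  interpret cring "QK n" by (rule cring_QK)
  show ?thesis
  proof
    show "Q_monomials n \<subseteq> carrier (QK n)"
      unfolding Q_monomials_def using QK_class_carrier[OF m] by auto
    show "\<one>\<^bsub>QK n\<^esub> \<in> Q_monomials n"
      unfolding Q_monomials_def QK_class_one[symmetric] by (rule CollectI, rule exI[of _ "\<lambda>_. 0"]) simp
    fix s t assume "s \<in> Q_monomials n" "t \<in> Q_monomials n"
    then obtain k l where kl: "s = QK_class n (?m k)" "t = QK_class n (?m l)"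
      unfolding Q_monomials_def by blast
    have "s \<otimes>\<^bsub>QK n\<^esub> t = QK_class n (?m (\<lambda>i. k i + l i))"
      unfolding kl QK_class_mult[OF m m, symmetric] by (simp add: power_add prod.distrib)
    thus "s \<otimes>\<^bsub>QK n\<^esub> t \<in> Q_monomials n"
      unfolding Q_monomials_def mem_Collect_eq by (intro exI[of _ "\<lambda>i. k i + l i"]) simp
  qed
qed

lemma to_loc_carrier: "a \<in> carrier (QK n) \<Longrightarrow> to_loc n a \<in> carrier (QK_loc n)"
  unfolding to_loc_def QK_loc_def
  by (rule localization_data.loc_frac_carrier[OF localization_data_QK _ localization_data.S_one[OF localization_data_QK]])

lemma to_loc_mult:
  assumes "a \<in> carrier (QK n)" "b \<in> carrier (QK n)"
  shows "to_loc n (a \<otimes>\<^bsub>QK n\<^esub> b) = to_loc n a \<otimes>\<^bsub>QK_loc n\<^esub> to_loc n b"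
proof -
  interpret localization_data "QK n" "Q_monomials n" by (rule localization_data_QK)
  show ?thesis unfolding to_loc_def QK_loc_def using assms S_one by (simp add: loc_frac_mult)
qed

lemma to_loc_add:
  assumes "a \<in> carrier (QK n)" "b \<in> carrier (QK n)"
  shows "to_loc n (a \<oplus>\<^bsub>QK n\<^esub> b) = to_loc n a \<oplus>\<^bsub>QK_loc n\<^esub> to_loc n b"
proof -
  interpret localization_data "QK n" "Q_monomials n" by (rule localization_data_QK)
  show ?thesis unfolding to_loc_def QK_loc_def using assms S_one by (simp add: loc_frac_add)
qed

text \<open>Composing \<open>\<Phi>\<close> with the canonical maps gives a map from polynomials in \<open>z\<close>, \<open>Q\<close> to a field
  that is a ring homomorphism on \<open>zq_polys n\<close>; only its values on variables and constants enter the argument.\<close>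

locale peterson_map =
  fixes n :: nat and \<Phi> :: "(zq mpoly set \<times> zq mpoly set) set \<Rightarrow> nat mpoly fract"
  assumes Phi: "is_Phi n \<Phi>"
begin

definition eval_QK :: "zq mpoly set \<Rightarrow> nat mpoly fract" where
  "eval_QK a = \<Phi> (to_loc n a)"

definition eval_zq :: "zq mpoly \<Rightarrow> nat mpoly fract" where
  "eval_zq p = eval_QK (QK_class n p)"

lemma Phi_hom: "\<Phi> \<in> Ring.ring_hom (QK_loc n) (Lambda_loc n)"
  using Phi unfolding is_Phi_def ring_iso_def by blast

lemma eval_QK_add: "a \<in> carrier (QK n) \<Longrightarrow> b \<in> carrier (QK n) \<Longrightarrow>
    eval_QK (a \<oplus>\<^bsub>QK n\<^esub> b) = eval_QK a + eval_QK b"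
  using ring_hom_add[OF Phi_hom to_loc_carrier to_loc_carrier]
  by (simp add: eval_QK_def to_loc_add) (simp add: Lambda_loc_def)

lemma eval_QK_mult: "a \<in> carrier (QK n) \<Longrightarrow> b \<in> carrier (QK n) \<Longrightarrow>
    eval_QK (a \<otimes>\<^bsub>QK n\<^esub> b) = eval_QK a * eval_QK b"
  using ring_hom_mult[OF Phi_hom to_loc_carrier to_loc_carrier]
  by (simp add: eval_QK_def to_loc_mult) (simp add: Lambda_loc_def)

lemma eval_add: "p \<in> zq_polys n \<Longrightarrow> q \<in> zq_polys n \<Longrightarrow> eval_zq (p + q) = eval_zq p + eval_zq q"
  unfolding eval_zq_def by (simp add: QK_class_add eval_QK_add QK_class_carrier)

lemma eval_mult: "p \<in> zq_polys n \<Longrightarrow> q \<in> zq_polys n \<Longrightarrow> eval_zq (p * q) = eval_zq p * eval_zq q"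
  unfolding eval_zq_def by (simp add: QK_class_mult eval_QK_mult QK_class_carrier)

lemma eval_Const: "eval_zq (Const c) = to_frac (Const c)"
  using Phi unfolding is_Phi_def eval_zq_def eval_QK_def by blast

lemma eval_0 [simp]: "eval_zq 0 = 0" and eval_1 [simp]: "eval_zq 1 = 1"
  using eval_Const[of 0] eval_Const[of 1]
  by (simp_all add: Const_0 Const_1 to_frac_def Zero_fract_def One_fract_def)

lemma eval_diff:
  assumes "p \<in> zq_polys n" "q \<in> zq_polys n"
  shows "eval_zq (p - q) = eval_zq p - eval_zq q"
  using eval_add[OF zq_polys_closed(3)[OF assms] assms(2)] by simp

lemma eval_sum: "(\<And>x. x \<in> A \<Longrightarrow> f x \<in> zq_polys n) \<Longrightarrow> eval_zq (sum f A) = (\<Sum>x\<in>A. eval_zq (f x))"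
  by (induction A rule: infinite_finite_induct) (simp_all add: eval_add zq_polys_closed)

lemma eval_prod: "(\<And>x. x \<in> A \<Longrightarrow> f x \<in> zq_polys n) \<Longrightarrow> eval_zq (prod f A) = (\<Prod>x\<in>A. eval_zq (f x))"
  by (induction A rule: infinite_finite_induct) (simp_all add: eval_mult zq_polys_closed)

lemma eval_Fpoly:
  assumes "m \<le> n"
  shows "eval_zq (Fpoly n m i) = quantum_elem (\<lambda>j. eval_zq (Qpoly n j)) (\<lambda>j. eval_zq (zpoly j)) m i"
proof -
  have z: "zpoly j \<in> zq_polys n" and Q: "1 - Qpoly n j \<in> zq_polys n" if "j \<in> {1..m}" for j
    using that assms by (auto intro!: zpoly_in zq_polys_closed Qpoly_in)
  have "eval_zq ((\<Prod>j\<in>I. zpoly j) * (\<Prod>j | j \<in> I \<and> j + 1 \<notin> I. 1 - Qpoly n j)) =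
     (\<Prod>j\<in>I. eval_zq (zpoly j)) * (\<Prod>j | j \<in> I \<and> j + 1 \<notin> I. 1 - eval_zq (Qpoly n j))"
    if "I \<subseteq> {1..m}" for I
  proof -
    have I: "j \<in> {1..m}" if "j \<in> I" for j using that \<open>I \<subseteq> {1..m}\<close> by blast
    have "eval_zq ((\<Prod>j\<in>I. zpoly j) * (\<Prod>j | j \<in> I \<and> j + 1 \<notin> I. 1 - Qpoly n j)) =
        eval_zq (\<Prod>j\<in>I. zpoly j) * eval_zq (\<Prod>j | j \<in> I \<and> j + 1 \<notin> I. 1 - Qpoly n j)"
      by (rule eval_mult) (auto intro!: zq_polys_closed(5) z Q I)
    also have "eval_zq (\<Prod>j\<in>I. zpoly j) = (\<Prod>j\<in>I. eval_zq (zpoly j))"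
      by (rule eval_prod) (auto intro!: z I)
    also have "eval_zq (\<Prod>j | j \<in> I \<and> j + 1 \<notin> I. 1 - Qpoly n j) =
        (\<Prod>j | j \<in> I \<and> j + 1 \<notin> I. eval_zq (1 - Qpoly n j))"
      by (rule eval_prod) (auto intro!: Q I)
    also have "\<dots> = (\<Prod>j | j \<in> I \<and> j + 1 \<notin> I. 1 - eval_zq (Qpoly n j))"
    proof (rule prod.cong)
      fix j assume "j \<in> {j. j \<in> I \<and> j + 1 \<notin> I}"
      hence "j \<in> {1..n}" using I assms by force
      thus "eval_zq (1 - Qpoly n j) = 1 - eval_zq (Qpoly n j)"
        using eval_diff[of 1 "Qpoly n j"] Qpoly_in zq_polys_closed(8) by simp
    qed simp
    finally show ?thesis .
  qed
  moreover have "eval_zq (Fpoly n m i) = (\<Sum>I | I \<subseteq> {1..m} \<and> card I = i.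
      eval_zq ((\<Prod>j\<in>I. zpoly j) * (\<Prod>j | j \<in> I \<and> j + 1 \<notin> I. 1 - Qpoly n j)))"
    unfolding Fpoly_def by (rule eval_sum) (auto intro!: zq_polys_closed(2,5) z Q)
  ultimately show ?thesis unfolding quantum_elem_def by (auto intro!: sum.cong)
qed

text \<open>The relation \<open>F_n = 1\<close> reads \<open>z_1 \<cdots> z_n = 1\<close> because \<open>Q_n = 0\<close>.  It makes the images of the
  \<open>z_j\<close> nonzero, hence all \<open>\<tau>_i\<close> and \<open>\<sigma>_i\<close>, without any computation with these polynomials.\<close>

lemma prod_z_eq_1:
  assumes "n \<ge> 1"
  shows "(\<Prod>j\<in>{1..n}. eval_zq (zpoly j)) = 1"
proof -
  have sub: "I \<subseteq> {1..n} \<and> card I = n \<longleftrightarrow> I = {1..n}" for I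
    using card_subset_eq[of "{1..n}" I] by auto
  have "{j. j \<in> {1..n} \<and> j + 1 \<notin> {1..n}} = {n}" using assms by auto
  hence F: "Fpoly n n n = (\<Prod>j\<in>{1..n}. zpoly j)"
    unfolding Fpoly_def sub by (simp add: Qpoly_def)
  have "Fpoly n n n - of_nat (n choose n) \<in> QK_ideal n"
    unfolding QK_ideal_def
  proof (rule subsetD[OF ring.genideal_self])
    show "ring (zq_ring n)" unfolding zq_ring_def by (rule cring.axioms(1)[OF cring_poly_ring])
    show "{Fpoly n n i - of_nat (n choose i) |i. i \<in> {1..n}} \<subseteq> carrier (zq_ring n)"
      unfolding carrier_zq_ring by (auto intro!: zq_polys_closed Fpoly_in)
    show "Fpoly n n n - of_nat (n choose n) \<in> {Fpoly n n i - of_nat (n choose i) |i. i \<in> {1..n}}"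
      using assms by (intro CollectI exI[of _ n]) simp
  qed
  hence "(\<Prod>j\<in>{1..n}. zpoly j) - 1 \<in> QK_ideal n" by (simp add: F)
  moreover have "0 \<in> QK_ideal n"
    using additive_subgroup.zero_closed[OF ideal.axioms(1)[OF QK_ideal]]
    by (simp add: zq_ring_def poly_ring_def)
  moreover have "QK_class n p = QK_ideal n" if "p \<in> QK_ideal n" for p
  proof -
    interpret ideal "QK_ideal n" "zq_ring n" by (rule QK_ideal)
    show ?thesis unfolding QK_class_def by (rule a_rcos_const[OF that])
  qed
  ultimately have "eval_zq ((\<Prod>j\<in>{1..n}. zpoly j) - 1) = eval_zq 0"
    unfolding eval_zq_def by simp
  moreover have "(\<Prod>j\<in>{1..n}. zpoly j) \<in> zq_polys n" by (intro zq_polys_closed zpoly_in)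
  moreover have "eval_zq (\<Prod>j\<in>{1..n}. zpoly j) = (\<Prod>j\<in>{1..n}. eval_zq (zpoly j))"
    by (rule eval_prod) (rule zpoly_in)
  ultimately show ?thesis
    by (simp add: eval_diff zq_polys_closed(8))
qed

end

section \<open>Renaming of variables and Demazure operators\<close>

lemma mpoly_induct_single:
  fixes p :: "'v mpoly"
  assumes "\<And>m c. P (Poly_Mapping.single m c)" "\<And>p q. P p \<Longrightarrow> P q \<Longrightarrow> P (p + q)"
  shows "P p"
proof -
  have "P (\<Sum>k\<in>A. Poly_Mapping.single k (Poly_Mapping.lookup p k))" if "finite A" for A
    using that
  proof (induction A)
    case empty
    show ?case using assms(1)[of 0 0] by simp
  qed (auto intro: assms)
  moreover have "p = (\<Sum>k\<in>Poly_Mapping.keys p. Poly_Mapping.single k (Poly_Mapping.lookup p k))"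
    by (rule poly_mapping_eqI) (auto simp: lookup_sum lookup_single when_def in_keys_iff)
  ultimately show ?thesis by (metis finite_keys)
qed

lemma mpoly_induct [case_names Const Var add mult]:
  fixes p :: "'v mpoly"
  assumes Const: "\<And>c. P (Const c)" and Var: "\<And>v. P (Var v)"
    and add: "\<And>p q. P p \<Longrightarrow> P q \<Longrightarrow> P (p + q)" and mult: "\<And>p q. P p \<Longrightarrow> P q \<Longrightarrow> P (p * q)"
  shows "P p"
proof (rule mpoly_induct_single)
  have pow: "P (Poly_Mapping.single (Poly_Mapping.single v k) 1)" for v k
  proof (induction k)
    case 0
    show ?case using Const[of 1] by (simp add: Const_def)
  next
    case (Suc k)
    have "Poly_Mapping.single (Poly_Mapping.single v (Suc k)) 1 =
        Var v * Poly_Mapping.single (Poly_Mapping.single v k) 1"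
      unfolding Var_def mult_single by (simp add: single_add[symmetric])
    thus ?case using mult[OF Var Suc] by simp
  qed
  fix m :: "'v \<Rightarrow>\<^sub>0 nat" and c :: complex
  have "P (Poly_Mapping.single (\<Sum>v\<in>A. Poly_Mapping.single v (Poly_Mapping.lookup m v)) c)"
    if "finite A" for A
    using that
  proof (induction A)
    case empty
    show ?case using Const[of c] by (simp add: Const_def)
  next
    case (insert v A)
    have "Poly_Mapping.single (\<Sum>v\<in>insert v A. Poly_Mapping.single v (Poly_Mapping.lookup m v)) c =
      Poly_Mapping.single (Poly_Mapping.single v (Poly_Mapping.lookup m v)) 1 *
      Poly_Mapping.single (\<Sum>v\<in>A. Poly_Mapping.single v (Poly_Mapping.lookup m v)) c"
      using insert by (simp add: mult_single)
    thus ?case using mult[OF pow insert.IH] by simp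
  qed
  moreover have "m = (\<Sum>v\<in>Poly_Mapping.keys m. Poly_Mapping.single v (Poly_Mapping.lookup m v))"
    by (rule poly_mapping_eqI) (auto simp: lookup_sum lookup_single when_def in_keys_iff)
  ultimately show "P (Poly_Mapping.single m c)" by (metis finite_keys)
qed (rule add)

definition rename_vars :: "(nat \<Rightarrow> nat) \<Rightarrow> nat mpoly \<Rightarrow> nat mpoly" where
  "rename_vars \<pi> = Poly_Mapping.map_key (Poly_Mapping.map_key \<pi>)"

lemma swap_vars_eq: "swap_vars i = rename_vars (transpose i (i + 1))"
  unfolding swap_vars_def rename_vars_def ..

lemma map_key_inverse:
  assumes "bij \<pi>"
  shows "Poly_Mapping.map_key \<pi> (Poly_Mapping.map_key (inv_into UNIV \<pi>) m) = m"
    and "Poly_Mapping.map_key (inv_into UNIV \<pi>) (Poly_Mapping.map_key \<pi> m) = m"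
  using assms
  by (simp_all add: map_key_compose bij_is_inj bij_imp_bij_inv surj_iff[THEN iffD1] bij_is_surj
      inv_o_cancel map_key_id[folded id_def])

lemma inj_map_key: "bij (\<pi> :: 'a \<Rightarrow> 'a) \<Longrightarrow> inj (Poly_Mapping.map_key \<pi>)"
  by (rule inj_on_inverseI[of _ "Poly_Mapping.map_key (inv_into UNIV \<pi>)"]) (rule map_key_inverse(2))

lemma rename_single:
  assumes "bij \<pi>"
  shows "rename_vars \<pi> (Poly_Mapping.single m c) = Poly_Mapping.single (Poly_Mapping.map_key (inv_into UNIV \<pi>) m) c"
  using map_key_single[OF inj_map_key[OF assms], of "Poly_Mapping.map_key (inv_into UNIV \<pi>) m" c]
  unfolding rename_vars_def map_key_inverse(1)[OF assms] .

lemma rename_add: "bij \<pi> \<Longrightarrow> rename_vars \<pi> (p + q) = rename_vars \<pi> p + rename_vars \<pi> q"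
  unfolding rename_vars_def by (rule map_key_plus) (rule inj_map_key)

lemma rename_mult:
  assumes "bij \<pi>"
  shows "rename_vars \<pi> (p * q) = rename_vars \<pi> p * rename_vars \<pi> q"
proof (induction p rule: mpoly_induct_single)
  case (1 m c)
  show ?case
  proof (induction q rule: mpoly_induct_single)
    case (1 m' c')
    have "inj (inv_into UNIV \<pi>)" using assms by (simp add: bij_imp_bij_inv bij_is_inj)
    thus ?case by (simp add: mult_single rename_single[OF assms] map_key_plus)
  qed (simp add: rename_add[OF assms] distrib_left)
qed (simp add: rename_add[OF assms] distrib_right)

lemma rename_Const: "bij \<pi> \<Longrightarrow> rename_vars \<pi> (Const c) = Const c"
  unfolding Const_def by (simp add: rename_single bij_imp_bij_inv bij_is_inj)

lemma rename_Var: "bij \<pi> \<Longrightarrow> rename_vars \<pi> (Var v) = Var (\<pi> v)"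
  using map_key_single[of "inv_into UNIV \<pi>" "\<pi> v" "1 :: nat"] unfolding Var_def
  by (simp add: rename_single bij_imp_bij_inv bij_is_inj)

lemma rename_0: "bij \<pi> \<Longrightarrow> rename_vars \<pi> 0 = 0" and rename_1: "bij \<pi> \<Longrightarrow> rename_vars \<pi> 1 = 1"
  using rename_Const[of \<pi> 0] rename_Const[of \<pi> 1] by (simp_all add: Const_0 Const_1)

lemma rename_diff:
  assumes "bij \<pi>"
  shows "rename_vars \<pi> (p - q) = rename_vars \<pi> p - rename_vars \<pi> q"
  using rename_add[OF assms, of "p - q" q] by (simp add: algebra_simps)

lemma rename_power: "bij \<pi> \<Longrightarrow> rename_vars \<pi> (p ^ k) = rename_vars \<pi> p ^ k"
  by (induction k) (simp_all add: rename_1 rename_mult)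

lemma rename_prod: "bij \<pi> \<Longrightarrow> rename_vars \<pi> (prod f A) = (\<Prod>x\<in>A. rename_vars \<pi> (f x))"
  by (induction A rule: infinite_finite_induct) (simp_all add: rename_1 rename_mult)

lemmas rename_simps = rename_add rename_mult rename_Const rename_Var rename_0 rename_1 rename_diff
  rename_power rename_prod

lemma rename_compose:
  assumes "bij \<pi>" "bij \<rho>"
  shows "rename_vars \<pi> (rename_vars \<rho> p) = rename_vars (\<pi> \<circ> \<rho>) p"
proof -
  have "bij (\<pi> \<circ> \<rho>)" by (rule bij_comp[OF assms(2,1)])
  thus ?thesis
    by (induction p rule: mpoly_induct) (use assms in \<open>simp_all only: rename_simps o_apply\<close>)
qed

lemma rename_id: "rename_vars id p = p"
  by (induction p rule: mpoly_induct) (simp_all add: id_def rename_simps[OF bij_id, unfolded id_def])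

lemma Var_eq_iff: "Var v = Var w \<longleftrightarrow> v = w"
proof
  assume "Var v = Var w"
  hence "Poly_Mapping.keys (Var v) = Poly_Mapping.keys (Var w)" by simp
  hence "Poly_Mapping.single v (1::nat) = Poly_Mapping.single w 1" by (simp add: Var_def)
  hence "Poly_Mapping.keys (Poly_Mapping.single v (1::nat)) = Poly_Mapping.keys (Poly_Mapping.single w (1::nat))" by simp
  thus "v = w" by simp
qed simp

abbreviation swap_adj :: "nat \<Rightarrow> nat mpoly \<Rightarrow> nat mpoly" where
  "swap_adj i \<equiv> rename_vars (transpose i (Suc i))"

lemma bij_adjacent: "bij (transpose i j :: nat \<Rightarrow> nat)"
  using permutes_bij[OF permutes_swap_id[of i UNIV j]] by simp

text \<open>The polynomials with this property contain constants and variables and are closed under sums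
  and, by the twisted Leibniz rule, under products.\<close>

lemma swap_adj_divisible: "\<exists>g. (Var i - Var (Suc i)) * g = f - swap_adj i f"
proof (induction f rule: mpoly_induct)
  case (Const c)
  show ?case by (rule exI[of _ 0]) (simp add: rename_simps bij_adjacent)
next
  case (Var v)
  have eq: "Var v - swap_adj i (Var v) = (Var i - Var (Suc i)) *
      (if v = i then 1 else if v = Suc i then -1 else 0)"
    by (simp add: rename_simps bij_adjacent)
  show ?case unfolding eq by blast
next
  case (add p q)
  then obtain g h where gh: "(Var i - Var (Suc i)) * g = p - swap_adj i p" "(Var i - Var (Suc i)) * h = q - swap_adj i q"
    by blast
  have "(Var i - Var (Suc i)) * (g + h) = p + q - swap_adj i (p + q)"
    unfolding distrib_left gh by (simp add: rename_simps bij_adjacent)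
  thus ?case by blast
next
  case (mult p q)
  then obtain g h where gh: "(Var i - Var (Suc i)) * g = p - swap_adj i p" "(Var i - Var (Suc i)) * h = q - swap_adj i q"
    by blast
  have "(Var i - Var (Suc i)) * (g * q + swap_adj i p * h) =
      ((Var i - Var (Suc i)) * g) * q + swap_adj i p * ((Var i - Var (Suc i)) * h)"
    by (simp add: algebra_simps)
  also have "\<dots> = p * q - swap_adj i (p * q)"
    unfolding gh by (simp add: rename_simps bij_adjacent algebra_simps)
  finally show ?case by blast
qed

text \<open>The exact division exists: if \<open>f - s_i f = (x_i - x_{i+1}) h\<close>, the quotient is
  \<open>s_i f + (1 - x_{i+1}) h\<close>.\<close>

lemma demazure_eq_iff:
  "demazure i f = g \<longleftrightarrow> (Var i - Var (Suc i)) * g = (1 - Var (Suc i)) * f - (1 - Var i) * swap_adj i f"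
proof -
  let ?R = "(1 - Var (Suc i)) * f - (1 - Var i) * swap_adj i f"
  have nz: "Var i - Var (Suc i) \<noteq> (0 :: nat mpoly)" using Var_eq_iff[of i "Suc i"] by simp
  obtain h where h: "(Var i - Var (Suc i)) * h = f - swap_adj i f" using swap_adj_divisible by blast
  have ex: "(Var i - Var (Suc i)) * (swap_adj i f + (1 - Var (Suc i)) * h) = ?R"
  proof -
    have "(Var i - Var (Suc i)) * (swap_adj i f + (1 - Var (Suc i)) * h) =
      (Var i - Var (Suc i)) * swap_adj i f + (1 - Var (Suc i)) * ((Var i - Var (Suc i)) * h)"
      by (simp add: algebra_simps)
    thus ?thesis unfolding h by (simp add: algebra_simps)
  qed
  have uniq: "g = g'" if "(Var i - Var (Suc i)) * g = ?R" "(Var i - Var (Suc i)) * g' = ?R" for g g'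
    using that nz by (metis mult_cancel_left)
  have "(Var i - Var (Suc i)) * demazure i f = ?R"
    unfolding demazure_def swap_vars_eq Suc_eq_plus1[symmetric]
    by (rule theI, rule ex, rule uniq[OF _ ex])
  thus ?thesis using uniq by blast
qed

lemmas demazure_spec = demazure_eq_iff[THEN iffD1, OF refl]

lemma swap_adj_involution: "swap_adj i (swap_adj i f) = f"
  by (simp add: rename_compose bij_adjacent rename_id)

lemma demazure_symmetric: "swap_adj i (demazure i f) = demazure i f"
proof -
  have nz: "Var i - Var (Suc i) \<noteq> (0 :: nat mpoly)" using Var_eq_iff[of i "Suc i"] by simp
  have "swap_adj i ((Var i - Var (Suc i)) * demazure i f) = swap_adj i ((1 - Var (Suc i)) * f - (1 - Var i) * swap_adj i f)"
    by (simp only: demazure_spec)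
  hence "(Var (Suc i) - Var i) * swap_adj i (demazure i f) = (1 - Var i) * swap_adj i f - (1 - Var (Suc i)) * f"
    by (simp add: rename_simps bij_adjacent swap_adj_involution)
  also have "\<dots> = (Var (Suc i) - Var i) * demazure i f"
    using demazure_spec[of i f] by (simp add: algebra_simps)
  finally have "(Var i - Var (Suc i)) * swap_adj i (demazure i f) = (Var i - Var (Suc i)) * demazure i f"
    by (simp add: algebra_simps)
  thus ?thesis using nz by simp
qed

lemma demazure_fixed: "demazure i f = f \<Longrightarrow> swap_adj i f = f"
  by (metis demazure_symmetric)

lemma demazure_mult_symmetric:
  assumes "swap_adj i h = h"
  shows "demazure i (h * f) = h * demazure i f"
  unfolding demazure_eq_iff mult.left_commute[of _ h] demazure_spec
  by (simp add: rename_simps bij_adjacent assms) (simp add: algebra_simps)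

lemma demazure_Var: "demazure i (Var i) = 1"
  unfolding demazure_eq_iff by (simp add: rename_simps bij_adjacent algebra_simps)

section \<open>Alternants\<close>

text \<open>A transposition \<open>(i k)\<close> is the conjugate of \<open>(i j)\<close> by \<open>(j k)\<close>, so it is reached from adjacent
  ones step by step.\<close>

lemma adjacent_transpositions_generate:
  fixes Q :: "(nat \<Rightarrow> nat) \<Rightarrow> bool"
  assumes "p permutes {a..<b}" and Qid: "Q id"
    and comp: "\<And>p q. Q p \<Longrightarrow> Q q \<Longrightarrow> Q (p \<circ> q)"
    and adj: "\<And>i. a \<le> i \<Longrightarrow> Suc i < b \<Longrightarrow> Q (transpose i (Suc i))"
  shows "Q p"
proof -
  have tr: "Q (transpose i (Suc (i + k)))" if "a \<le> i" "Suc (i + k) < b" for i k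
    using that
  proof (induction k)
    case (Suc k)
    have "transpose i (Suc (i + Suc k)) =
      transpose (i + Suc k) (Suc (i + Suc k)) \<circ> transpose i (Suc (i + k)) \<circ> transpose (i + Suc k) (Suc (i + Suc k))"
      by (rule ext) (auto simp: transpose_def)
    moreover have "Q (transpose (i + Suc k) (Suc (i + Suc k)))" by (rule adj) (use Suc.prems in auto)
    moreover have "Q (transpose i (Suc (i + k)))" using Suc by simp
    ultimately show ?case using comp by presburger
  qed (use adj in simp)
  have "Q (transpose i j)" if ij: "i \<in> {a..<b}" "j \<in> {a..<b}" "i < j" for i j
    using tr[of i "j - Suc i"] ij by simp
  hence tr': "Q (transpose i j)" if "i \<in> {a..<b}" "j \<in> {a..<b}" "i \<noteq> j" for i j
    using that by (metis linorder_neqE_nat transpose_commute)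
  from assms(1) finite_atLeastLessThan show ?thesis
  proof (induction rule: permutes_induct)
    case id
    show ?case by (rule Qid)
  next
    case (swap i j p)
    show ?case by (rule comp[OF tr']) (use swap in auto)
  qed
qed

text \<open>Transports permutations of \<open>{0..<d}\<close>, the index set of matrices, to the indices \<open>1, \<dots>, d\<close> of
  the variables.\<close>

definition shift_perm :: "(nat \<Rightarrow> nat) \<Rightarrow> nat \<Rightarrow> nat" where
  "shift_perm p = (\<lambda>v. case v of 0 \<Rightarrow> 0 | Suc k \<Rightarrow> Suc (p k))"

lemma shift_perm_comp: "shift_perm (p \<circ> q) = shift_perm p \<circ> shift_perm q"
  by (rule ext) (simp add: shift_perm_def split: nat.split)

lemma shift_perm_id: "shift_perm id = id"
  by (rule ext) (simp add: shift_perm_def split: nat.split)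

lemma shift_perm_transpose: "shift_perm (transpose i j) = transpose (Suc i) (Suc j)"
  by (rule ext) (auto simp: shift_perm_def transpose_def split: nat.split)

lemma shift_perm_Suc [simp]: "shift_perm p (Suc k) = Suc (p k)"
  by (simp add: shift_perm_def)

lemma bij_shift_perm:
  assumes "bij p"
  shows "bij (shift_perm p)"
proof (rule o_bij)
  show "shift_perm (inv_into UNIV p) \<circ> shift_perm p = id" "shift_perm p \<circ> shift_perm (inv_into UNIV p) = id"
    unfolding shift_perm_comp[symmetric] using assms
    by (simp_all add: bij_is_inj bij_is_surj shift_perm_id surj_iff[THEN iffD1])
qed

definition alternant :: "nat \<Rightarrow> nat mpoly \<Rightarrow> nat mpoly" where
  "alternant d f = (\<Sum>p | p permutes {0..<d}. signof p * rename_vars (shift_perm p) f)"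

lemma alternant_diff: "alternant d (f - g) = alternant d f - alternant d g"
  unfolding alternant_def sum_subtractf[symmetric]
  by (rule sum.cong) (auto simp: rename_diff bij_shift_perm permutes_bij right_diff_distrib)

lemma alternant_swap:
  assumes "1 \<le> i" "i < d"
  shows "alternant d (swap_adj i f) = - alternant d f"
proof -
  define t where "t = (transpose (i - 1) i :: nat \<Rightarrow> nat)"
  have t: "t permutes {0..<d}" unfolding t_def by (rule permutes_swap_id) (use assms in auto)
  have st: "shift_perm t = transpose i (Suc i)"
    unfolding t_def shift_perm_transpose using assms by simp
  have "alternant d (swap_adj i f) = (\<Sum>p | p permutes {0..<d}. signof p * rename_vars (shift_perm (p \<circ> t)) f)"
    unfolding alternant_def
    by (rule sum.cong) (auto simp: rename_compose bij_shift_perm permutes_bij bij_adjacent shift_perm_comp st)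
  also have "\<dots> = (\<Sum>p | p permutes {0..<d}. - (signof (p \<circ> t) * rename_vars (shift_perm (p \<circ> t)) f))"
  proof (rule sum.cong)
    fix p assume "p \<in> {p. p permutes {0..<d}}"
    hence "sign (p \<circ> t) = - sign p"
      using assms t by (subst sign_compose) (auto simp: permutation_permutes t_def sign_swap_id)
    thus "signof p * rename_vars (shift_perm (p \<circ> t)) f = - (signof (p \<circ> t) * rename_vars (shift_perm (p \<circ> t)) f)"
      by simp
  qed simp
  also have "\<dots> = - alternant d f"
    unfolding alternant_def sum_negf
    by (subst sum_permutations_compose_right[OF t, of "\<lambda>p. signof p * rename_vars (shift_perm p) f"]) simp
  finally show ?thesis .
qed

lemma alternant_mult_symmetric:
  assumes "\<And>i. 1 \<le> i \<Longrightarrow> i < d \<Longrightarrow> swap_adj i h = h"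
  shows "alternant d (h * f) = h * alternant d f"
proof -
  have inv: "rename_vars (shift_perm p) h = h" if "p permutes {0..<d}" for p
  proof -
    have "bij p \<and> rename_vars (shift_perm p) h = h" using that
    proof (rule adjacent_transpositions_generate)
      fix p q assume "bij p \<and> rename_vars (shift_perm p) h = h" "bij q \<and> rename_vars (shift_perm q) h = h"
      thus "bij (p \<circ> q) \<and> rename_vars (shift_perm (p \<circ> q)) h = h"
        by (auto simp: shift_perm_comp bij_comp bij_shift_perm rename_compose[symmetric])
    next
      fix i :: nat assume "Suc i < d"
      thus "bij (transpose i (Suc i)) \<and> rename_vars (shift_perm (transpose i (Suc i))) h = h"
        unfolding shift_perm_transpose using assms[of "Suc i"] bij_adjacent by simp
    next
      show "bij id \<and> rename_vars (shift_perm id) h = h"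
        unfolding shift_perm_id by (intro conjI bij_id rename_id)
    qed
    thus ?thesis by blast
  qed
  show ?thesis unfolding alternant_def sum_distrib_left
    by (rule sum.cong) (auto simp: rename_mult bij_shift_perm permutes_bij inv mult.left_commute)
qed

lemma alternant_prod:
  "alternant d (\<Prod>j<d. Var (Suc j) ^ a j * (1 - Var (Suc j)) ^ b j) =
   det (mat d d (\<lambda>(i, j). Var (Suc j) ^ a i * (1 - Var (Suc j)) ^ b i))"
proof -
  have "rename_vars (shift_perm p) (\<Prod>j<d. Var (Suc j) ^ a j * (1 - Var (Suc j)) ^ b j) =
      (\<Prod>i = 0..<d. mat d d (\<lambda>(i, j). Var (Suc j) ^ a i * (1 - Var (Suc j)) ^ b i) $$ (i, p i))"
    if p: "p permutes {0..<d}" for p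
  proof -
    have "rename_vars (shift_perm p) (\<Prod>j<d. Var (Suc j) ^ a j * (1 - Var (Suc j)) ^ b j) =
        (\<Prod>j<d. Var (Suc (p j)) ^ a j * (1 - Var (Suc (p j))) ^ b j)"
      using p by (simp add: rename_simps bij_shift_perm permutes_bij)
    also have "\<dots> = (\<Prod>i = 0..<d. mat d d (\<lambda>(i, j). Var (Suc j) ^ a i * (1 - Var (Suc j)) ^ b i) $$ (i, p i))"
      unfolding atLeast0LessThan by (rule prod.cong) (use permutes_in_image[OF p] in auto)
    finally show ?thesis .
  qed
  thus ?thesis unfolding alternant_def
    by (subst det_def'[of _ d]) (auto intro!: sum.cong)
qed

text \<open>The weight that makes the alternant insensitive to Demazure operators.\<close>

definition rho_poly :: "nat \<Rightarrow> nat mpoly" where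
  "rho_poly d = (\<Prod>j<d. (1 - Var (Suc j)) ^ j)"

text \<open>Write \<open>\<rho> = r (1 - x_{i+1})\<close> with \<open>r\<close> symmetric under \<open>s_i\<close>.  Then both \<open>\<rho> \<pi>_i f\<close> and \<open>\<rho> f\<close> have
  the same antisymmetrization under \<open>s_i\<close>, namely \<open>r (x_i - x_{i+1}) \<pi>_i f\<close>, and twice the
  alternant only depends on that.\<close>

lemma alternant_demazure:
  assumes i: "1 \<le> i" "i < d"
  shows "alternant d (rho_poly d * demazure i f) = alternant d (rho_poly d * f)"
proof -
  obtain k where k: "i = Suc k" using i by (cases i) auto
  define r where "r = ((1 - Var i) * (1 - Var (Suc i))) ^ k * (\<Prod>j\<in>{..<d} - {k, i}. (1 - Var (Suc j)) ^ j :: nat mpoly)"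
  have rho: "rho_poly d = r * (1 - Var (Suc i))"
  proof -
    have "{..<d} = insert k (insert i ({..<d} - {k, i}))" using i k by auto
    hence "rho_poly d = (\<Prod>j\<in>insert k (insert i ({..<d} - {k, i})). (1 - Var (Suc j)) ^ j)"
      unfolding rho_poly_def by simp
    also have "\<dots> = r * (1 - Var (Suc i))"
      unfolding r_def using k by (simp add: power_mult_distrib mult_ac)
    finally show ?thesis .
  qed
  have sr: "swap_adj i r = r"
  proof -
    have "swap_adj i (\<Prod>j\<in>{..<d} - {k, i}. (1 - Var (Suc j)) ^ j) = (\<Prod>j\<in>{..<d} - {k, i}. (1 - Var (Suc j)) ^ j)"
      unfolding rename_prod[OF bij_adjacent]
      by (rule prod.cong) (use k in \<open>auto simp: rename_simps bij_adjacent transpose_def\<close>)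
    thus ?thesis unfolding r_def by (simp add: rename_simps bij_adjacent mult.commute)
  qed
  let ?g = "demazure i f"
  have *: "rho_poly d * ?g - swap_adj i (rho_poly d * ?g) = rho_poly d * f - swap_adj i (rho_poly d * f)"
  proof -
    have "rho_poly d * ?g - swap_adj i (rho_poly d * ?g) = r * ((Var i - Var (Suc i)) * ?g)"
      unfolding rho by (simp add: rename_mult bij_adjacent sr demazure_symmetric)
        (simp add: rename_simps bij_adjacent algebra_simps)
    also have "\<dots> = rho_poly d * f - swap_adj i (rho_poly d * f)"
      unfolding demazure_spec rho by (simp add: rename_mult bij_adjacent sr)
        (simp add: rename_simps bij_adjacent algebra_simps)
    finally show ?thesis .
  qed
  have "2 * alternant d (rho_poly d * ?g) = alternant d (rho_poly d * ?g - swap_adj i (rho_poly d * ?g))"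
    unfolding alternant_diff alternant_swap[OF i] by simp
  also have "\<dots> = 2 * alternant d (rho_poly d * f)"
    unfolding * alternant_diff alternant_swap[OF i] by simp
  finally show ?thesis by simp
qed

section \<open>Lehmer codes and dominant permutations\<close>

definition lehmer :: "nat \<Rightarrow> (nat \<Rightarrow> nat) \<Rightarrow> nat \<Rightarrow> nat" where
  "lehmer n w i = card {j \<in> {i<..n}. w j < w i}"

lemma perm_length_lehmer: "perm_length n w = (\<Sum>i\<in>{1..n}. lehmer n w i)"
proof -
  have "{(i, j). i \<in> {1..n} \<and> j \<in> {1..n} \<and> i < j \<and> w i > w j} =
      (SIGMA i:{1..n}. {j \<in> {i<..n}. w j < w i})" by auto
  thus ?thesis unfolding perm_length_def lehmer_def by (simp add: card_SigmaI)
qed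

lemma swap_permutes: "w permutes {1..n} \<Longrightarrow> 1 \<le> i \<Longrightarrow> i < n \<Longrightarrow> w \<circ> transpose i (Suc i) permutes {1..n}"
  by (rule permutes_compose[OF permutes_swap_id]) auto

text \<open>At an ascent, the exchange of positions exchanges the two code entries and adds one to the
  first of them.\<close>

lemma lehmer_swap:
  assumes w: "w permutes {1..n}" and i: "1 \<le> i" "i < n" and asc: "w i < w (Suc i)"
  shows "lehmer n (w \<circ> transpose i (Suc i)) k =
    (if k = i then Suc (lehmer n w (Suc i)) else if k = Suc i then lehmer n w i else lehmer n w k)"
proof -
  let ?v = "w \<circ> transpose i (Suc i)"
  consider "k = i" | "k = Suc i" | "k \<noteq> i" "k \<noteq> Suc i" by blast
  thus ?thesis
  proof cases
    case 1
    have "{j \<in> {i<..n}. ?v j < ?v i} = insert (Suc i) {j \<in> {Suc i<..n}. w j < w (Suc i)}"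
      using asc i by (auto simp: transpose_def)
    thus ?thesis unfolding lehmer_def 1 by simp
  next
    case 2
    have "{j \<in> {Suc i<..n}. ?v j < ?v (Suc i)} = {j \<in> {i<..n}. w j < w i}"
    proof (intro Set.set_eqI iffI)
      fix j assume "j \<in> {j \<in> {i<..n}. w j < w i}"
      moreover from this asc have "j \<noteq> Suc i" by auto
      ultimately show "j \<in> {j \<in> {Suc i<..n}. ?v j < ?v (Suc i)}" by (auto simp: transpose_def)
    qed (auto simp: transpose_def)
    thus ?thesis unfolding lehmer_def 2 by simp
  next
    case 3
    have "bij_betw (transpose i (Suc i)) {j \<in> {k<..n}. ?v j < ?v k} {j \<in> {k<..n}. w j < w k}"
    proof (rule bij_betw_byWitness[where f' = "transpose i (Suc i)"])
      have tk: "transpose i (Suc i) k = k" using 3 by (auto simp: transpose_def)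
      have mem: "transpose i (Suc i) j \<in> {k<..n}" if "j \<in> {k<..n}" for j
        using that i 3 by (auto simp: transpose_def)
      show "transpose i (Suc i) ` {j \<in> {k<..n}. ?v j < ?v k} \<subseteq> {j \<in> {k<..n}. w j < w k}"
      proof (intro image_subsetI CollectI conjI)
        fix j assume j: "j \<in> {j \<in> {k<..n}. ?v j < ?v k}"
        thus "transpose i (Suc i) j \<in> {k<..n}" by (intro mem) blast
        show "w (transpose i (Suc i) j) < w k" using j tk by simp
      qed
      show "transpose i (Suc i) ` {j \<in> {k<..n}. w j < w k} \<subseteq> {j \<in> {k<..n}. ?v j < ?v k}"
      proof (intro image_subsetI CollectI conjI)
        fix j assume j: "j \<in> {j \<in> {k<..n}. w j < w k}"
        thus "transpose i (Suc i) j \<in> {k<..n}" by (intro mem) blast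
        show "?v (transpose i (Suc i) j) < ?v k" using j tk by simp
      qed
    qed auto
    thus ?thesis using 3 bij_betw_same_card unfolding lehmer_def by simp
  qed
qed

lemma perm_length_swap:
  assumes w: "w permutes {1..n}" and i: "1 \<le> i" "i < n" and asc: "w i < w (Suc i)"
  shows "perm_length n (w \<circ> transpose i (Suc i)) = perm_length n w + 1"
proof -
  have split: "{1..n} = insert i (insert (Suc i) ({1..n} - {i, Suc i}))" using i by auto
  have s: "(\<Sum>k\<in>{1..n}. f k) = f i + f (Suc i) + (\<Sum>k\<in>{1..n} - {i, Suc i}. f k)" for f :: "nat \<Rightarrow> nat"
    by (subst split) simp
  have "(\<Sum>k\<in>{1..n} - {i, Suc i}. lehmer n (w \<circ> transpose i (Suc i)) k) =
      (\<Sum>k\<in>{1..n} - {i, Suc i}. lehmer n w k)"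
    by (rule sum.cong) (auto simp: lehmer_swap[OF assms])
  thus ?thesis unfolding perm_length_lehmer s by (simp add: lehmer_swap[OF assms])
qed

lemma comp_transpose_twice: "w \<circ> transpose i j \<circ> transpose i j = w"
  by (rule ext) simp

lemma perm_length_swap_descent:
  assumes w: "w permutes {1..n}" and i: "1 \<le> i" "i < n" and desc: "w (Suc i) < w i"
  shows "perm_length n (w \<circ> transpose i (Suc i)) + 1 = perm_length n w"
proof -
  have "perm_length n (w \<circ> transpose i (Suc i) \<circ> transpose i (Suc i)) =
      perm_length n (w \<circ> transpose i (Suc i)) + 1"
    by (rule perm_length_swap[OF swap_permutes[OF w i] i]) (use desc in simp)
  thus ?thesis by (simp only: comp_transpose_twice)
qed

lemma perm_neq: "w permutes {1..n} \<Longrightarrow> i \<noteq> j \<Longrightarrow> w i \<noteq> w j"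
  using permutes_inj[of w] by (auto simp: inj_eq)

lemma lehmer_le: "lehmer n w i \<le> n - i"
proof -
  have "lehmer n w i \<le> card {i<..n}" unfolding lehmer_def by (rule card_mono) auto
  thus ?thesis by simp
qed

text \<open>If no smaller value stands to the left, all \<open>w i - 1\<close> smaller values stand to the right.\<close>

lemma lehmer_eq_if_larger_before:
  assumes w: "w permutes {1..n}" and i: "i \<in> {1..n}" and before: "\<And>j. 1 \<le> j \<Longrightarrow> j < i \<Longrightarrow> w i < w j"
  shows "lehmer n w i = w i - 1"
proof -
  have "bij_betw w {j \<in> {1..n}. w j < w i} {1..<w i}"
  proof (rule bij_betwI')
    fix y assume "y \<in> {1..<w i}"
    moreover have "w i \<in> {1..n}" using permutes_in_image[OF w] i by simp
    ultimately have "y \<in> {1..n}" by auto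
    then obtain x where "x \<in> {1..n}" "w x = y" using permutes_image[OF w] by (metis imageE)
    thus "\<exists>x\<in>{j \<in> {1..n}. w j < w i}. y = w x" using \<open>y \<in> {1..<w i}\<close> by auto
  next
    fix x assume "x \<in> {j \<in> {1..n}. w j < w i}"
    thus "w x \<in> {1..<w i}" using permutes_in_image[OF w, of x] by auto
  qed (use permutes_inj[OF w] in \<open>auto simp: inj_eq\<close>)
  moreover have "{j \<in> {1..n}. w j < w i} = {j \<in> {i<..n}. w j < w i}"
  proof (intro Set.set_eqI iffI)
    fix j assume j: "j \<in> {j \<in> {1..n}. w j < w i}"
    hence "\<not> j < i" using before[of j] by auto
    moreover have "j \<noteq> i" using j by auto
    ultimately show "j \<in> {j \<in> {i<..n}. w j < w i}" using j by auto
  qed (use i in auto)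
  ultimately show ?thesis unfolding lehmer_def using bij_betw_same_card by fastforce
qed

lemma permutes_no_ascent:
  assumes w: "w permutes {1..n}" and desc: "\<And>i. 1 \<le> i \<Longrightarrow> i < n \<Longrightarrow> w (Suc i) < w i"
  shows "w = longest_perm n"
proof
  fix i
  show "w i = longest_perm n i"
  proof (cases "i \<in> {1..n}")
    case False
    thus ?thesis using w unfolding longest_perm_def permutes_def by auto
  next
    case True
    have anti: "w k < w j" if "1 \<le> j" "j < k" "k \<le> n" for j k
      using that(2,1,3)
    proof (induction k rule: less_induct)
      case (less k)
      then obtain k' where k': "k = Suc k'" by (cases k) auto
      show ?case
      proof (cases "j = k'")
        case False
        hence "w k' < w j" using less k' by auto
        thus ?thesis using desc[of k'] less k' by auto
      qed (use desc[of k'] less k' in auto)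
    qed
    have "{j \<in> {i<..n}. w j < w i} = {i<..n}" using anti True by auto
    hence "lehmer n w i = n - i" unfolding lehmer_def by simp
    moreover have "lehmer n w i = w i - 1"
      by (rule lehmer_eq_if_larger_before[OF w True]) (use anti True in auto)
    moreover have "w i \<ge> 1" using permutes_in_image[OF w, of i] True by simp
    ultimately show ?thesis using True unfolding longest_perm_def by auto
  qed
qed

locale grothendieck_family =
  fixes n :: nat and G :: "(nat \<Rightarrow> nat) \<Rightarrow> nat mpoly"
  assumes G: "grothendieck_polynomials n G"
begin

lemma G_longest: "G (longest_perm n) = (\<Prod>i\<in>{1..n-1}. Var i ^ (n - i))"
  using G unfolding grothendieck_polynomials_def by blast

lemma G_descent:
  assumes "w permutes {1..n}" "1 \<le> i" "i < n" "w (Suc i) < w i"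
  shows "demazure i (G w) = G (w \<circ> transpose i (Suc i))"
  using G perm_length_swap_descent[OF assms] assms
  unfolding grothendieck_polynomials_def Let_def Suc_eq_plus1 by auto

lemma G_ascent:
  assumes "w permutes {1..n}" "1 \<le> i" "i < n" "w i < w (Suc i)"
  shows "demazure i (G w) = G w"
  using G perm_length_swap[OF assms] assms
  unfolding grothendieck_polynomials_def Let_def Suc_eq_plus1 by auto

text \<open>Descending induction on the length, starting at the longest permutation.  Otherwise take the
  first ascent \<open>i\<close>.  Since the code is weakly decreasing, its entries at \<open>i\<close> and \<open>i + 1\<close> agree;
  since there are descents before \<open>i\<close>, raising the entry at \<open>i\<close> by one keeps the code weakly
  decreasing.  So the induction hypothesis applies to \<open>w s_i\<close>, and \<open>\<pi>_i\<close> turns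
  \<open>x_i^{c+1} x_{i+1}^c\<close> into \<open>x_i^c x_{i+1}^c\<close>.\<close>

lemma G_dominant:
  assumes "w permutes {1..n}" "\<And>i j. 1 \<le> i \<Longrightarrow> i \<le> j \<Longrightarrow> j \<le> n \<Longrightarrow> lehmer n w j \<le> lehmer n w i"
  shows "G w = (\<Prod>i\<in>{1..n}. Var i ^ lehmer n w i)"
  using assms
proof (induction "n * n - perm_length n w" arbitrary: w rule: less_induct)
  case less
  note w = less.prems(1) and dom = less.prems(2)
  show ?case
  proof (cases "\<exists>i. 1 \<le> i \<and> i < n \<and> w i < w (Suc i)")
    case False
    have desc: "w (Suc i) < w i" if "1 \<le> i" "i < n" for i
      using False that perm_neq[OF w, of i "Suc i"] by (metis linorder_neqE_nat n_not_Suc_n)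
    have wl: "w = longest_perm n" by (rule permutes_no_ascent[OF w desc])
    have "lehmer n w i = n - i" if "i \<in> {1..n}" for i
    proof -
      have "{j \<in> {i<..n}. w j < w i} = {i<..n}" unfolding wl longest_perm_def using that by auto
      thus ?thesis unfolding lehmer_def by simp
    qed
    hence "(\<Prod>i\<in>{1..n}. Var i ^ lehmer n w i) = (\<Prod>i\<in>{1..n}. Var i ^ (n - i) :: nat mpoly)"
      by (intro prod.cong) auto
    also have "\<dots> = (\<Prod>i\<in>{1..n-1}. Var i ^ (n - i))"
      by (rule prod.mono_neutral_right) auto
    finally show ?thesis using G_longest wl by simp
  next
    case True
    define i where "i = (LEAST i. 1 \<le> i \<and> i < n \<and> w i < w (Suc i))"
    have i: "1 \<le> i" "i < n" "w i < w (Suc i)"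
      using LeastI_ex[OF True] unfolding i_def by auto
    have least: "\<not> w j < w (Suc j)" if "1 \<le> j" "j < i" for j
      using not_less_Least[of j "\<lambda>i. 1 \<le> i \<and> i < n \<and> w i < w (Suc i)"] that i
      unfolding i_def[symmetric] by auto
    let ?v = "w \<circ> transpose i (Suc i)"
    have v: "?v permutes {1..n}" by (rule swap_permutes[OF w i(1,2)])
    note code = lehmer_swap[OF w i]
    have "lehmer n w i \<le> lehmer n w (Suc i)"
      unfolding lehmer_def
    proof (rule card_mono)
      show "{j \<in> {i<..n}. w j < w i} \<subseteq> {j \<in> {Suc i<..n}. w j < w (Suc i)}"
      proof
        fix j assume j: "j \<in> {j \<in> {i<..n}. w j < w i}"
        hence "j \<noteq> Suc i" using i(3) by auto
        thus "j \<in> {j \<in> {Suc i<..n}. w j < w (Suc i)}" using j i(3) by auto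
      qed
    qed simp
    hence eq: "lehmer n w (Suc i) = lehmer n w i" using dom[of i "Suc i"] i by simp
    have before: "Suc (lehmer n w i) \<le> lehmer n w j" if j: "1 \<le> j" "j < i" for j
    proof -
      obtain k where k: "i = Suc k" using j by (cases i) auto
      have wk: "w i < w k" using least[of k] perm_neq[OF w, of i k] j k by auto
      have "lehmer n w k > lehmer n w i" unfolding lehmer_def
      proof (rule psubset_card_mono)
        have "{j \<in> {i<..n}. w j < w i} \<subseteq> {j \<in> {k<..n}. w j < w k}" using wk k by auto
        moreover have "i \<in> {j \<in> {k<..n}. w j < w k}" "i \<notin> {j \<in> {i<..n}. w j < w i}"
          using wk k i by auto
        ultimately show "{j \<in> {i<..n}. w j < w i} \<subset> {j \<in> {k<..n}. w j < w k}" by blast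
      qed simp
      moreover have "lehmer n w k \<le> lehmer n w j" by (rule dom) (use j k i in auto)
      ultimately show ?thesis by simp
    qed
    have dom': "lehmer n ?v l \<le> lehmer n ?v k" if kl: "1 \<le> k" "k \<le> l" "l \<le> n" for k l
      using dom[OF kl] dom[of "Suc i" l] dom[of i l] dom[of k i] before[of k] eq kl i
      unfolding code by (auto split: if_splits)
    have lv: "perm_length n ?v = perm_length n w + 1" by (rule perm_length_swap[OF w i])
    have "perm_length n ?v \<le> n * n"
    proof -
      have "perm_length n ?v \<le> (\<Sum>i\<in>{1..n}. n)" unfolding perm_length_lehmer
        by (rule sum_mono) (use lehmer_le in \<open>meson diff_le_self le_trans\<close>)
      thus ?thesis by simp
    qed
    hence IH: "G ?v = (\<Prod>i\<in>{1..n}. Var i ^ lehmer n ?v i)"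
      by (intro less.hyps v dom') (use lv in auto)
    define c where "c = lehmer n w i"
    define r where "r = (Var i * Var (Suc i)) ^ c * (\<Prod>k\<in>{1..n} - {i, Suc i}. Var k ^ lehmer n w k :: nat mpoly)"
    have split: "{1..n} = insert i (insert (Suc i) ({1..n} - {i, Suc i}))" using i by auto
    have s: "(\<Prod>k\<in>{1..n}. f k) = f i * f (Suc i) * (\<Prod>k\<in>{1..n} - {i, Suc i}. f k)" for f :: "nat \<Rightarrow> nat mpoly"
      by (subst split) (simp add: mult.assoc)
    have "(\<Prod>k\<in>{1..n} - {i, Suc i}. Var k ^ lehmer n ?v k) =
        (\<Prod>k\<in>{1..n} - {i, Suc i}. Var k ^ lehmer n w k :: nat mpoly)"
      by (rule prod.cong) (auto simp: code)
    hence Gv: "G ?v = r * Var i"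
      unfolding IH s r_def by (simp add: code eq c_def power_mult_distrib mult_ac)
    have wr: "(\<Prod>i\<in>{1..n}. Var i ^ lehmer n w i) = r"
      unfolding s r_def by (simp add: eq c_def power_mult_distrib)
    have sr: "swap_adj i r = r"
    proof -
      have "swap_adj i (\<Prod>k\<in>{1..n} - {i, Suc i}. Var k ^ lehmer n w k) = (\<Prod>k\<in>{1..n} - {i, Suc i}. Var k ^ lehmer n w k)"
        unfolding rename_prod[OF bij_adjacent]
        by (rule prod.cong) (auto simp: rename_simps bij_adjacent transpose_def)
      thus ?thesis unfolding r_def by (simp add: rename_simps bij_adjacent mult.commute)
    qed
    have "G (?v \<circ> transpose i (Suc i)) = demazure i (G ?v)"
      by (rule G_descent[symmetric, OF v i(1,2)]) (use i in auto)
    also have "\<dots> = r" unfolding Gv demazure_mult_symmetric[OF sr] demazure_Var by simp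
    finally show ?thesis unfolding wr by (simp only: comp_transpose_twice)
  qed
qed

text \<open>For an adjacent transposition one of the two Grothendieck polynomials is \<open>\<pi>_i\<close> of the other, in
  either direction, and the alternant does not see \<open>\<pi>_i\<close>.  Arguing with all of the symmetric group
  in this way avoids reduced words.\<close>

lemma alternant_invariant:
  assumes w: "w permutes {1..n}" and d: "d \<le> n" and p: "p permutes {1..d}"
  shows "alternant d (rho_poly d * G (w \<circ> p)) = alternant d (rho_poly d * G w)"
proof -
  let ?Q = "\<lambda>p. p permutes {1..n} \<and> (\<forall>w. w permutes {1..n} \<longrightarrow>
    alternant d (rho_poly d * G (w \<circ> p)) = alternant d (rho_poly d * G w))"
  have "?Q p"
  proof (rule adjacent_transpositions_generate[where a = 1 and b = "Suc d" and Q = ?Q])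
    show "p permutes {1..<Suc d}" using p by (simp add: atLeastLessThanSuc_atLeastAtMost)
    fix p q assume p: "?Q p" and q: "?Q q"
    show "?Q (p \<circ> q)"
    proof (intro conjI allI impI)
      show "p \<circ> q permutes {1..n}" using p q by (blast intro: permutes_compose)
      fix w assume w: "w permutes {1..n}"
      have "w \<circ> p permutes {1..n}" using p w by (blast intro: permutes_compose)
      hence "alternant d (rho_poly d * G (w \<circ> p \<circ> q)) = alternant d (rho_poly d * G (w \<circ> p))"
        using q by blast
      also have "\<dots> = alternant d (rho_poly d * G w)" using p w by blast
      finally show "alternant d (rho_poly d * G (w \<circ> (p \<circ> q))) = alternant d (rho_poly d * G w)"
        by (simp only: o_assoc)
    qed
  next
    fix i assume i: "1 \<le> i" "Suc i < Suc d"
    have "alternant d (rho_poly d * G (w \<circ> transpose i (Suc i))) = alternant d (rho_poly d * G w)"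
      if w: "w permutes {1..n}" for w
    proof -
      let ?v = "w \<circ> transpose i (Suc i)"
      have v: "?v permutes {1..n}" by (rule swap_permutes[OF w]) (use i d in auto)
      have vv: "?v \<circ> transpose i (Suc i) = w" by (simp only: comp_transpose_twice)
      consider "w (Suc i) < w i" | "w i < w (Suc i)"
        using perm_neq[OF w, of i "Suc i"] by linarith
      thus ?thesis
      proof cases
        case 1
        have "G ?v = demazure i (G w)" by (rule G_descent[symmetric, OF w]) (use 1 i d in auto)
        thus ?thesis using alternant_demazure[of i d "G w"] i by simp
      next
        case 2
        have "G (?v \<circ> transpose i (Suc i)) = demazure i (G ?v)"
          by (rule G_descent[symmetric, OF v]) (use 2 i d in auto)
        thus ?thesis unfolding vv using alternant_demazure[of i d "G ?v"] i by simp
      qed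
    qed
    moreover have "transpose i (Suc i) permutes {1..n}"
      by (rule permutes_swap_id) (use i d in auto)
    ultimately show "?Q (transpose i (Suc i))" by blast
  qed (simp add: permutes_id)
  thus ?thesis using w by blast
qed

end

section \<open>Grassmannian permutations\<close>

text \<open>The polynomials \<open>a_i\<close> of both determinants; for \<open>\<mu> = i\<close> they are, up to binomial
  coefficients, the Bernstein basis of degree \<open>d - 1\<close>.\<close>

definition bernstein_poly :: "nat \<Rightarrow> nat \<Rightarrow> nat \<Rightarrow> 'a::comm_ring_1 poly" where
  "bernstein_poly d \<mu> i = monom 1 \<mu> * [:1, -1:] ^ (d - Suc i)"

lemma coeff_bernstein_poly_low: "l < \<mu> \<Longrightarrow> coeff (bernstein_poly d \<mu> i) l = 0"
  unfolding bernstein_poly_def by (simp add: coeff_monom_mult)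

lemma coeff_bernstein_poly_diag: "coeff (bernstein_poly d \<mu> i) \<mu> = 1"
  unfolding bernstein_poly_def by (simp add: coeff_monom_mult poly_0_coeff_0[symmetric] poly_power)

lemma coeff_bernstein_poly_high:
  assumes "\<mu> + (d - Suc i) < l"
  shows "coeff (bernstein_poly d \<mu> i :: 'a::comm_ring_1 poly) l = 0"
proof (rule coeff_eq_0)
  have "degree ([:1, -1:] ^ (d - Suc i) :: 'a poly) \<le> degree ([:1, -1:] :: 'a poly) * (d - Suc i)"
    by (rule degree_power_le)
  also have "\<dots> \<le> 1 * (d - Suc i)" by (rule mult_right_mono) auto
  finally have "degree (bernstein_poly d \<mu> i :: 'a poly) \<le> \<mu> + (d - Suc i)"
    unfolding bernstein_poly_def using degree_mult_le[of "monom 1 \<mu> :: 'a poly" "[:1, -1:] ^ (d - Suc i)"]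
      degree_monom_le[of "1 :: 'a" \<mu>] by linarith
  thus "degree (bernstein_poly d \<mu> i :: 'a poly) < l" using assms by simp
qed

lemma poly_bernstein_poly: "poly (bernstein_poly d \<mu> i) z = z ^ \<mu> * (1 - z) ^ (d - Suc i)"
  unfolding bernstein_poly_def by (simp add: poly_monom)

lemma poly_as_sum:
  fixes p :: "'a::comm_ring_1 poly"
  assumes "\<And>l. L \<le> l \<Longrightarrow> coeff p l = 0"
  shows "poly p z = (\<Sum>l<L. coeff p l * z ^ l)"
proof -
  have "poly p z = (\<Sum>l\<in>{..degree p}. coeff p l * z ^ l)" by (rule poly_altdef)
  also have "\<dots> = (\<Sum>l\<in>{..degree p} \<union> {..<L}. coeff p l * z ^ l)"
    by (rule sum.mono_neutral_left) (auto simp: coeff_eq_0 not_le)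
  also have "\<dots> = (\<Sum>l<L. coeff p l * z ^ l)"
    by (rule sum.mono_neutral_right) (use assms in \<open>auto simp: not_less\<close>)
  finally show ?thesis .
qed

lemma det_bernstein_rows:
  fixes x :: "nat \<Rightarrow> nat \<Rightarrow> 'a::comm_ring_1"
  shows "det (mat d d (\<lambda>(i, j). \<Sum>l<d. coeff (bernstein_poly d i i) l * x l j)) = det (mat d d (\<lambda>(i, j). x i j))"
  unfolding det_row_combination
  by (subst det_upper_unitriangular) (auto simp: coeff_bernstein_poly_low coeff_bernstein_poly_diag)

text \<open>The polynomials \<open>u^i (1 - u)^{d-1-i}\<close> arise from \<open>1, u, \<dots>, u^{d-1}\<close> by a unitriangular
  transformation.\<close>

lemma vandermonde_bernstein:
  fixes z :: "nat \<Rightarrow> 'a::comm_ring_1"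
  shows "det (mat d d (\<lambda>(i, j). z j ^ i * (1 - z j) ^ (d - Suc i))) = det (mat d d (\<lambda>(i, j). z j ^ i))"
proof -
  have "z j ^ i * (1 - z j) ^ (d - Suc i) = (\<Sum>l<d. coeff (bernstein_poly d i i) l * z j ^ l)" if "i < d" for i j
    unfolding poly_bernstein_poly[symmetric] by (rule poly_as_sum) (use that in \<open>auto intro: coeff_bernstein_poly_high\<close>)
  hence "mat d d (\<lambda>(i, j). z j ^ i * (1 - z j) ^ (d - Suc i)) =
      mat d d (\<lambda>(i, j). \<Sum>l<d. coeff (bernstein_poly d i i) l * z j ^ l)"
    by (intro eq_matI) auto
  thus ?thesis by (simp only: det_bernstein_rows)
qed

lemma strict_mono_on_unique:
  fixes f g :: "nat \<Rightarrow> nat"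
  assumes f: "strict_mono_on {a..b} f" and g: "strict_mono_on {a..b} g" and im: "f ` {a..b} = g ` {a..b}"
    and k: "k \<in> {a..b}"
  shows "f k = g k"
  using k
proof (induction k rule: less_induct)
  case (less k)
  have *: "\<not> f' k < g' k" if f': "strict_mono_on {a..b} f'" and g': "strict_mono_on {a..b} g'"
    and im': "f' ` {a..b} = g' ` {a..b}" and IH: "\<And>l. l < k \<Longrightarrow> l \<in> {a..b} \<Longrightarrow> f' l = g' l" for f' g' :: "nat \<Rightarrow> nat"
  proof
    assume lt: "f' k < g' k"
    have "f' k \<in> g' ` {a..b}" using im' less.prems by blast
    then obtain l where l: "l \<in> {a..b}" "f' k = g' l" by blast
    show False
    proof (cases "l < k")
      case True
      hence "f' l < f' k" using strict_mono_onD[OF f' l(1) less.prems] by simp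
      thus False using IH[OF True l(1)] l(2) by simp
    next
      case False
      hence "g' k \<le> g' l" using strict_mono_onD[OF g' less.prems l(1)] by (cases "k = l") auto
      thus False using lt l(2) by simp
    qed
  qed
  have "\<not> f k < g k" by (rule *[OF f g im]) (rule less.IH)
  moreover have "\<not> g k < f k" by (rule *[OF g f im[symmetric]]) (rule less.IH[symmetric])
  ultimately show ?case by simp
qed

locale grassmannian =
  fixes n d :: nat and lam :: "nat \<Rightarrow> nat"
  assumes d: "1 \<le> d" "d \<le> n - 1" and part: "is_partition lam" and sub: "lam \<le> rect n d"
begin

lemma dn: "d < n" using d by simp

lemma lam_le: "lam i \<le> n - d"
proof -
  have "lam i \<le> rect n d i" using sub by (simp add: le_fun_def)
  thus ?thesis by (simp add: rect_def split: if_splits)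
qed

lemma lam_anti: "i \<le> j \<Longrightarrow> lam j \<le> lam i"
  using part unfolding is_partition_def antimono_def by blast

definition head :: "nat \<Rightarrow> nat" where "head a = lam (d - a) + a"

lemma head_mono: "1 \<le> a \<Longrightarrow> a < b \<Longrightarrow> b \<le> d \<Longrightarrow> head a < head b"
proof -
  assume "1 \<le> a" "a < b" "b \<le> d"
  moreover from this have "lam (d - a) \<le> lam (d - b)" by (intro lam_anti) simp
  ultimately show ?thesis unfolding head_def by simp
qed

lemma head_range: "a \<in> {1..d} \<Longrightarrow> head a \<in> {1..n}"
  unfolding head_def using lam_le[of "d - a"] dn by auto

lemma grassmannian_exists:
  "\<exists>w. w permutes {1..n} \<and> (\<forall>a\<in>{1..d}. w a = lam (d - a) + a) \<and> strict_mono_on {d+1..n} w"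
proof -
  define C where "C = {1..n} - head ` {1..d}"
  have inj: "inj_on head {1..d}"
    by (rule linorder_inj_onI) (use head_mono in force)+
  have sub: "head ` {1..d} \<subseteq> {1..n}" using head_range by blast
  have fC: "finite C" and cC: "card C = n - d"
    unfolding C_def using card_Diff_subset[OF _ sub] card_image[OF inj] by auto
  obtain h where h: "bij_betw h {..<n - d} C" "strict_mono_on {..<n - d} h"
    using ex_bij_betw_strict_mono_card[OF fC] unfolding cC by blast
  define w where "w a = (if a \<in> {1..d} then head a else if a \<in> {d+1..n} then h (a - (d + 1)) else a)" for a
  have "bij_betw w {1..d} (head ` {1..d})"
    using inj_on_imp_bij_betw[OF inj] by (rule bij_betw_cong[THEN iffD1, rotated]) (simp add: w_def)
  moreover have "bij_betw w {d+1..n} C"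
  proof -
    have "bij_betw (\<lambda>a. a - (d + 1)) {d+1..n} {..<n - d}"
      by (rule bij_betw_byWitness[where f' = "\<lambda>a. a + (d + 1)"]) (use dn in auto)
    from bij_betw_trans[OF this h(1)] show ?thesis
      by (rule bij_betw_cong[THEN iffD1, rotated]) (auto simp: w_def)
  qed
  ultimately have "bij_betw w ({1..d} \<union> {d+1..n}) (head ` {1..d} \<union> C)"
    by (rule bij_betw_combine) (auto simp: C_def)
  moreover have "{1..d} \<union> {d+1..n} = {1..n}" using d by auto
  moreover have "head ` {1..d} \<union> C = {1..n}" unfolding C_def using sub by blast
  ultimately have "w permutes {1..n}"
    by (intro bij_imp_permutes) (auto simp: w_def)
  moreover have "\<forall>a\<in>{1..d}. w a = lam (d - a) + a" by (simp add: w_def head_def)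
  moreover have "strict_mono_on {d+1..n} w"
  proof (rule strict_mono_onI)
    fix a b assume ab: "a \<in> {d+1..n}" "b \<in> {d+1..n}" "a < b"
    have "h (a - (d + 1)) < h (b - (d + 1))"
      by (rule strict_mono_onD[OF h(2)]) (use ab in auto)
    thus "w a < w b" using ab by (simp add: w_def)
  qed
  ultimately show ?thesis by blast
qed

definition w :: "nat \<Rightarrow> nat" where "w = grassmannian_perm n d lam"

lemma w: "w permutes {1..n}" "a \<in> {1..d} \<Longrightarrow> w a = lam (d - a) + a" "strict_mono_on {d+1..n} w"
proof -
  let ?P = "\<lambda>w. w permutes {1..n} \<and> (\<forall>a\<in>{1..d}. w a = lam (d - a) + a) \<and> strict_mono_on {d+1..n} w"
  have uniq: "u = v" if u: "?P u" and v: "?P v" for u v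
  proof
    have eqd: "u a = v a" if "a \<in> {1..d}" for a using u v that by simp
    have im: "f ` {d+1..n} = {1..n} - f ` {1..d}" if "f permutes {1..n}" for f :: "nat \<Rightarrow> nat"
    proof -
      have "{d+1..n} = {1..n} - {1..d}" using d by auto
      thus ?thesis using image_set_diff[OF permutes_inj[OF that], of "{1..n}" "{1..d}"]
        permutes_image[OF that] by simp
    qed
    have "u ` {1..d} = v ` {1..d}" using eqd by (rule image_cong[OF refl])
    hence ims: "u ` {d+1..n} = v ` {d+1..n}" using im u v by metis
    fix a
    show "u a = v a"
    proof (cases "a \<in> {1..n}")
      case False
      hence "u a = a" "v a = a" using u v unfolding permutes_def by blast+
      thus ?thesis by simp
    next
      case True
      show ?thesis
      proof (cases "a \<in> {1..d}")
        case False
        hence "a \<in> {d+1..n}" using True by auto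
        thus ?thesis using strict_mono_on_unique[of "d + 1" n u v a] u v ims by blast
      qed (rule eqd)
    qed
  qed
  have "\<exists>!w. ?P w" using grassmannian_exists uniq by (rule ex_ex1I)
  hence "?P w" unfolding w_def grassmannian_perm_def by (rule theI')
  thus "w permutes {1..n}" "a \<in> {1..d} \<Longrightarrow> w a = lam (d - a) + a" "strict_mono_on {d+1..n} w"
    by blast+
qed

text \<open>Reverses the first \<open>d\<close> positions; it makes the Grassmannian permutation dominant.\<close>

definition rev_head :: "nat \<Rightarrow> nat" where
  "rev_head a = (if a \<in> {1..d} then d + 1 - a else a)"

lemma rev_head: "rev_head permutes {1..d}"
proof (rule bij_imp_permutes)
  show "bij_betw rev_head {1..d} {1..d}"
    by (rule bij_betw_byWitness[where f' = rev_head]) (auto simp: rev_head_def)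
qed (auto simp: rev_head_def)

lemma wr_permutes: "w \<circ> rev_head permutes {1..n}"
  by (rule permutes_compose[OF permutes_subset[OF rev_head] w(1)]) (use d in auto)

lemma wr_head: "a \<in> {1..d} \<Longrightarrow> (w \<circ> rev_head) a = lam (a - 1) + (d + 1 - a)"
proof -
  assume a: "a \<in> {1..d}"
  hence "d + 1 - a \<in> {1..d}" "d - (d + 1 - a) = a - 1" by auto
  with w(2)[of "d + 1 - a"] a show ?thesis by (simp add: rev_head_def)
qed

text \<open>After the reversal the first \<open>d\<close> values decrease, so each is preceded only by larger ones.\<close>

lemma lehmer_wr:
  assumes "a \<in> {1..n}"
  shows "lehmer n (w \<circ> rev_head) a = (if a \<le> d then lam (a - 1) + (d - a) else 0)"
proof (cases "a \<le> d")
  case True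
  hence a: "a \<in> {1..d}" using assms by simp
  have "lehmer n (w \<circ> rev_head) a = (w \<circ> rev_head) a - 1"
  proof (rule lehmer_eq_if_larger_before[OF wr_permutes assms])
    fix j assume j: "1 \<le> j" "j < a"
    have "lam (a - 1) \<le> lam (j - 1)" by (rule lam_anti) (use j in auto)
    thus "(w \<circ> rev_head) a < (w \<circ> rev_head) j"
      using wr_head[OF a] wr_head[of j] a j unfolding atLeastAtMost_iff by linarith
  qed
  also have "\<dots> = lam (a - 1) + (d - a)" unfolding wr_head[OF a] using a by auto
  finally show ?thesis using True by simp
next
  case False
  have "(w \<circ> rev_head) a < (w \<circ> rev_head) j" if "j \<in> {a<..n}" for j
    using strict_mono_onD[OF w(3), of a j] that False assms by (simp add: rev_head_def)
  hence "{j \<in> {a<..n}. (w \<circ> rev_head) j < (w \<circ> rev_head) a} = {}" by (auto dest: less_asym)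
  thus ?thesis using False unfolding lehmer_def by simp
qed

text \<open>The bialternant formula \<open>\<GG>_w = det(a_i(x_j)) / det(x_j^i)\<close>.  As \<open>\<GG>_w\<close> is symmetric in
  \<open>x_1, \<dots>, x_d\<close>, it factors out of the alternant of \<open>\<rho> \<GG>_w\<close>; that alternant may be computed from
  the dominant permutation, where \<open>\<GG>\<close> is a monomial.  Reversing the rows brings both determinants
  to the stated form with the same sign.  The denominator needs \<open>det((1 - x_j)^i)\<close> up to that sign,
  which follows from \<open>vandermonde_bernstein\<close> at the points \<open>1 - x_j\<close> and at the points \<open>x_j\<close>.\<close>

lemma grassmannian_alternant:
  assumes "grothendieck_polynomials n G"
  shows "G w * det (mat d d (\<lambda>(i, j). Var (Suc j) ^ i)) =
    det (mat d d (\<lambda>(i, j). Var (Suc j) ^ (lam (d - Suc i) + i) * (1 - Var (Suc j)) ^ (d - Suc i)))"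
proof -
  interpret grothendieck_family n G by standard (rule assms)
  define x :: "nat \<Rightarrow> nat mpoly" where "x j = Var (Suc j)" for j
  have sym: "swap_adj i (G w) = G w" if i: "1 \<le> i" "i < d" for i
  proof -
    have "lam (d - i) \<le> lam (d - Suc i)" by (rule lam_anti) simp
    hence "w i < w (Suc i)" using w(2)[of i] w(2)[of "Suc i"] i by simp
    thus ?thesis using G_ascent[OF w(1)] i dn by (intro demazure_fixed) simp
  qed
  have dom: "lehmer n (w \<circ> rev_head) j \<le> lehmer n (w \<circ> rev_head) i"
    if "1 \<le> i" "i \<le> j" "j \<le> n" for i j
  proof -
    have "lam (j - 1) \<le> lam (i - 1)" by (rule lam_anti) (use that in simp)
    thus ?thesis using that lehmer_wr[of i] lehmer_wr[of j] by (simp, arith)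
  qed
  have "G (w \<circ> rev_head) = (\<Prod>i\<in>{1..n}. Var i ^ lehmer n (w \<circ> rev_head) i)"
    by (rule G_dominant[OF wr_permutes dom])
  also have "\<dots> = (\<Prod>i\<in>{1..d}. Var i ^ lehmer n (w \<circ> rev_head) i)"
    by (rule prod.mono_neutral_right) (use lehmer_wr dn in auto)
  also have "\<dots> = (\<Prod>j<d. x j ^ (lam j + (d - Suc j)))"
    by (rule prod.reindex_bij_witness[of _ Suc "\<lambda>i. i - 1"]) (use lehmer_wr dn in \<open>auto simp: x_def\<close>)
  finally have Gr: "rho_poly d * G (w \<circ> rev_head) = (\<Prod>j<d. x j ^ (lam j + (d - Suc j)) * (1 - x j) ^ j)"
    unfolding rho_poly_def x_def by (simp add: prod.distrib mult.commute)
  have "G w * alternant d (rho_poly d) = alternant d (rho_poly d * G w)"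
    using alternant_mult_symmetric[OF sym, of d "rho_poly d"] by (simp add: mult.commute)
  also have "\<dots> = alternant d (rho_poly d * G (w \<circ> rev_head))"
    by (rule alternant_invariant[symmetric, OF w(1) _ rev_head]) (use dn in simp)
  also have "\<dots> = det (mat d d (\<lambda>(i, j). x j ^ (lam i + (d - Suc i)) * (1 - x j) ^ i))"
    unfolding Gr unfolding x_def by (rule alternant_prod)
  finally have main: "G w * alternant d (rho_poly d) = \<dots>" .
  define p where "p i = (if i < d then d - Suc i else i)" for i
  have p: "p permutes {0..<d}"
  proof (rule bij_imp_permutes)
    show "bij_betw p {0..<d} {0..<d}"
      by (rule bij_betw_byWitness[where f' = p]) (auto simp: p_def)
  qed (simp add: p_def)
  \<comment> \<open>The sign of the reversal occurs in numerator and denominator and is never evaluated.\<close>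
  have rev: "det (mat d d (\<lambda>(i, j). f (d - Suc i) j)) = signof p * det (mat d d (\<lambda>(i, j). f i j))"
    for f :: "nat \<Rightarrow> nat \<Rightarrow> nat mpoly"
  proof -
    have "mat d d (\<lambda>(i, j). f (d - Suc i) j) = mat d d (\<lambda>(i, j). mat d d (\<lambda>(i, j). f i j) $$ (p i, j))"
      by (rule eq_matI) (auto simp: p_def)
    thus ?thesis using det_permute_rows[OF _ p, of "mat d d (\<lambda>(i, j). f i j)"] by simp
  qed
  have "alternant d (rho_poly d) = det (mat d d (\<lambda>(i, j). (1 - x j) ^ i))"
    using alternant_prod[of d "\<lambda>_. 0" "\<lambda>i. i"] unfolding rho_poly_def x_def by simp
  also have "\<dots> = det (mat d d (\<lambda>(i, j). (1 - x j) ^ i * (1 - (1 - x j)) ^ (d - Suc i)))"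
    by (rule vandermonde_bernstein[symmetric])
  also have "\<dots> = det (mat d d (\<lambda>(i, j). x j ^ (d - Suc i) * (1 - x j) ^ (d - Suc (d - Suc i))))"
    by (intro arg_cong[where f = det] eq_matI) (auto simp: mult.commute)
  also have "\<dots> = signof p * det (mat d d (\<lambda>(i, j). x j ^ i * (1 - x j) ^ (d - Suc i)))"
    by (rule rev)
  also have "\<dots> = signof p * det (mat d d (\<lambda>(i, j). x j ^ i))"
    unfolding vandermonde_bernstein ..
  finally have den: "alternant d (rho_poly d) = signof p * det (mat d d (\<lambda>(i, j). x j ^ i))" .
  have "det (mat d d (\<lambda>(i, j). x j ^ (lam i + (d - Suc i)) * (1 - x j) ^ i)) =
      det (mat d d (\<lambda>(i, j). x j ^ (lam (d - Suc (d - Suc i)) + (d - Suc i)) * (1 - x j) ^ (d - Suc (d - Suc i))))"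
    by (intro arg_cong[where f = det] eq_matI) auto
  also have "\<dots> = signof p * det (mat d d (\<lambda>(i, j). x j ^ (lam (d - Suc i) + i) * (1 - x j) ^ (d - Suc i)))"
    by (rule rev)
  finally have num: "det (mat d d (\<lambda>(i, j). x j ^ (lam i + (d - Suc i)) * (1 - x j) ^ i)) = \<dots>" .
  have "signof p * (G w * det (mat d d (\<lambda>(i, j). x j ^ i))) =
      signof p * det (mat d d (\<lambda>(i, j). x j ^ (lam (d - Suc i) + i) * (1 - x j) ^ (d - Suc i)))"
    using main unfolding den num by (simp add: mult.left_commute)
  thus ?thesis unfolding x_def by (simp add: sign_def split: if_splits)
qed

end

section \<open>Dual stable Grothendieck polynomials as determinants\<close>

lemma to_frac_add: "to_frac (p + q) = to_frac p + to_frac q"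
  and to_frac_mult: "to_frac (p * q) = to_frac p * to_frac q"
  and to_frac_1: "to_frac 1 = 1" and to_frac_0: "to_frac 0 = 0"
  unfolding to_frac_def by (simp_all add: Zero_fract_def One_fract_def)

interpretation to_frac: comm_ring_hom to_frac
  by standard (simp_all add: to_frac_add to_frac_mult to_frac_1 to_frac_0)

interpretation Const: comm_ring_hom "Const :: complex \<Rightarrow> 'v mpoly"
  by standard (simp_all add: Const_def single_add mult_single single_one)

definition scalar :: "complex \<Rightarrow> nat mpoly fract" where
  "scalar c = to_frac (Const c)"

interpretation scalar: comm_ring_hom scalar
  by standard (simp_all add: scalar_def hom_distribs)

definition geo_series :: "nat mpoly fract fps" where "geo_series = Abs_fps (\<lambda>_. 1)"

definition H_series :: "nat mpoly fract fps" where
  "H_series = Abs_fps (\<lambda>k. to_frac (hsym (int k)))"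

lemma geo_series_inverse: "(1 - fps_X) * geo_series = 1"
  unfolding geo_series_def by (rule fps_ext) (simp add: algebra_simps)

text \<open>The alternating binomial coefficients in the definition of \<open>g_\<lambda>\<close> are the coefficients of
  \<open>(1 - u)^{-i}\<close>.\<close>

lemma geo_series_power: "geo_series ^ i = Abs_fps (\<lambda>m. scalar ((- 1) ^ m * ((- of_nat i) gchoose m)))"
proof (induction i)
  case 0
  show ?case by (rule fps_ext) (simp add: fps_one_nth gbinomial_0_left hom_distribs)
next
  case (Suc i)
  define b where "b i = Abs_fps (\<lambda>m. scalar ((- 1) ^ m * ((- of_nat i) gchoose m)))" for i
  have step: "(1 - fps_X) * b (Suc i) = b i"
  proof (rule fps_ext)
    fix m
    show "fps_nth ((1 - fps_X) * b (Suc i)) m = fps_nth (b i) m"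
    proof (cases m)
      case 0
      thus ?thesis unfolding b_def by simp
    next
      case (Suc k)
      have "(- of_nat i :: complex) gchoose Suc k = (- of_nat (Suc i) gchoose k) + (- of_nat (Suc i) gchoose Suc k)"
        using gbinomial_Suc_Suc[of "- of_nat (Suc i) :: complex" k] by simp
      hence "(-1) ^ Suc k * ((- of_nat (Suc i)) gchoose Suc k) - (-1) ^ k * ((- of_nat (Suc i)) gchoose k) =
          (-1) ^ Suc k * ((- of_nat i :: complex) gchoose Suc k)"
        by (simp add: algebra_simps)
      moreover have "fps_nth ((1 - fps_X) * b (Suc i)) (Suc k) =
         fps_nth (b (Suc i)) (Suc k) - fps_nth (b (Suc i)) k" by (simp add: algebra_simps)
      ultimately show ?thesis unfolding Suc b_def fps_nth_Abs_fps
        by (metis scalar.hom_minus)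
    qed
  qed
  have "b (Suc i) = ((1 - fps_X) * geo_series) * b (Suc i)" unfolding geo_series_inverse by simp
  also have "\<dots> = geo_series * ((1 - fps_X) * b (Suc i))" by (simp add: mult_ac)
  also have "\<dots> = geo_series ^ Suc i" unfolding step using Suc unfolding b_def by simp
  finally show ?case unfolding b_def by simp
qed

text \<open>The series whose coefficients of \<open>u^{n-d}, \<dots>, u^{n-1}\<close> form row \<open>i\<close> of the determinant of \<open>g_\<mu>\<close>
  when \<open>s = n - d - \<mu>_i\<close>; the power of \<open>u\<close> aligns all rows with one set of columns.\<close>

definition shape_row :: "nat \<Rightarrow> nat \<Rightarrow> nat mpoly fract fps" where
  "shape_row s i = fps_X ^ (s + i) * (geo_series ^ i * H_series)"

lemma partition_support:
  assumes "is_partition mu"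
  shows "mu k \<noteq> 0 \<longleftrightarrow> k < plength mu"
proof -
  have fin: "finite {k. mu k \<noteq> 0}" and anti: "antimono mu" using assms by (auto simp: is_partition_def)
  have down: "mu j \<noteq> 0" if "mu k \<noteq> 0" "j \<le> k" for j k
    using that antimonoD[OF anti, of j k] by auto
  show ?thesis
  proof
    assume k: "mu k \<noteq> 0"
    have "{..k} \<subseteq> {k. mu k \<noteq> 0}" using down[OF k] by auto
    hence "card {..k} \<le> plength mu" unfolding plength_def by (rule card_mono[OF fin])
    thus "k < plength mu" by simp
  next
    assume k: "k < plength mu"
    show "mu k \<noteq> 0"
    proof
      assume "mu k = 0"
      hence "{k. mu k \<noteq> 0} \<subseteq> {..<k}" using down[of _ k] by (auto simp: not_less[symmetric])
      hence "plength mu \<le> card {..<k}" unfolding plength_def by (intro card_mono) auto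
      thus False using k by simp
    qed
  qed
qed

text \<open>The determinant may be enlarged from the length of \<open>\<mu>\<close> to \<open>d\<close>: the rows of the zero
  parts vanish below the original block and are upper unitriangular in the remaining columns.\<close>

lemma dual_groth_det:
  assumes dn: "d \<le> n" and part: "is_partition mu" and sub: "mu \<le> rect n d"
  shows "to_frac (dual_groth mu) =
    det (mat d d (\<lambda>(i, j). fps_nth (shape_row (n - d - mu i) i) (n - d + j)))"
proof -
  let ?x = "\<lambda>i j. fps_nth (shape_row (n - d - mu i) i) (n - d + j)"
  have le: "mu i \<le> n - d" for i
  proof -
    have "mu i \<le> rect n d i" using sub by (simp add: le_fun_def)
    thus ?thesis by (simp add: rect_def split: if_splits)
  qed
  have ld: "plength mu \<le> d"
  proof (rule ccontr)
    assume "\<not> plength mu \<le> d"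
    hence "mu d \<noteq> 0" using partition_support[OF part, of d] by simp
    moreover have "mu d \<le> rect n d d" using sub by (simp add: le_fun_def)
    ultimately show False by (simp add: rect_def)
  qed
  have x: "?x i j = (if mu i + j < i then 0 else fps_nth (geo_series ^ i * H_series) (mu i + j - i))" for i j
  proof -
    have "n - d + j < n - d - mu i + i \<longleftrightarrow> mu i + j < i" using le[of i] by linarith
    moreover have "n - d + j - (n - d - mu i + i) = mu i + j - i" if "\<not> mu i + j < i"
      using le[of i] that by linarith
    ultimately show ?thesis unfolding shape_row_def fps_X_power_mult_nth by simp
  qed
  have entry: "to_frac (\<Sum>m\<in>{0..nat (int (mu i) + int j - int i)}.
        Const ((- 1) ^ m * ((- of_nat i) gchoose m)) * hsym (int (mu i) + int j - int i - int m)) = ?x i j" for i j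
  proof (cases "mu i + j < i")
    case True
    hence "nat (int (mu i) + int j - int i) = 0" "int (mu i) + int j - int i < 0" by auto
    thus ?thesis unfolding x using True by (simp add: hsym_def hom_distribs)
  next
    case False
    define N where "N = mu i + j - i"
    have N: "int (mu i) + int j - int i = int N" using False unfolding N_def by simp
    have "fps_nth (geo_series ^ i * H_series) N = (\<Sum>m=0..N. scalar ((- 1) ^ m * ((- of_nat i) gchoose m)) * to_frac (hsym (int (N - m))))"
      unfolding fps_mult_nth geo_series_power H_series_def by simp
    also have "\<dots> = to_frac (\<Sum>m\<in>{0..N}. Const ((- 1) ^ m * ((- of_nat i) gchoose m)) * hsym (int N - int m))"
      unfolding scalar_def to_frac.hom_sum to_frac.hom_mult by (rule sum.cong) (auto simp: of_nat_diff)
    finally show ?thesis using False unfolding x N nat_int N_def by simp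
  qed
  define l where "l = plength mu"
  define e where "e = d - l"
  have d: "d = l + e" using ld unfolding e_def l_def by simp
  have dg: "to_frac (dual_groth mu) = det (mat l l (\<lambda>(i, j). ?x i j))"
    unfolding dual_groth_def to_frac.hom_det[symmetric] l_def
    by (intro arg_cong[where f = det] eq_matI) (simp_all add: entry)
  have zero: "mu i = 0" if "l \<le> i" for i
    using partition_support[OF part, of i] that unfolding l_def by auto
  have block: "mat d d (\<lambda>(i, j). ?x i j) = four_block_mat (mat l l (\<lambda>(i, j). ?x i j))
      (mat l e (\<lambda>(i, j). ?x i (l + j))) (0\<^sub>m e l) (mat e e (\<lambda>(i, j). ?x (l + i) (l + j)))" (is "?L = ?R")
  proof (rule eq_matI)
    fix i j assume "i < dim_row ?R" "j < dim_col ?R"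
    hence ij: "i < d" "j < d" using d by auto
    show "?L $$ (i, j) = ?R $$ (i, j)"
    proof (cases "i < l")
      case True
      thus ?thesis using ij d by (cases "j < l") auto
    next
      case False
      hence "?x i j = 0" if "j < l" using that x[of i j] zero[of i] by simp
      thus ?thesis using ij d False by (cases "j < l") auto
    qed
  qed (use d in auto)
  have "det (mat e e (\<lambda>(i, j). ?x (l + i) (l + j))) = 1"
  proof (rule det_upper_unitriangular)
    show "?x (l + i) (l + j) = 0" if "j < i" "i < e" for i j
      unfolding x using that by (simp add: zero)
    show "?x (l + i) (l + i) = 1" if "i < e" for i
      unfolding x by (simp add: zero geo_series_power H_series_def hsym_def hom_distribs)
  qed
  hence "det (mat d d (\<lambda>(i, j). ?x i j)) = det (mat l l (\<lambda>(i, j). ?x i j))"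
    unfolding block by (subst det_four_block_mat_lower_left_zero[of _ l _ e]) auto
  thus ?thesis unfolding dg by simp
qed

definition M_series :: "nat \<Rightarrow> nat mpoly fract fps" where
  "M_series k = geo_series ^ k * H_series"

lemma M_series_Suc: "M_series k = (1 - fps_X) * M_series (Suc k)"
proof -
  have "(1 - fps_X) * M_series (Suc k) = ((1 - fps_X) * geo_series) * M_series k"
    unfolding M_series_def by (simp add: mult_ac)
  thus ?thesis unfolding geo_series_inverse by simp
qed

text \<open>Explains the polynomials \<open>a_i\<close>: a common factor \<open>(1 - u)^{-(d-1)}\<close> is pulled out of all rows.\<close>

lemma fps_bernstein_poly_geo:
  assumes "i < d"
  shows "fps_of_poly (bernstein_poly d \<mu> i) * (geo_series ^ (d - 1) * F) = fps_X ^ \<mu> * (geo_series ^ i * F)"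
proof -
  have 1: "fps_of_poly (bernstein_poly d \<mu> i) = fps_X ^ \<mu> * (1 - fps_X) ^ (d - Suc i)"
    unfolding bernstein_poly_def
    by (simp add: fps_of_poly_mult fps_of_poly_power fps_of_poly_monom fps_of_poly_pCons)
  have 2: "geo_series ^ (d - 1) = geo_series ^ (d - Suc i) * geo_series ^ i"
    using assms by (simp flip: power_add)
  have "fps_of_poly (bernstein_poly d \<mu> i) * (geo_series ^ (d - 1) * F) =
      fps_X ^ \<mu> * (((1 - fps_X) * geo_series) ^ (d - Suc i) * (geo_series ^ i * F))"
    unfolding 1 2 by (simp add: power_mult_distrib mult_ac)
  thus ?thesis unfolding geo_series_inverse by simp
qed

lemma det_geo_rows:
  "det (mat d d (\<lambda>(i, j). fps_nth (fps_X ^ i * (geo_series ^ i * F)) (n - d + j))) =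
   corner_minor n d (geo_series ^ (d - 1) * F)"
proof -
  have "fps_nth (fps_X ^ i * (geo_series ^ i * F)) (n - d + j) =
      (\<Sum>l<d. coeff (bernstein_poly d i i) l * fps_nth (fps_X ^ l * (geo_series ^ (d - 1) * F)) (n - d + j))" if "i < d" for i j
    unfolding fps_bernstein_poly_geo[OF that, symmetric]
    by (rule fps_nth_poly_mult) (use that in \<open>auto intro: coeff_bernstein_poly_high\<close>)
  hence "mat d d (\<lambda>(i, j). fps_nth (fps_X ^ i * (geo_series ^ i * F)) (n - d + j)) =
      mat d d (\<lambda>(i, j). \<Sum>l<d. coeff (bernstein_poly d i i) l * fps_nth (fps_X ^ l * (geo_series ^ (d - 1) * F)) (n - d + j))"
    by (intro eq_matI) auto
  thus ?thesis unfolding corner_minor_def by (simp only: det_bernstein_rows)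
qed

lemma rect_partition: "is_partition (rect n d)"
  unfolding is_partition_def
proof
  show "antimono (rect n d)" unfolding antimono_def rect_def by auto
  show "finite {k. rect n d k \<noteq> 0}" by (rule finite_subset[of _ "{..<d}"]) (auto simp: rect_def)
qed

lemma tau_corner_minor:
  assumes "d \<le> n"
  shows "to_frac (tau n d) = corner_minor n d (M_series (d - 1))"
proof -
  have "to_frac (tau n d) = det (mat d d (\<lambda>(i, j). fps_nth (shape_row (n - d - rect n d i) i) (n - d + j)))"
    unfolding tau_def by (rule dual_groth_det[OF assms rect_partition]) simp
  also have "\<dots> = det (mat d d (\<lambda>(i, j). fps_nth (fps_X ^ i * (geo_series ^ i * H_series)) (n - d + j)))"
    by (intro arg_cong[where f = det] eq_matI) (auto simp: rect_def shape_row_def)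
  finally show ?thesis unfolding det_geo_rows M_series_def .
qed

lemma det_row_sum:
  fixes c :: "nat \<Rightarrow> nat \<Rightarrow> 'a::comm_ring_1"
  assumes r: "r < d"
  shows "det (mat d d (\<lambda>(i, j). if i = r then \<Sum>p\<in>A. f p j else c i j)) =
    (\<Sum>p\<in>A. det (mat d d (\<lambda>(i, j). if i = r then f p j else c i j)))"
proof -
  have expand: "det (mat d d (\<lambda>(i, j). if i = r then g j else c i j)) =
    (\<Sum>q | q permutes {0..<d}. signof q * (g (q r) * (\<Prod>i\<in>{0..<d} - {r}. c i (q i))))" for g
  proof -
    have "(\<Prod>i = 0..<d. mat d d (\<lambda>(i, j). if i = r then g j else c i j) $$ (i, q i)) =
        g (q r) * (\<Prod>i\<in>{0..<d} - {r}. c i (q i))" if q: "q permutes {0..<d}" for q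
    proof -
      have "(\<Prod>i = 0..<d. mat d d (\<lambda>(i, j). if i = r then g j else c i j) $$ (i, q i)) =
          (\<Prod>i = 0..<d. if i = r then g (q i) else c i (q i))"
        by (rule prod.cong) (use permutes_in_image[OF q] in auto)
      also have "\<dots> = g (q r) * (\<Prod>i\<in>{0..<d} - {r}. if i = r then g (q i) else c i (q i))"
        by (subst prod.remove[of _ r]) (use r in auto)
      also have "(\<Prod>i\<in>{0..<d} - {r}. if i = r then g (q i) else c i (q i)) = (\<Prod>i\<in>{0..<d} - {r}. c i (q i))"
        by (rule prod.cong) auto
      finally show ?thesis .
    qed
    thus ?thesis by (subst det_def'[of _ d]) (auto intro!: sum.cong)
  qed
  show ?thesis unfolding expand sum_distrib_left sum_distrib_right by (rule sum.swap)
qed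

text \<open>The sum runs over the partitions in the rectangle.  Summing the row \<open>r\<close> over
  \<open>\<mu>_r = \<mu>_{r+1}, \<dots>, n - d\<close> with the later rows fixed is a finite geometric series: it gives the
  full series, a row with \<open>(1 - u)^{-1}\<close> more, minus a tail that equals row \<open>r + 1\<close> and so does not
  change the determinant.  \<open>T r\<close> consists of the partitions whose first \<open>r\<close> parts are full, which
  stand for rows that are already summed.\<close>

lemma sigma_corner_minor:
  assumes dn: "d \<le> n"
  shows "to_frac (sigma n d) = corner_minor n d (M_series d)"
proof -
  define k where "k = n - d"
  define E where "E i j = fps_nth (fps_X ^ i * (geo_series ^ i * (geo_series * H_series))) (k + j)" for i j
  define e where "e p i j = fps_nth (shape_row (k - p) i) (k + j)" for p i j
  define T where "T r = {mu. is_partition mu \<and> mu \<le> rect n d \<and> (\<forall>i<r. mu i = k)}" for r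
  define D where "D r mu = det (mat d d (\<lambda>(i, j). if i < r then E i j else e (mu i) i j))" for r mu
  have T_le: "mu i \<le> (if i < d then k else 0)" if "mu \<in> T r" for mu r i
    using that unfolding T_def le_fun_def rect_def k_def by auto
  have T_anti: "mu j \<le> mu i" if "mu \<in> T r" "i \<le> j" for mu r i j
    using that unfolding T_def is_partition_def antimono_def by auto
  have T_I: "mu \<in> T r" if "antimono mu" "\<And>i. mu i \<le> (if i < d then k else 0)" "\<And>i. i < r \<Longrightarrow> mu i = k" for mu r
  proof -
    have "finite {i. mu i \<noteq> 0}"
    proof (rule finite_subset)
      show "{i. mu i \<noteq> 0} \<subseteq> {..<d}"
      proof
        fix i assume "i \<in> {i. mu i \<noteq> 0}"
        thus "i \<in> {..<d}" using that(2)[of i] by (auto split: if_splits)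
      qed
    qed simp
    moreover have "mu \<le> rect n d" using that(2) unfolding le_fun_def rect_def k_def by simp
    ultimately show ?thesis using that unfolding T_def is_partition_def by simp
  qed
  \<comment> \<open>Since \<open>u^{i+1} (1 - u)^{-(i+1)}\<close> is \<open>u (1 - u)^{-1}\<close> times \<open>u^i (1 - u)^{-i}\<close>, the tail of the
    geometric series in row \<open>i\<close> is a row of index \<open>i + 1\<close>.\<close>
  have telescope: "(\<Sum>p\<in>{q..k}. e p i j) = E i j - e q (Suc i) j" if "q \<le> k" for q i j
    using that
  proof (induction q rule: inc_induct)
    case base
    have "shape_row 0 i = (1 - fps_X) * (fps_X ^ i * (geo_series ^ i * (geo_series * H_series)))"
      unfolding shape_row_def using geo_series_inverse by (simp add: mult_ac)
    also have "\<dots> = fps_X ^ i * (geo_series ^ i * (geo_series * H_series)) - shape_row 0 (Suc i)"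
      unfolding shape_row_def by (simp add: algebra_simps)
    finally show ?case unfolding e_def E_def by simp
  next
    case (step q)
    have merge: "e q i j + e q (Suc i) j = e (Suc q) (Suc i) j"
    proof -
      define s where "s = k - Suc q"
      have s: "k - q = Suc s" using step unfolding s_def by simp
      have "shape_row (Suc s) i + shape_row (Suc s) (Suc i) = fps_X ^ (Suc s + i) * ((1 - fps_X) * geo_series + fps_X * geo_series) * (geo_series ^ i * H_series)"
        unfolding shape_row_def geo_series_inverse by (simp add: algebra_simps)
      also have "\<dots> = shape_row s (Suc i)" unfolding shape_row_def by (simp add: algebra_simps)
      finally show ?thesis unfolding e_def s s_def[symmetric] by (metis fps_add_nth)
    qed
    have "(\<Sum>p\<in>{q..k}. e p i j) = e q i j + (\<Sum>p\<in>{Suc q..k}. e p i j)"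
      using step by (simp add: sum.atLeast_Suc_atMost)
    also have "\<dots> = e q i j + (E i j - e (Suc q) (Suc i) j)"
      using step.IH by simp
    finally show ?case unfolding merge[symmetric] by simp
  qed
  have row_step: "(\<Sum>p\<in>{nu (Suc r)..k}. D r (nu(r := p))) = D (Suc r) nu"
    if r: "r < d" and nu: "nu \<in> T (Suc r)" for r nu
  proof -
    define c where "c i j = (if i < r then E i j else e (nu i) i j)" for i j
    define q where "q = nu (Suc r)"
    have qk: "q \<le> k" using T_le[OF nu, of "Suc r"] unfolding q_def by (auto split: if_splits)
    have "D r (nu(r := p)) = det (mat d d (\<lambda>(i, j). if i = r then e p r j else c i j))" for p
      unfolding D_def c_def by (intro arg_cong[where f = det] eq_matI) auto
    hence "(\<Sum>p\<in>{q..k}. D r (nu(r := p))) = det (mat d d (\<lambda>(i, j). if i = r then \<Sum>p\<in>{q..k}. e p r j else c i j))"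
      by (simp add: det_row_sum[OF r])
    also have "\<dots> = det (mat d d (\<lambda>(i, j). if i = r then E r j - e q (Suc r) j else c i j))"
      unfolding telescope[OF qk] ..
    also have "\<dots> = det (mat d d (\<lambda>(i, j). if i = r then E r j else c i j))" (is "_ = det (mat d d (\<lambda>(i, j). ?x i j))")
    proof -
      define t where "t i l = (if i = l then 1 else if i = r \<and> l = Suc r then -1 else (0 :: nat mpoly fract))" for i l
      have "(if i = r then E r j - e q (Suc r) j else c i j) = (\<Sum>l<d. t i l * ?x l j)" if ij: "i < d" "j < d" for i j
      proof -
        have "(\<Sum>l<d. t i l * ?x l j) = (\<Sum>l<d. (if i = l then ?x l j else 0) + (if Suc r = l \<and> i = r then - ?x l j else 0))"
          by (rule sum.cong) (auto simp: t_def)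
        also have "\<dots> = ?x i j + (if i = r then \<Sum>l<d. if Suc r = l then - ?x l j else 0 else 0)"
          using ij by (simp add: sum.distrib)
        also have "(\<Sum>l<d. if Suc r = l then - ?x l j else 0) = - e q (Suc r) j"
        proof (cases "Suc r < d")
          case True
          thus ?thesis by (simp add: c_def q_def)
        next
          case False
          \<comment> \<open>In the last row the tail starts beyond \<open>u^{n-1}\<close>.\<close>
          hence "Suc r = d" using r by simp
          moreover from this have "q = 0" using T_le[OF nu, of "Suc r"] unfolding q_def by simp
          ultimately show ?thesis using ij unfolding e_def shape_row_def
            by (simp add: fps_X_power_mult_nth)
        qed
        finally show ?thesis by simp
      qed
      hence "mat d d (\<lambda>(i, j). if i = r then E r j - e q (Suc r) j else c i j) = mat d d (\<lambda>(i, j). \<Sum>l<d. t i l * ?x l j)"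
        by (intro eq_matI) auto
      also have "det \<dots> = det (mat d d (\<lambda>(i, j). ?x i j))"
        unfolding det_row_combination by (subst det_upper_unitriangular) (auto simp: t_def)
      finally show ?thesis .
    qed
    also have "\<dots> = D (Suc r) nu"
      unfolding D_def c_def by (intro arg_cong[where f = det] eq_matI) (auto simp: less_Suc_eq)
    finally show ?thesis unfolding q_def .
  qed
  have finT: "finite (T r)" for r
  proof (rule finite_subset)
    show "T r \<subseteq> {mu. \<forall>i. (i \<in> {..<d} \<longrightarrow> mu i \<in> {..k}) \<and> (i \<notin> {..<d} \<longrightarrow> mu i = 0)}"
    proof
      fix mu assume mu: "mu \<in> T r"
      have "(i \<in> {..<d} \<longrightarrow> mu i \<in> {..k}) \<and> (i \<notin> {..<d} \<longrightarrow> mu i = 0)" for i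
        using T_le[OF mu, of i] by (cases "i < d") auto
      thus "mu \<in> {mu. \<forall>i. (i \<in> {..<d} \<longrightarrow> mu i \<in> {..k}) \<and> (i \<notin> {..<d} \<longrightarrow> mu i = 0)}"
        by blast
    qed
  qed (rule finite_set_of_finite_funs; simp)
  have sum_step: "(\<Sum>mu\<in>T r. D r mu) = (\<Sum>nu\<in>T (Suc r). D (Suc r) nu)" if r: "r < d" for r
  proof -
    have "(\<Sum>mu\<in>T r. D r mu) = (\<Sum>(nu, p)\<in>(SIGMA nu:T (Suc r). {nu (Suc r)..k}). D r (nu(r := p)))"
    proof (rule sum.reindex_bij_witness[of _ "\<lambda>(nu, p). nu(r := p)" "\<lambda>mu. (mu(r := k), mu r)"])
      fix mu assume mu: "mu \<in> T r"
      have full: "mu i = k" if "i < r" for i using mu that unfolding T_def by simp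
      have "mu(r := k) \<in> T (Suc r)"
      proof (rule T_I)
        show "antimono (mu(r := k))"
        proof (rule antimonoI)
          fix x y :: nat assume "x \<le> y"
          thus "(mu(r := k)) y \<le> (mu(r := k)) x"
            using T_anti[OF mu, of x y] T_le[OF mu, of y] full[of x] by (auto split: if_splits)
        qed
        show "(mu(r := k)) i \<le> (if i < d then k else 0)" for i
          using T_le[OF mu, of i] r by auto
        show "(mu(r := k)) i = k" if "i < Suc r" for i using that full[of i] by auto
      qed
      thus "(\<lambda>mu. (mu(r := k), mu r)) mu \<in> (SIGMA nu:T (Suc r). {nu (Suc r)..k})"
        using T_anti[OF mu, of r "Suc r"] T_le[OF mu, of r] r by auto
      show "(\<lambda>(nu, p). nu(r := p)) ((\<lambda>mu. (mu(r := k), mu r)) mu) = mu" by simp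
      show "(case (\<lambda>mu. (mu(r := k), mu r)) mu of (nu, p) \<Rightarrow> D r (nu(r := p))) = D r mu" by simp
    next
      fix z assume "z \<in> (SIGMA nu:T (Suc r). {nu (Suc r)..k})"
      then obtain nu p where z: "z = (nu, p)" and nu: "nu \<in> T (Suc r)" and p: "nu (Suc r) \<le> p" "p \<le> k" by auto
      have full: "nu i = k" if "i \<le> r" for i using nu that unfolding T_def by simp
      show "(\<lambda>mu. (mu(r := k), mu r)) ((\<lambda>(nu, p). nu(r := p)) z) = z"
        unfolding z using full[of r] by (auto simp: fun_upd_idem)
      show "(\<lambda>(nu, p). nu(r := p)) z \<in> T r" unfolding z prod.case
      proof (rule T_I)
        show "antimono (nu(r := p))"
        proof (rule antimonoI)
          fix x y :: nat assume xy: "x \<le> y"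
          consider "x = r" "y = r" | "x = r" "Suc r \<le> y" | "x < r" "y = r" | "x \<noteq> r" "y \<noteq> r"
            using xy by linarith
          thus "(nu(r := p)) y \<le> (nu(r := p)) x"
            using T_anti[OF nu, of x y] T_anti[OF nu, of "Suc r" y] full[of x] p xy by cases auto
        qed
        show "(nu(r := p)) i \<le> (if i < d then k else 0)" for i
          using T_le[OF nu, of i] r p by auto
        show "(nu(r := p)) i = k" if "i < r" for i using that full[of i] by auto
      qed
    qed
    also have "\<dots> = (\<Sum>nu\<in>T (Suc r). \<Sum>p\<in>{nu (Suc r)..k}. D r (nu(r := p)))"
      by (rule sum.Sigma[symmetric]) (use finT in auto)
    also have "\<dots> = (\<Sum>nu\<in>T (Suc r). D (Suc r) nu)"
      by (rule sum.cong) (auto simp: row_step[OF r])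
    finally show ?thesis .
  qed
  have "to_frac (sigma n d) = (\<Sum>mu\<in>T 0. D 0 mu)"
    unfolding sigma_def to_frac.hom_sum T_def D_def
    by (rule sum.cong) (auto simp: dual_groth_det[OF dn] e_def k_def)
  also have "\<dots> = (\<Sum>mu\<in>T d. D d mu)"
  proof -
    have "(\<Sum>mu\<in>T 0. D 0 mu) = (\<Sum>mu\<in>T r. D r mu)" if "r \<le> d" for r
      using that by (induction r) (auto simp: sum_step)
    thus ?thesis by blast
  qed
  also have "T d = {rect n d}"
  proof
    show "T d \<subseteq> {rect n d}"
    proof
      fix mu assume mu: "mu \<in> T d"
      have "mu i = rect n d i" for i
        using T_le[OF mu, of i] mu unfolding T_def rect_def k_def by auto
      thus "mu \<in> {rect n d}" by auto
    qed
    show "{rect n d} \<subseteq> T d"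
      using rect_partition unfolding T_def k_def by (auto simp: rect_def)
  qed
  also have "(\<Sum>mu\<in>{rect n d}. D d mu) = det (mat d d (\<lambda>(i, j). E i j))"
    unfolding D_def by (simp, intro arg_cong[where f = det] eq_matI) auto
  also have "\<dots> = corner_minor n d (geo_series ^ (d - 1) * (geo_series * H_series))"
    unfolding E_def k_def by (rule det_geo_rows)
  also have "\<dots> = corner_minor n d (M_series d)"
  proof (cases d)
    case 0
    thus ?thesis by (simp add: corner_minor_def)
  next
    case (Suc c)
    thus ?thesis unfolding M_series_def by (simp add: mult_ac)
  qed
  finally show ?thesis .
qed

text \<open>Complementing the partition turns \<open>n - d - \<lambda>^\<or>_i\<close> back into a part of \<open>\<lambda>\<close>.  The row that
  arises is the one of \<open>grassmannian_alternant\<close>, with coefficient extraction from \<open>M_{d-1}\<close> in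
  place of evaluation at \<open>x_j\<close>.\<close>

lemma (in grassmannian) dual_partition_det:
  "to_frac (dual_groth (dual_partition n d lam)) =
   det (mat d d (\<lambda>(i, j). fps_nth (fps_of_poly (bernstein_poly d (lam (d - Suc i) + i) i) * M_series (d - 1)) (n - d + j)))"
proof -
  let ?mu = "dual_partition n d lam"
  have "to_frac (dual_groth ?mu) = det (mat d d (\<lambda>(i, j). fps_nth (shape_row (n - d - ?mu i) i) (n - d + j)))"
  proof (rule dual_groth_det)
    show "d \<le> n" using dn by simp
    show "?mu \<le> rect n d" unfolding le_fun_def dual_partition_def rect_def by auto
    show "is_partition ?mu" unfolding is_partition_def
    proof
      show "antimono ?mu"
      proof (rule antimonoI)
        fix x y :: nat assume "x \<le> y"
        thus "?mu y \<le> ?mu x" unfolding dual_partition_def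
          using lam_anti[of "d - 1 - y" "d - 1 - x"] by (auto intro: diff_le_mono2)
      qed
      show "finite {k. ?mu k \<noteq> 0}" by (rule finite_subset[of _ "{..<d}"]) (auto simp: dual_partition_def)
    qed
  qed
  also have "\<dots> = det (mat d d (\<lambda>(i, j). fps_nth (fps_of_poly (bernstein_poly d (lam (d - Suc i) + i) i) * M_series (d - 1)) (n - d + j)))"
  proof (intro arg_cong[where f = det] eq_matI)
    fix i j assume "i < dim_row (mat d d (\<lambda>(i, j). fps_nth (fps_of_poly (bernstein_poly d (lam (d - Suc i) + i) i) * M_series (d - 1)) (n - d + j)))"
      and "j < dim_col (mat d d (\<lambda>(i, j). fps_nth (fps_of_poly (bernstein_poly d (lam (d - Suc i) + i) i) * M_series (d - 1)) (n - d + j)))"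
    hence ij: "i < d" "j < d" by auto
    have "n - d - ?mu i = lam (d - Suc i)" using lam_le[of "d - Suc i"] ij by (simp add: dual_partition_def)
    moreover have "fps_of_poly (bernstein_poly d (lam (d - Suc i) + i) i) * M_series (d - 1) = shape_row (lam (d - Suc i)) i"
      unfolding M_series_def shape_row_def by (rule fps_bernstein_poly_geo[OF ij(1)])
    ultimately show "mat d d (\<lambda>(i, j). fps_nth (shape_row (n - d - ?mu i) i) (n - d + j)) $$ (i, j) =
      mat d d (\<lambda>(i, j). fps_nth (fps_of_poly (bernstein_poly d (lam (d - Suc i) + i) i) * M_series (d - 1)) (n - d + j)) $$ (i, j)"
      using ij by simp
  qed auto
  finally show ?thesis .
qed

section \<open>One expansion for the classical and the quantum side\<close>

text \<open>A vanishing determinant would give a nonzero polynomial of degree less than \<open>d\<close> with \<open>d\<close> roots.\<close>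

lemma vandermonde_nonzero:
  fixes x :: "nat \<Rightarrow> 'a::idom"
  assumes inj: "inj_on x {..<d}"
  shows "det (mat d d (\<lambda>(i, j). x j ^ i)) \<noteq> 0"
proof
  define A where "A = mat d d (\<lambda>(j, i). x j ^ i)"
  assume "det (mat d d (\<lambda>(i, j). x j ^ i)) = 0"
  also have "det (mat d d (\<lambda>(i, j). x j ^ i)) = det A"
    unfolding A_def by (subst det_transpose[symmetric, of _ d]) (auto intro!: arg_cong[where f = det])
  finally obtain v where v: "v \<in> carrier_vec d" "v \<noteq> 0\<^sub>v d" "A *\<^sub>v v = 0\<^sub>v d"
    using det_0_iff_vec_prod_zero[of A d] by (auto simp: A_def)
  define p where "p = Poly (map (\<lambda>i. v $ i) [0..<d])"
  have cp: "coeff p l = (if l < d then v $ l else 0)" for l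
    unfolding p_def coeff_Poly_eq by (auto simp: nth_default_def)
  have "p \<noteq> 0"
  proof
    assume "p = 0"
    hence "v $ l = 0" if "l < d" for l using cp[of l] that by simp
    hence "v = 0\<^sub>v d" using v(1) by (intro eq_vecI) auto
    thus False using v(2) by contradiction
  qed
  have root: "poly p (x j) = 0" if j: "j < d" for j
  proof -
    have "poly p (x j) = (\<Sum>l<d. coeff p l * x j ^ l)" by (rule poly_as_sum) (simp add: cp)
    also have "\<dots> = (A *\<^sub>v v) $ j"
      unfolding A_def using j v(1) by (simp add: scalar_prod_def cp mult.commute atLeast0LessThan)
    finally show ?thesis using v(3) j by simp
  qed
  have "d = card (x ` {..<d})" using card_image[OF inj] by simp
  also have "\<dots> \<le> card {y. poly p y = 0}"
    by (rule card_mono) (use root poly_roots_finite[OF \<open>p \<noteq> 0\<close>] in auto)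
  also have "\<dots> \<le> degree p" by (rule card_poly_roots_bound[OF \<open>p \<noteq> 0\<close>])
  finally have "d \<le> degree p" .
  hence "coeff p (degree p) = 0" unfolding cp by simp
  thus False using \<open>p \<noteq> 0\<close> by simp
qed

lemma (in comm_ring_hom) hom_coeff_linear_power:
  "hom (coeff ([:a, b:] ^ k) l) = coeff ([:hom a, hom b:] ^ k) l"
proof (induction k arbitrary: l)
  case (Suc k)
  thus ?case by (cases l) (simp_all add: hom_distribs)
qed (simp add: hom_distribs)

lemma (in comm_ring_hom) hom_coeff_bernstein_poly: "hom (coeff (bernstein_poly d \<mu> i) l) = coeff (bernstein_poly d \<mu> i) l"
  unfolding bernstein_poly_def coeff_monom_mult using hom_coeff_linear_power[of 1 "-1"]
  by (simp add: hom_distribs)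

context grassmannian
begin

text \<open>The coefficient vectors of the \<open>a_i\<close>, completed to a basis by unit vectors.  The values of the
  Grassmannian permutation, lowered by one, are the lowest exponents of the \<open>a_i\<close> followed by the
  missing exponents.\<close>

definition partition_matrix :: "complex mat" where
  "partition_matrix = mat n n (\<lambda>(i, l). if i < d then coeff (bernstein_poly d (lam (d - Suc i) + i) i) l
     else if l = w (Suc i) - 1 then 1 else 0)"

text \<open>The leading exponents of the rows are a permutation of \<open>0, \<dots>, n - 1\<close>, and sorting the rows
  by them makes the matrix unitriangular.\<close>

lemma partition_matrix_invertible:
  obtains B where "B \<in> carrier_mat n n" "B * partition_matrix = 1\<^sub>m n"
proof -
  define \<pi> where "\<pi> i = (if i < n then w (Suc i) - 1 else i)" for i
  have w_range: "w (Suc i) \<in> {1..n}" if "i < n" for i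
    using permutes_in_image[OF w(1), of "Suc i"] that by simp
  have \<pi>: "\<pi> permutes {0..<n}"
  proof (rule bij_imp_permutes)
    have "\<pi> ` {0..<n} \<subseteq> {0..<n}" using w_range unfolding \<pi>_def by force
    moreover have "inj_on \<pi> {0..<n}"
    proof (rule inj_onI)
      fix i j assume ij: "i \<in> {0..<n}" "j \<in> {0..<n}" "\<pi> i = \<pi> j"
      hence "w (Suc i) = w (Suc j)" using w_range[of i] w_range[of j] unfolding \<pi>_def by auto
      thus "i = j" using perm_neq[OF w(1), of "Suc i" "Suc j"] by auto
    qed
    ultimately show "bij_betw \<pi> {0..<n} {0..<n}"
      by (simp add: bij_betw_def endo_inj_surj)
  qed (simp add: \<pi>_def)
  define a where "a i l = (if i < d then coeff (bernstein_poly d (lam (d - Suc i) + i) i) l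
     else if l = w (Suc i) - 1 then 1 else (0 :: complex))" for i l
  define u where "u k = a (inv_into UNIV \<pi> k)" for k
  have \<pi>_head: "\<pi> i = lam (d - Suc i) + i" if "i < d" for i
    using w(2)[of "Suc i"] that dn unfolding \<pi>_def by simp
  have "det (mat n n (\<lambda>(k, l). u k l)) = 1"
  proof (rule det_upper_unitriangular)
    fix k assume k: "k < n"
    define i where "i = inv_into UNIV \<pi> k"
    have ki: "k = \<pi> i" unfolding i_def using permutes_inverses[OF \<pi>] by simp
    have "i < n" using permutes_in_image[OF \<pi>, of i] k ki by simp
    thus "u k k = 1"
      unfolding u_def i_def[symmetric] a_def using ki \<pi>_head[of i] coeff_bernstein_poly_diag
      by (auto simp: \<pi>_def)
    show "u k l = 0" if "l < k" for l
      unfolding u_def i_def[symmetric] a_def using ki \<pi>_head[of i] \<open>i < n\<close> that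
      by (auto simp: \<pi>_def intro: coeff_bernstein_poly_low)
  qed
  moreover have "partition_matrix = mat n n (\<lambda>(i, l). mat n n (\<lambda>(k, l). u k l) $$ (\<pi> i, l))"
  proof -
    have "u (\<pi> i) = a i" for i unfolding u_def using permutes_inverses[OF \<pi>] by simp
    thus ?thesis unfolding partition_matrix_def
      by (intro eq_matI) (use permutes_in_image[OF \<pi>] in \<open>auto simp: a_def\<close>)
  qed
  ultimately have "det partition_matrix = signof \<pi>"
    using det_permute_rows[OF _ \<pi>, of "mat n n (\<lambda>(k, l). u k l)"] by simp
  hence "det partition_matrix \<noteq> 0" by (simp add: sign_def)
  from det_non_zero_imp_unit[OF _ this, of n undefined] obtain B
    where "B \<in> carrier_mat n n" "B * partition_matrix = 1\<^sub>m n"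
    unfolding Units_def ring_mat_def by (auto simp: partition_matrix_def)
  thus ?thesis by (rule that)
qed

definition inverse_matrix :: "complex mat" where
  "inverse_matrix = (SOME B. B \<in> carrier_mat n n \<and> B * partition_matrix = 1\<^sub>m n)"

lemma inverse_matrix: "inverse_matrix \<in> carrier_mat n n" "inverse_matrix * partition_matrix = 1\<^sub>m n"
  using someI_ex[of "\<lambda>B. B \<in> carrier_mat n n \<and> B * partition_matrix = 1\<^sub>m n"] partition_matrix_invertible
  unfolding inverse_matrix_def by blast+

lemma det_inverse_matrix: "det inverse_matrix \<noteq> 0"
proof
  assume "det inverse_matrix = 0"
  moreover have "det inverse_matrix * det partition_matrix = 1"
    using det_mult[OF inverse_matrix(1), of partition_matrix] inverse_matrix(2)
    by (simp add: partition_matrix_def)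
  ultimately show False by simp
qed

definition basis_coeff :: "(nat \<Rightarrow> nat) \<Rightarrow> complex" where
  "basis_coeff = flag_coeff n d (\<lambda>m i c. \<Sum>l<n. coeff ([:-1, 1:] ^ (m - i)) l * inverse_matrix $$ (l, d + c))"

text \<open>The identity that both sides share.  The numbers \<open>det inverse_matrix\<close> and \<open>basis_coeff \<iota>\<close> are
  complex and independent of the ring, of \<open>z\<close>, \<open>Q\<close> and of the functionals \<open>x\<close>, so equal
  coefficients appear for the classical polynomials and for their quantizations.\<close>

lemma common_expansion:
  fixes h :: "complex \<Rightarrow> 'a::idom" and x :: "nat \<Rightarrow> nat \<Rightarrow> 'a"
  assumes "comm_ring_hom h"
    and kill: "\<And>m j. d \<le> m \<Longrightarrow> m < n \<Longrightarrow> j < d \<Longrightarrow> (\<Sum>l<n. coeff (toda_poly Q z m) l * x l j) = 0"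
  shows "h (det inverse_matrix) *
      det (mat d d (\<lambda>(i, j). \<Sum>l<n. coeff (bernstein_poly d (lam (d - Suc i) + i) i) l * x l j)) =
    det (mat d d (\<lambda>(i, j). x i j)) *
      (\<Sum>\<iota>\<in>basis_index n. h (basis_coeff \<iota>) * (\<Prod>j\<in>{1..n-1}. quantum_elem Q z j (\<iota> j)))"
proof -
  interpret h: comm_ring_hom h by (rule assms(1))
  define A where "A = map_mat h partition_matrix"
  define B where "B = map_mat h inverse_matrix"
  define P where "P = mat n n (\<lambda>(i, l). if i < d then (if i = l then 1 else 0) else coeff (toda_poly Q z i) l)"
  define X where "X = mat n d (\<lambda>(l, j). x l j)"
  have toda_poly_deg: "coeff (toda_poly Q z m) m = 1" "l > m \<Longrightarrow> coeff (toda_poly Q z m) l = 0" for m l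
    using monic_toda_poly[of m Q z] unfolding monic_of_degree_def by auto
  have A: "A \<in> carrier_mat n n" and B: "B \<in> carrier_mat n n" and P: "P \<in> carrier_mat n n"
    and X: "X \<in> carrier_mat n d"
    using inverse_matrix(1) by (simp_all add: A_def B_def P_def X_def partition_matrix_def)
  have "B * A = 1\<^sub>m n"
    unfolding A_def B_def
    using h.mat_hom_mult[OF inverse_matrix(1), of partition_matrix n] inverse_matrix(2) h.mat_hom_one
    by (simp add: partition_matrix_def)
  hence main: "det B * det (mat d d (\<lambda>(i, j). (A * X) $$ (i, j))) =
    det (mat d d (\<lambda>(i, j). X $$ (i, j))) *
    det (mat (n - d) (n - d) (\<lambda>(i, j). (P * B) $$ (d + i, d + j)))"
  proof (intro complementary_minor[OF A B P X])
    show "d \<le> n" using dn by simp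
    show "(P * X) $$ (i, j) = 0" if "d \<le> i" "i < n" "j < d" for i j
    proof -
      have "(P * X) $$ (i, j) = (\<Sum>l<n. coeff (toda_poly Q z i) l * x l j)"
        unfolding P_def X_def using that by (simp add: scalar_prod_def atLeast0LessThan)
      thus ?thesis using kill[OF that] by simp
    qed
  qed (use toda_poly_deg dn in \<open>auto simp: P_def\<close>)
  have detB: "det B = h (det inverse_matrix)" unfolding B_def by (rule h.hom_det)
  have AX: "mat d d (\<lambda>(i, j). (A * X) $$ (i, j)) =
      mat d d (\<lambda>(i, j). \<Sum>l<n. coeff (bernstein_poly d (lam (d - Suc i) + i) i) l * x l j)"
  proof (rule eq_matI)
    fix i j assume "i < dim_row (mat d d (\<lambda>(i, j). \<Sum>l<n. coeff (bernstein_poly d (lam (d - Suc i) + i) i) l * x l j))"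
      and "j < dim_col (mat d d (\<lambda>(i, j). \<Sum>l<n. coeff (bernstein_poly d (lam (d - Suc i) + i) i) l * x l j))"
    hence ij: "i < d" "j < d" by auto
    thus "mat d d (\<lambda>(i, j). (A * X) $$ (i, j)) $$ (i, j) =
      mat d d (\<lambda>(i, j). \<Sum>l<n. coeff (bernstein_poly d (lam (d - Suc i) + i) i) l * x l j) $$ (i, j)"
      unfolding A_def X_def partition_matrix_def using dn
      by (simp add: scalar_prod_def atLeast0LessThan h.hom_coeff_bernstein_poly)
  qed auto
  let ?\<kappa> = "\<lambda>m i c. \<Sum>l<n. coeff ([:-1, 1:] ^ (m - i)) l * inverse_matrix $$ (l, d + c)"
  have PB: "mat (n - d) (n - d) (\<lambda>(i, j). (P * B) $$ (d + i, d + j)) =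
      mat (n - d) (n - d) (\<lambda>(r, c). \<Sum>i\<le>d + r. h (?\<kappa> (d + r) i c) * quantum_elem Q z (d + r) i)" (is "?L = ?R")
  proof (rule eq_matI)
    fix r c assume "r < dim_row ?R" "c < dim_col ?R"
    hence rc: "d + r < n" "d + c < n" by auto
    have "?L $$ (r, c) = (\<Sum>l<n. coeff (toda_poly Q z (d + r)) l * h (inverse_matrix $$ (l, d + c)))"
      unfolding P_def B_def using rc inverse_matrix(1) by (simp add: scalar_prod_def atLeast0LessThan)
    also have "\<dots> = (\<Sum>l<n. \<Sum>i\<le>d + r. quantum_elem Q z (d + r) i * h (coeff ([:-1, 1:] ^ (d + r - i)) l * inverse_matrix $$ (l, d + c)))"
      unfolding toda_poly_def coeff_sum sum_distrib_right
      by (simp add: h.hom_coeff_linear_power h.hom_mult h.hom_uminus mult.assoc)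
    also have "\<dots> = (\<Sum>i\<le>d + r. \<Sum>l<n. quantum_elem Q z (d + r) i * h (coeff ([:-1, 1:] ^ (d + r - i)) l * inverse_matrix $$ (l, d + c)))"
      by (rule sum.swap)
    also have "\<dots> = (\<Sum>i\<le>d + r. h (?\<kappa> (d + r) i c) * quantum_elem Q z (d + r) i)"
      unfolding h.hom_sum sum_distrib_left[symmetric] by (simp add: mult.commute)
    finally show "?L $$ (r, c) = ?R $$ (r, c)" using rc by simp
  qed auto
  have "det ?R = (\<Sum>\<iota>\<in>basis_index n. flag_coeff n d (\<lambda>m i c. h (?\<kappa> m i c)) \<iota> * (\<Prod>j\<in>{1..n-1}. quantum_elem Q z j (\<iota> j)))" for R
    by (rule det_flagged_expansion[OF d(1)]) (use dn in auto)
  hence det_PB: "det (mat (n - d) (n - d) (\<lambda>(i, j). (P * B) $$ (d + i, d + j))) =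
      (\<Sum>\<iota>\<in>basis_index n. h (basis_coeff \<iota>) * (\<Prod>j\<in>{1..n-1}. quantum_elem Q z j (\<iota> j)))"
    unfolding PB h.flag_coeff_hom basis_coeff_def .
  have Xtop: "mat d d (\<lambda>(i, j). X $$ (i, j)) = mat d d (\<lambda>(i, j). x i j)"
    unfolding X_def using dn by (intro eq_matI) auto
  show ?thesis using main unfolding detB AX det_PB Xtop .
qed

lemma bernstein_poly_degree: "i < d \<Longrightarrow> n \<le> l \<Longrightarrow> coeff (bernstein_poly d (lam (d - Suc i) + i) i) l = 0"
  by (rule coeff_bernstein_poly_high) (use lam_le[of "d - Suc i"] dn in simp)

lemma toda_poly_degree: "m < n \<Longrightarrow> n \<le> l \<Longrightarrow> coeff (toda_poly Q z m) l = 0"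
  using monic_toda_poly[of m Q z] unfolding monic_of_degree_def by auto

text \<open>Evaluation at \<open>x_1, \<dots>, x_d\<close> kills \<open>(s - x_1) \<cdots> (s - x_m)\<close> for \<open>m \<ge> d\<close>.\<close>

lemma grothendieck_expansion:
  assumes G: "grothendieck_polynomials n G"
  shows "Const (det inverse_matrix) * G w = (\<Sum>\<iota>\<in>basis_index n. Const (basis_coeff \<iota>) * fprod n \<iota>)"
proof -
  let ?x = "\<lambda>l j. Var (Suc j) ^ l :: nat mpoly"
  let ?V = "det (mat d d (\<lambda>(i, j). ?x i j))"
  let ?S = "\<Sum>\<iota>\<in>basis_index n. Const (basis_coeff \<iota>) * fprod n \<iota>"
  have f: "quantum_elem (\<lambda>_. 0) (\<lambda>j. 1 - Var j) j i = fpoly j i" for j i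
    unfolding quantum_elem_def fpoly_def by simp
  have "Const (det inverse_matrix) *
      det (mat d d (\<lambda>(i, j). \<Sum>l<n. coeff (bernstein_poly d (lam (d - Suc i) + i) i) l * ?x l j)) =
    ?V * (\<Sum>\<iota>\<in>basis_index n. Const (basis_coeff \<iota>) * (\<Prod>j\<in>{1..n-1}. quantum_elem (\<lambda>_. 0) (\<lambda>j. 1 - Var j) j (\<iota> j)))"
  proof (rule common_expansion)
    show "comm_ring_hom (Const :: complex \<Rightarrow> nat mpoly)" by (rule Const.comm_ring_hom_axioms)
    fix m j assume mj: "d \<le> m" "m < n" "j < d"
    have "(\<Sum>l<n. coeff (toda_poly (\<lambda>_. 0) (\<lambda>j. 1 - Var j) m) l * ?x l j) = poly (toda_poly (\<lambda>_. 0) (\<lambda>j. 1 - Var j) m) (Var (Suc j))"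
      by (rule poly_as_sum[symmetric]) (rule toda_poly_degree[OF mj(2)])
    also have "\<dots> = (\<Prod>k\<in>{1..m}. Var (Suc j) - Var k)"
      unfolding toda_poly_classical poly_prod by simp
    also have "\<dots> = 0" by (rule prod_zero) (use mj in \<open>auto intro!: bexI[of _ "Suc j"]\<close>)
    finally show "(\<Sum>l<n. coeff (toda_poly (\<lambda>_. 0) (\<lambda>j. 1 - Var j) m) l * ?x l j) = 0" .
  qed
  also have "(\<Sum>\<iota>\<in>basis_index n. Const (basis_coeff \<iota>) * (\<Prod>j\<in>{1..n-1}. quantum_elem (\<lambda>_. 0) (\<lambda>j. 1 - Var j) j (\<iota> j))) = ?S"
    unfolding f fprod_def ..
  also have "mat d d (\<lambda>(i, j). \<Sum>l<n. coeff (bernstein_poly d (lam (d - Suc i) + i) i) l * ?x l j) =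
      mat d d (\<lambda>(i, j). Var (Suc j) ^ (lam (d - Suc i) + i) * (1 - Var (Suc j)) ^ (d - Suc i))"
    unfolding poly_bernstein_poly[symmetric]
    by (intro eq_matI) (auto simp: poly_as_sum[OF bernstein_poly_degree])
  also have "det \<dots> = G w * ?V" by (rule grassmannian_alternant[OF G, symmetric])
  finally have "?V * (Const (det inverse_matrix) * G w) = ?V * ?S" by (simp add: mult_ac)
  moreover have "?V \<noteq> 0"
    by (rule vandermonde_nonzero) (simp add: inj_on_def Var_eq_iff)
  ultimately show ?thesis by simp
qed

end

context peterson_map
begin

abbreviation "zz j \<equiv> eval_zq (zpoly j)"
abbreviation "QQ j \<equiv> eval_zq (Qpoly n j)"

lemma zz_eq: "1 \<le> i \<Longrightarrow> i \<le> n \<Longrightarrow>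
    zz i = to_frac (tau n i) * to_frac (sigma n (i - 1)) / (to_frac (sigma n i) * to_frac (tau n (i - 1)))"
  using Phi unfolding is_Phi_def eval_zq_def eval_QK_def by (simp add: to_frac_mult)

lemma QQ_eq: "1 \<le> i \<Longrightarrow> i < n \<Longrightarrow>
    QQ i = to_frac (tau n (i - 1)) * to_frac (tau n (i + 1)) / (to_frac (tau n i))\<^sup>2"
  using Phi unfolding is_Phi_def eval_zq_def eval_QK_def
  by (simp add: to_frac_mult power2_eq_square)

lemma tau_sigma_nonzero:
  assumes "n \<ge> 1" "i \<le> n"
  shows "to_frac (tau n i) \<noteq> 0" "to_frac (sigma n i) \<noteq> 0"
proof -
  have nz: "zz j \<noteq> 0" if "1 \<le> j" "j \<le> n" for j
  proof
    assume "zz j = 0"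
    hence "(\<Prod>j\<in>{1..n}. zz j) = 0" using that by (intro prod_zero) auto
    with prod_z_eq_1[OF assms(1)] show False by (metis zero_neq_one)
  qed
  have "to_frac (tau n i) \<noteq> 0 \<and> to_frac (sigma n i) \<noteq> 0"
  proof (cases "i = 0")
    case True
    thus ?thesis using nz[of 1] zz_eq[of 1] assms(1) by auto
  next
    case False
    thus ?thesis using nz[of i] zz_eq[of i] assms(2) by auto
  qed
  thus "to_frac (tau n i) \<noteq> 0" "to_frac (sigma n i) \<noteq> 0" by blast+
qed

lemma toda_solution_peterson:
  assumes "n \<ge> 1"
  shows "toda_solution n M_series zz QQ (\<lambda>i. to_frac (tau n i)) (\<lambda>i. to_frac (sigma n i))"
proof
  show "M_series m = (1 - fps_X) * M_series (Suc m)" for m by (rule M_series_Suc)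
qed (fact tau_corner_minor sigma_corner_minor tau_sigma_nonzero[OF assms] zz_eq QQ_eq)+

text \<open>The functionals are the coefficients of \<open>u^{n-d}, \<dots>, u^{n-1}\<close> in \<open>(\<cdot>) M_{d-1}\<close>; that they kill the
  images of \<open>P_d, \<dots>, P_{n-1}\<close> is \<open>toda_poly_low_shift\<close>.\<close>

lemma quantum_expansion:
  assumes "grassmannian n d lam"
  shows "(\<Sum>\<iota>\<in>basis_index n. scalar (grassmannian.basis_coeff n d lam \<iota>) * eval_zq (Fprod n \<iota>)) =
    scalar (det (grassmannian.inverse_matrix n d lam)) *
    (to_frac (dual_groth (dual_partition n d lam)) / to_frac (tau n d))"
proof -
  interpret grassmannian n d lam by (rule assms)
  have n1: "n \<ge> 1" using dn by simp
  interpret toda_solution n M_series zz QQ "\<lambda>i. to_frac (tau n i)" "\<lambda>i. to_frac (sigma n i)"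
    by (rule toda_solution_peterson[OF n1])
  let ?x = "\<lambda>l j. fps_nth (fps_X ^ l * M_series (d - 1)) (n - d + j)"
  have F: "eval_zq (Fprod n \<iota>) = (\<Prod>j\<in>{1..n-1}. quantum_elem QQ zz j (\<iota> j))" for \<iota>
  proof -
    have "eval_zq (Fprod n \<iota>) = (\<Prod>j\<in>{1..n-1}. eval_zq (Fpoly n j (\<iota> j)))"
      unfolding Fprod_def by (rule eval_prod) (rule Fpoly_in, auto)
    also have "\<dots> = (\<Prod>j\<in>{1..n-1}. quantum_elem QQ zz j (\<iota> j))"
      by (rule prod.cong[OF refl], rule eval_Fpoly) auto
    finally show ?thesis .
  qed
  have "scalar (det inverse_matrix) *
      det (mat d d (\<lambda>(i, j). \<Sum>l<n. coeff (bernstein_poly d (lam (d - Suc i) + i) i) l * ?x l j)) =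
    det (mat d d (\<lambda>(i, j). ?x i j)) *
      (\<Sum>\<iota>\<in>basis_index n. scalar (basis_coeff \<iota>) * (\<Prod>j\<in>{1..n-1}. quantum_elem QQ zz j (\<iota> j)))"
  proof (rule common_expansion)
    show "comm_ring_hom scalar" by (rule scalar.comm_ring_hom_axioms)
    fix m j assume mj: "d \<le> m" "m < n" "j < d"
    have "(\<Sum>l<n. coeff (toda_poly QQ zz m) l * ?x l j) = fps_nth (fps_of_poly (toda_poly QQ zz m) * M_series (d - 1)) (n - d + j)"
      by (rule fps_nth_poly_mult[symmetric]) (rule toda_poly_degree[OF mj(2)])
    also have "\<dots> = 0" by (rule toda_poly_low_shift) (use mj d dn in auto)
    finally show "(\<Sum>l<n. coeff (toda_poly QQ zz m) l * ?x l j) = 0" .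
  qed
  also have "det (mat d d (\<lambda>(i, j). ?x i j)) = to_frac (tau n d)"
    using tau_corner_minor[of d n] dn by (simp add: corner_minor_def)
  also have "mat d d (\<lambda>(i, j). \<Sum>l<n. coeff (bernstein_poly d (lam (d - Suc i) + i) i) l * ?x l j) =
      mat d d (\<lambda>(i, j). fps_nth (fps_of_poly (bernstein_poly d (lam (d - Suc i) + i) i) * M_series (d - 1)) (n - d + j))"
    by (intro eq_matI) (auto simp: fps_nth_poly_mult[OF bernstein_poly_degree])
  also have "det \<dots> = to_frac (dual_groth (dual_partition n d lam))"
    by (rule dual_partition_det[symmetric])
  finally show ?thesis unfolding F using tau_sigma_nonzero(1)[OF n1, of d] dn
    by (simp add: field_simps)
qed

lemma quantization_expansion:
  assumes Q: "quantization_map n Qhat"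
  shows "eval_QK (Qhat (\<Sum>\<iota>\<in>basis_index n. Const (a \<iota>) * fprod n \<iota>)) =
    (\<Sum>\<iota>\<in>basis_index n. scalar (a \<iota>) * eval_zq (Fprod n \<iota>))"
proof -
  interpret L: Modules.module "\<lambda>c p. Const c * p :: nat mpoly"
    by standard (simp_all add: Const.hom_add Const.hom_mult distrib_left distrib_right mult.assoc)
  have L_base: "fprod n \<iota> \<in> L_space n" if "\<iota> \<in> basis_index n" for \<iota>
    unfolding L_space_def by (rule L.span_base) (use that in blast)
  have L_scale: "Const c * f \<in> L_space n" if "f \<in> L_space n" for c f
    using that unfolding L_space_def by (rule L.span_scale)
  have L_zero: "0 \<in> L_space n" unfolding L_space_def by (rule L.span_zero)
  have L_add: "f + g \<in> L_space n" if "f \<in> L_space n" "g \<in> L_space n" for f g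
    using that unfolding L_space_def by (rule L.span_add)
  have carr: "Qhat f \<in> carrier (QK n)" if "f \<in> L_space n" for f
    using Q that unfolding quantization_map_def by blast
  have cC: "QK_class n (Const c) \<in> carrier (QK n)" for c
    by (rule QK_class_carrier) (simp add: zq_polys_def)
  have add: "eval_QK (Qhat (f + g)) = eval_QK (Qhat f) + eval_QK (Qhat g)" if "f \<in> L_space n" "g \<in> L_space n" for f g
    using Q that carr unfolding quantization_map_def by (simp add: eval_QK_add)
  have scale: "eval_QK (Qhat (Const c * f)) = scalar c * eval_QK (Qhat f)" if f: "f \<in> L_space n" for c f
  proof -
    have "Qhat (Const c * f) = QK_class n (Const c) \<otimes>\<^bsub>QK n\<^esub> Qhat f"
      using Q f unfolding quantization_map_def by blast
    thus ?thesis using eval_QK_mult[OF cC carr[OF f]] eval_Const[of c]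
      by (simp add: eval_zq_def scalar_def)
  qed
  have base: "eval_QK (Qhat (fprod n \<iota>)) = eval_zq (Fprod n \<iota>)" if "\<iota> \<in> basis_index n" for \<iota>
    using Q that unfolding quantization_map_def eval_zq_def by simp
  have "(\<Sum>\<iota>\<in>A. Const (a \<iota>) * fprod n \<iota>) \<in> L_space n \<and>
      eval_QK (Qhat (\<Sum>\<iota>\<in>A. Const (a \<iota>) * fprod n \<iota>)) = (\<Sum>\<iota>\<in>A. scalar (a \<iota>) * eval_zq (Fprod n \<iota>))"
    if "finite A" "A \<subseteq> basis_index n" for A
    using that
  proof (induction A)
    case empty
    have "eval_QK (Qhat 0) = 0" using scale[OF L_zero, of 0] by (simp add: Const_0)
    thus ?case using L_zero by simp
  next
    case (insert \<iota> A)
    hence "fprod n \<iota> \<in> L_space n" using L_base by blast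
    thus ?case using insert by (simp add: L_add L_scale add scale base)
  qed
  moreover have "finite (basis_index n)" unfolding basis_index_def by (intro finite_PiE) auto
  ultimately show ?thesis by blast
qed

end

theorem theorem1p7:
  fixes n d :: nat
    and lam :: "nat \<Rightarrow> nat"
    and \<GG> :: "(nat \<Rightarrow> nat) \<Rightarrow> nat mpoly"
    and Qhat :: "nat mpoly \<Rightarrow> zq mpoly set"
    and \<Phi> :: "(zq mpoly set \<times> zq mpoly set) set \<Rightarrow> nat mpoly fract"
  assumes "n \<ge> 2"
    and "grothendieck_polynomials n \<GG>"
    and "quantization_map n Qhat"
    and "is_Phi n \<Phi>"
    and "1 \<le> d" and "d \<le> n - 1"
    and "is_partition lam" and "lam \<le> rect n d"
  shows "\<Phi> (to_loc n (Qhat (\<GG> (grassmannian_perm n d lam)))) =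
         to_frac (dual_groth (dual_partition n d lam)) / to_frac (tau n d)"
proof -
  interpret grassmannian n d lam by standard (use assms in auto)
  interpret peterson_map n \<Phi> by standard (rule assms)
  define b where "b = inverse (det inverse_matrix)"
  have b: "b * det inverse_matrix = 1" unfolding b_def using det_inverse_matrix by simp
  have "\<GG> w = Const b * (Const (det inverse_matrix) * \<GG> w)"
    unfolding mult.assoc[symmetric] Const.hom_mult[symmetric] b by simp
  also have "\<dots> = (\<Sum>\<iota>\<in>basis_index n. Const (b * basis_coeff \<iota>) * fprod n \<iota>)"
    unfolding grothendieck_expansion[OF assms(2)] sum_distrib_left by (simp add: Const.hom_mult mult.assoc)
  finally have "eval_QK (Qhat (\<GG> w)) = (\<Sum>\<iota>\<in>basis_index n. scalar (b * basis_coeff \<iota>) * eval_zq (Fprod n \<iota>))"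
    by (simp only: quantization_expansion[OF assms(3)])
  also have "\<dots> = scalar b * (\<Sum>\<iota>\<in>basis_index n. scalar (basis_coeff \<iota>) * eval_zq (Fprod n \<iota>))"
    unfolding sum_distrib_left by (simp add: scalar.hom_mult mult.assoc)
  also have "\<dots> = scalar (b * det inverse_matrix) * (to_frac (dual_groth (dual_partition n d lam)) / to_frac (tau n d))"
    unfolding quantum_expansion[OF grassmannian_axioms] scalar.hom_mult by (simp only: mult.assoc)
  finally show ?thesis unfolding b eval_QK_def w_def by simp
qed

end
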